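(* Let $1\le k\le n+1$, let $\mathcal G$ be any set with $\mathcal P_+^{k:n}\cup\mathcal P^+_{0:n}\subseteq\mathcal G\subseteq\mathcal F_+^{k:n}$, take any $(\nu_1,\nu_2)\in\mathrm N_+(\mathcal G)\times\mathrm N_+(\mathcal G)$, and take any $s$ and $z$ in $I$. Then $(\nu_1,\nu_2)\in\hat{\mathcal G}$ if and only if all of the following conditions hold: (i') $\nu_1(p_{s;0,i})=\nu_2(p_{s;0,i})\in\mathbb R$ for all $i\in\{0,\dots,k-1\}$; (ii') $\nu_1(p_{a,z;0:k:j})\ge\nu_2(p_{a,z;0:k:j})$ for all $j\in F_{k,n}$; (iii) $\nu_1(p_{t;0,n}^+)\ge\nu_2(p_{t;0,n}^+)$ for all $t\in I$.
   Context: Indices $i,j,k,m,n$ are nonnegative integers. $I\subseteq\mathbb R$ is an interval of nonzero length, $a=\inf I$, $b=\sup I$ ($-\infty\le a<b\le\infty$). $\mathcal B$ is the set of Borel-measurable functions $I\to\mathbb R$; $\mathcal B^+=\{w\in\mathcal B: w>0\}$. $\mathcal{RC}$ is the set of functions $I\to\mathbb R$ that are right-continuous on $I\setminus\{b\}$ and, if $b\in I$, left-continuous at $b$. For $w\in\mathcal B^+$, $\mathcal{RC}_w=\{f\in\mathcal B: f/w\in\mathcal{RC}\}$, and $\mathcal S_w$ is the set of $f\in\mathcal B$ for which there is a function $D_wf\in\mathcal{RC}_w$ (necessarily unique) with $f(x)=f(z)+\int_z^x(D_wf)(u)\,du$ for all $x,z\in I$ (with $\int_z^x=-\int_x^z$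 if $x<z$). Fix a sequence $\mathbf w=(w_0,w_1,\dots)$ of gauge functions in $\mathcal B^+$, each bounded on every compact subset of $I$. Put $\mathcal S^0=\mathcal B$, $f^{(0)}=f/w_0$, and recursively for $j\ge1$: $\mathcal S^j=\{f\in\mathcal S^{j-1}: f^{(j-1)}\in\mathcal S_{w_j}\}$ and $f^{(j)}=(D_{w_j}f^{(j-1)})/w_j$ for $f\in\mathcal S^j$. For integers $j\ge-1$, $\mathcal P^{\le j}=\{p\in\mathcal S^{j+1}: p^{(j+1)}=0\}$. $\mathcal F_+^{k:n}$ is the set of $f\in\mathcal S^n$ such that $f^{(j)}$ is nondecreasing on $I$ for each $j\in\{k-1,\dots,n\}$. $\mathcal P_+^{k:n}=\mathcal P^{\le n}\cap\mathcal F_+^{k:n}$. For $t\in I\cup\{a\}$ and $j\le m$ define $p_{t;j,m}:I\to(-\infty,\infty]$ by $p_{t;m,m}=w_m$ and $p_{t;j,m}(x)=w_j(x)\int_{t+}^{x}p_{t;j+1,m}(u)\,du$ for $j<m$ (real-valued if $t\in I$; if $t=a\notin I$, then $p_{a;j,m}$ is either finite everywhere on $I$ or $\infty$ everywhere on $I$). Put $p_{t;j,m}^+(x)=p_{t;j,m}(x)$ if $x\ge t$ and $0$ if $x<t$. $\mathcal P^+_{0:n}=\{p_{t;0,n}^+: t\in I\}$. Let $F_{k,n}=\{j: k\le j\le n,\ p_{a;k,j}<\infty\}$ (empty if $k=n+1$). For $j\in F_{k,n}$ and $0\le i\le k$ let $p_{a,z;k:k:j}=p_{a;k,j}$ and $p_{a,z;i:k:j}(x)=w_i(x)\int_z^x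 p_{a,z;i+1:k:j}(u)\,du$ for $i<k$. $\mathrm N_+$ is the set of all nonnegative (not necessarily finite) measures on the Borel $\sigma$-algebra over $I$. For Borel $f$ and $\nu\in\mathrm N_+$, $\nu(f)=\int_I f\,d\nu=\nu(f_+)-\nu(f_-)$, which exists if at least one of $\nu(f_+),\nu(f_-)$ is finite; any stated condition on $\nu(f)$ means that $\nu(f)$ exists (in $[-\infty,\infty]$) and satisfies the condition. $\mathrm N_+(\mathcal G)=\{\nu\in\mathrm N_+:\nu(f)>-\infty\text{ for all }f\in\mathcal G\}$. The dual cone is $\hat{\mathcal G}=\{(\nu_1,\nu_2)\in\mathrm N_+(\mathcal G)\times\mathrm N_+(\mathcal G):\nu_1(f)\ge\nu_2(f)\text{ for all }f\in\mathcal G\}$. *)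

theory Defs
  imports "HOL-Analysis.Analysis"
begin

text \<open>
  A function \<open>I \<rightarrow> \<real>\<close> is represented by a total function \<open>real \<Rightarrow> real\<close> whose values
  outside \<open>I\<close> are ignored: all conditions below, including equations between functions, are
  imposed on \<open>I\<close> only. Every class of functions defined here is therefore closed under changing
  values outside \<open>I\<close>.
\<close>

definition left_end :: "real set \<Rightarrow> ereal" where
  "left_end I = Inf (ereal ` I)"

definition right_end :: "real set \<Rightarrow> ereal" where
  "right_end I = Sup (ereal ` I)"

definition borel_funs :: "real set \<Rightarrow> (real \<Rightarrow> real) set" where
  "borel_funs I = borel_measurable (restrict_space borel I)"

definition pos_borel_funs :: "real set \<Rightarrow> (real \<Rightarrow> real) set" where
  "pos_borel_funs I = {w \<in> borel_funs I. \<forall>x\<in>I. w x > 0}"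

definition gauge_seq :: "real set \<Rightarrow> (nat \<Rightarrow> real \<Rightarrow> real) \<Rightarrow> bool" where
  "gauge_seq I w \<longleftrightarrow>
     (\<forall>j. w j \<in> pos_borel_funs I \<and> (\<forall>K. compact K \<and> K \<subseteq> I \<longrightarrow> bounded (w j ` K)))"

definition RC :: "real set \<Rightarrow> (real \<Rightarrow> real) set" where
  "RC I = {f. \<forall>x\<in>I. (ereal x \<noteq> right_end I \<longrightarrow> continuous (at_right x) f) \<and>
                    (ereal x = right_end I \<longrightarrow> continuous (at_left x) f)}"

definition RC_gauge :: "real set \<Rightarrow> (real \<Rightarrow> real) \<Rightarrow> (real \<Rightarrow> real) set" where
  "RC_gauge I w = {f \<in> borel_funs I. (\<lambda>x. f x / w x) \<in> RC I}"

text \<open>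
  Integrability must be demanded explicitly: a right-continuous function need not be locally
  integrable, and the Bochner integral of a non-integrable function is 0 by convention.
\<close>

definition is_gauge_deriv ::
    "real set \<Rightarrow> (real \<Rightarrow> real) \<Rightarrow> (real \<Rightarrow> real) \<Rightarrow> (real \<Rightarrow> real) \<Rightarrow> bool" where
  "is_gauge_deriv I w f g \<longleftrightarrow> g \<in> RC_gauge I w \<and>
     (\<forall>x\<in>I. \<forall>z\<in>I. interval_lebesgue_integrable lborel (ereal z) (ereal x) g \<and>
        f x = f z + (LBINT u=ereal z..ereal x. g u))"

definition S_gauge :: "real set \<Rightarrow> (real \<Rightarrow> real) \<Rightarrow> (real \<Rightarrow> real) set" where
  "S_gauge I w = {f \<in> borel_funs I. \<exists>g. is_gauge_deriv I w f g}"

text \<open>The choice is unique on \<open>I\<close>.\<close>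

definition D_gauge :: "real set \<Rightarrow> (real \<Rightarrow> real) \<Rightarrow> (real \<Rightarrow> real) \<Rightarrow> real \<Rightarrow> real" where
  "D_gauge I w f = (SOME g. is_gauge_deriv I w f g)"

text \<open>\<open>gderiv I w j f\<close> is \<open>f\<^sup>(\<^sup>j\<^sup>)\<close>; it is meaningful for \<open>f \<in> S_space I w j\<close> only.\<close>

primrec gderiv ::
    "real set \<Rightarrow> (nat \<Rightarrow> real \<Rightarrow> real) \<Rightarrow> nat \<Rightarrow> (real \<Rightarrow> real) \<Rightarrow> real \<Rightarrow> real" where
  "gderiv I w 0 f = (\<lambda>x. f x / w 0 x)"
| "gderiv I w (Suc j) f = (\<lambda>x. D_gauge I (w (Suc j)) (gderiv I w j f) x / w (Suc j) x)"

primrec S_space ::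
    "real set \<Rightarrow> (nat \<Rightarrow> real \<Rightarrow> real) \<Rightarrow> nat \<Rightarrow> (real \<Rightarrow> real) set" where
  "S_space I w 0 = borel_funs I"
| "S_space I w (Suc j) = {f \<in> S_space I w j. gderiv I w j f \<in> S_gauge I (w (Suc j))}"

text \<open>\<open>\<P>\<^sup>\<le>\<^sup>j\<close> for \<open>j \<ge> 0\<close> (the case \<open>j = -1\<close> is not needed).\<close>

definition P_le ::
    "real set \<Rightarrow> (nat \<Rightarrow> real \<Rightarrow> real) \<Rightarrow> nat \<Rightarrow> (real \<Rightarrow> real) set" where
  "P_le I w j = {p \<in> S_space I w (Suc j). \<forall>x\<in>I. gderiv I w (Suc j) p x = 0}"

text \<open>The next two definitions are meant for \<open>k \<ge> 1\<close>, so that \<open>k - 1\<close> is not truncated.\<close>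

definition F_plus ::
    "real set \<Rightarrow> (nat \<Rightarrow> real \<Rightarrow> real) \<Rightarrow> nat \<Rightarrow> nat \<Rightarrow> (real \<Rightarrow> real) set" where
  "F_plus I w k n = {f \<in> S_space I w n. \<forall>j\<in>{k - 1..n}. mono_on I (gderiv I w j f)}"

definition P_plus ::
    "real set \<Rightarrow> (nat \<Rightarrow> real \<Rightarrow> real) \<Rightarrow> nat \<Rightarrow> nat \<Rightarrow> (real \<Rightarrow> real) set" where
  "P_plus I w k n = P_le I w n \<inter> F_plus I w k n"

text \<open>
  The integral of an extended-real-valued function. It exists iff the positive or the negative
  part has a finite integral; \<open>ext_integral\<close> has no intended meaning otherwise.
\<close>

definition ext_integral_exists :: "'a measure \<Rightarrow> ('a \<Rightarrow> ereal) \<Rightarrow> bool" where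
  "ext_integral_exists M f \<longleftrightarrow>
     (\<integral>\<^sup>+x. e2ennreal (f x) \<partial>M) < \<infinity> \<or> (\<integral>\<^sup>+x. e2ennreal (- f x) \<partial>M) < \<infinity>"

definition ext_integral :: "'a measure \<Rightarrow> ('a \<Rightarrow> ereal) \<Rightarrow> ereal" where
  "ext_integral M f =
     enn2ereal (\<integral>\<^sup>+x. e2ennreal (f x) \<partial>M) - enn2ereal (\<integral>\<^sup>+x. e2ennreal (- f x) \<partial>M)"

text \<open>
  \<open>ext_interval_integral t x f\<close> is \<open>\<integral>\<^bsub>t+\<^esub>\<^bsup>x\<^esup> f(u) du\<close>, with the usual sign convention for \<open>x < t\<close>.
  It is only used for integrands that are nonnegative or integrable on the interval.
\<close>

definition ext_interval_integral :: "ereal \<Rightarrow> real \<Rightarrow> (real \<Rightarrow> ereal) \<Rightarrow> ereal" where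
  "ext_interval_integral t x f =
     (if t \<le> ereal x
      then ext_integral lborel (\<lambda>u. indicator (einterval t (ereal x)) u * f u)
      else - ext_integral lborel (\<lambda>u. indicator (einterval (ereal x) t) u * f u))"

text \<open>
  Starting from \<open>g\<close> at level \<open>m\<close>, integrate from \<open>t\<close> and multiply by the gauge functions
  \<open>w (m - 1), \<dots>, w j\<close>. Meant for \<open>j \<le> m\<close>.
\<close>

function iter_integral ::
    "(nat \<Rightarrow> real \<Rightarrow> real) \<Rightarrow> ereal \<Rightarrow> (real \<Rightarrow> ereal) \<Rightarrow> nat \<Rightarrow> nat \<Rightarrow> real \<Rightarrow> ereal" where
  "iter_integral w t g j m =
     (if j < m
      then (\<lambda>x. ereal (w j x) * ext_interval_integral t x (iter_integral w t g (Suc j) m))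
      else g)"
  by pat_completeness auto
termination
  by (relation "Wellfounded.measure (\<lambda>(w, t, g, j, m). m - j)") auto

declare iter_integral.simps [simp del]

text \<open>\<open>p_fun w t j m\<close> is \<open>p\<^bsub>t;j,m\<^esub>\<close>.\<close>

definition p_fun ::
    "(nat \<Rightarrow> real \<Rightarrow> real) \<Rightarrow> ereal \<Rightarrow> nat \<Rightarrow> nat \<Rightarrow> real \<Rightarrow> ereal" where
  "p_fun w t j m = iter_integral w t (\<lambda>x. ereal (w m x)) j m"

lemma p_fun_same: "p_fun w t m m = (\<lambda>x. ereal (w m x))"
  by (simp add: p_fun_def iter_integral.simps)

lemma p_fun_less:
  "j < m \<Longrightarrow> p_fun w t j m x = ereal (w j x) * ext_interval_integral t x (p_fun w t (Suc j) m)"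
  unfolding p_fun_def by (subst iter_integral.simps) simp

definition p_fun_plus ::
    "(nat \<Rightarrow> real \<Rightarrow> real) \<Rightarrow> real \<Rightarrow> nat \<Rightarrow> nat \<Rightarrow> real \<Rightarrow> ereal" where
  "p_fun_plus w t j m x = (if t \<le> x then p_fun w (ereal t) j m x else 0)"

text \<open>\<open>p\<^bsub>t;0,n\<^esub>\<^sup>+\<close> is real-valued on \<open>I\<close> for \<open>t \<in> I\<close>.\<close>

definition P_zero_plus ::
    "real set \<Rightarrow> (nat \<Rightarrow> real \<Rightarrow> real) \<Rightarrow> nat \<Rightarrow> (real \<Rightarrow> real) set" where
  "P_zero_plus I w n = {f. \<exists>t\<in>I. \<forall>x\<in>I. ereal (f x) = p_fun_plus w t 0 n x}"

definition F_index :: "real set \<Rightarrow> (nat \<Rightarrow> real \<Rightarrow> real) \<Rightarrow> nat \<Rightarrow> nat \<Rightarrow> nat set" where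
  "F_index I w k n = {j. k \<le> j \<and> j \<le> n \<and> (\<forall>x\<in>I. p_fun w (left_end I) k j x < \<infinity>)}"

text \<open>\<open>p_az_fun I w z i k j\<close> is \<open>p\<^bsub>a,z;i:k:j\<^esub>\<close>.\<close>

definition p_az_fun ::
    "real set \<Rightarrow> (nat \<Rightarrow> real \<Rightarrow> real) \<Rightarrow> real \<Rightarrow> nat \<Rightarrow> nat \<Rightarrow> nat \<Rightarrow> real \<Rightarrow> ereal" where
  "p_az_fun I w z i k j = iter_integral w (ereal z) (p_fun w (left_end I) k j) i k"

lemma p_az_fun_same: "p_az_fun I w z k k j = p_fun w (left_end I) k j"
  by (simp add: p_az_fun_def iter_integral.simps)

lemma p_az_fun_less:
  "i < k \<Longrightarrow> p_az_fun I w z i k j x =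
     ereal (w i x) * ext_interval_integral (ereal z) x (p_az_fun I w z (Suc i) k j)"
  unfolding p_az_fun_def by (subst iter_integral.simps) simp

definition N_plus :: "real set \<Rightarrow> real measure set" where
  "N_plus I = {\<nu>. sets \<nu> = sets (restrict_space borel I)}"

definition N_plus_on :: "real set \<Rightarrow> (real \<Rightarrow> real) set \<Rightarrow> real measure set" where
  "N_plus_on I G = {\<nu> \<in> N_plus I. \<forall>f\<in>G. ext_integral_exists \<nu> (\<lambda>x. ereal (f x)) \<and>
                                        ext_integral \<nu> (\<lambda>x. ereal (f x)) > -\<infinity>}"

definition integral_ge :: "real measure \<Rightarrow> real measure \<Rightarrow> (real \<Rightarrow> ereal) \<Rightarrow> bool" where
  "integral_ge \<nu>1 \<nu>2 f \<longleftrightarrow> ext_integral_exists \<nu>1 f \<and> ext_integral_exists \<nu>2 f \<and>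
     ext_integral \<nu>1 f \<ge> ext_integral \<nu>2 f"

definition integral_eq_real :: "real measure \<Rightarrow> real measure \<Rightarrow> (real \<Rightarrow> ereal) \<Rightarrow> bool" where
  "integral_eq_real \<nu>1 \<nu>2 f \<longleftrightarrow> ext_integral_exists \<nu>1 f \<and> ext_integral_exists \<nu>2 f \<and>
     ext_integral \<nu>1 f = ext_integral \<nu>2 f \<and> \<bar>ext_integral \<nu>1 f\<bar> \<noteq> \<infinity>"

definition dual_cone ::
    "real set \<Rightarrow> (real \<Rightarrow> real) set \<Rightarrow> (real measure \<times> real measure) set" where
  "dual_cone I G = {(\<nu>1, \<nu>2) \<in> N_plus_on I G \<times> N_plus_on I G.
                      \<forall>f\<in>G. integral_ge \<nu>1 \<nu>2 (\<lambda>x. ereal (f x))}"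

end

theory Submission
  imports Defs
begin

text \<open>
  Given \<open>f \<in> \<F>\<^sub>+\<^bsup>k:n\<^esup>\<close>, subtract its Taylor polynomial of order \<open>k - 1\<close> at \<open>z\<close>, whose
  integrals are controlled by (i'). The remainder is a \<open>k\<close>-fold iterated integral from \<open>z\<close> of
  \<open>w\<^sub>k f\<^sup>(\<^sup>k\<^sup>) \<ge> 0\<close>, so it has constant sign on either side of \<open>z\<close>: nonnegative to the right,
  and of sign \<open>(-1)\<^sup>k\<close> to the left. Expanding \<open>f\<^sup>(\<^sup>k\<^sup>)\<close> at the left end \<open>a\<close> produces
  nonnegative multiples of the functions \<open>p\<^bsub>a;k,j\<^esub>\<close> plus an iterated integral of
  \<open>f\<^sup>(\<^sup>n\<^sup>)\<close>. The latter is a mixture over levels \<open>\<lambda>\<close> (layer-cake formula) of iterated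
  integrals of indicators of the upper sets \<open>{f\<^sup>(\<^sup>n\<^sup>) \<ge> \<lambda>}\<close>, and these are, modulo polynomials,
  the functions of (iii), or limits of them, or the last function of (ii'). Because all pieces have
  the same sign at each point, Tonelli's theorem applies separately on the two sides of \<open>z\<close>; the
  measures are \<open>\<sigma>\<close>-finite since (i') makes \<open>w\<^sub>0 > 0\<close> integrable. Layers instead of the
  Stieltjes measure of \<open>f\<^sup>(\<^sup>n\<^sup>)\<close> avoid any continuity requirement, which would fail for
  \<open>n = 0\<close>. Conversely, every function in the conditions lies in \<open>\<G>\<close>, with both signs in
  the case of (i').
\<close>

section \<open>Iterated nonnegative integrals\<close>

text \<open>Infinite integrals are the obstacle: membership of the measures in
  \<open>N_plus_on\<close> bounds only negative parts, so neither \<open>f\<close> nor the functions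
  of (iii) need be integrable, and no difference of integrals may be formed before finiteness is
  known. Everything is therefore compared through one quantity, the increment from \<open>z\<close>
  of the derivative of order \<open>m = k - 1\<close>. The target \<open>f\<close> and each function
  in (ii') and (iii) are reduced modulo polynomials of order at most \<open>m\<close> to the
  iterated integral from \<open>z\<close> of this increment; by (i') an inequality between the
  measures survives the reduction (\<open>integral_ge_perturb\<close>). The increment of
  \<open>f\<close> is a nonnegative mixture of those of test functions and their monotone limits.
  The relation \<open>dominates\<close> is conditional on finite negative halves, so that these have
  to be established for \<open>f\<close> alone: nothing cancels within a mixture, and they pass to
  every summand with nonzero coefficient and to almost every layer
  (\<open>dominates_mixture\<close>). Order \<open>m\<close> rather than \<open>k\<close> also
  covers \<open>k = n + 1\<close>, where a derivative of order \<open>k\<close> need not exist and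
  the layers are cut from the increment itself.\<close>

primrec iter_nn ::
    "(real \<Rightarrow> real \<Rightarrow> ennreal) \<Rightarrow> (nat \<Rightarrow> real \<Rightarrow> ennreal) \<Rightarrow> nat \<Rightarrow> nat \<Rightarrow>
      (real \<Rightarrow> ennreal) \<Rightarrow> real \<Rightarrow> ennreal" where
  "iter_nn K W 0 j h = h"
| "iter_nn K W (Suc d) j h =
     (\<lambda>x. W j x * (\<integral>\<^sup>+u. K x u * iter_nn K W d (Suc j) h u \<partial>lborel))"

text \<open>Joint measurability in the parameter \<open>l\<close> is what Tonelli's theorem for the
  layers requires; a single iterated integral is the special case of a constant family.\<close>

lemma borel_measurable_iter_nn_param:
  assumes K: "case_prod K \<in> borel_measurable (borel \<Otimes>\<^sub>M borel)"
    and W[measurable]: "\<And>j. W j \<in> borel_measurable borel"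
    and h: "(\<lambda>(l, x). h l x) \<in> borel_measurable (M \<Otimes>\<^sub>M borel)"
  shows "(\<lambda>(l, x). iter_nn K W d j (h l) x) \<in> borel_measurable (M \<Otimes>\<^sub>M borel)"
proof (induction d arbitrary: j)
  case 0
  then show ?case using h by simp
next
  case (Suc d)
  have K': "(\<lambda>q. K (snd (fst q)) (snd q)) \<in> borel_measurable ((M \<Otimes>\<^sub>M borel) \<Otimes>\<^sub>M lborel)"
    using measurable_compose[OF _ K, of "\<lambda>q. (snd (fst q), snd q)" "(M \<Otimes>\<^sub>M borel) \<Otimes>\<^sub>M lborel"]
    by simp
  have S': "(\<lambda>q. iter_nn K W d (Suc j) (h (fst (fst q))) (snd q))
      \<in> borel_measurable ((M \<Otimes>\<^sub>M borel) \<Otimes>\<^sub>M lborel)"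
    using measurable_compose[OF _ Suc.IH, of "\<lambda>q. (fst (fst q), snd q)" "(M \<Otimes>\<^sub>M borel) \<Otimes>\<^sub>M lborel"]
    by simp
  have "(\<lambda>p. \<integral>\<^sup>+u. K (snd p) u * iter_nn K W d (Suc j) (h (fst p)) u \<partial>lborel)
      \<in> borel_measurable (M \<Otimes>\<^sub>M borel)"
    by (rule lborel.borel_measurable_nn_integral)
      (use borel_measurable_times_ennreal[OF K' S'] in \<open>simp add: case_prod_beta'\<close>)
  then show ?case
    by (simp add: case_prod_beta')
qed

lemma borel_measurable_iter_nn:
  assumes "case_prod K \<in> borel_measurable (borel \<Otimes>\<^sub>M borel)"
    and "\<And>j. W j \<in> borel_measurable borel" and h: "h \<in> borel_measurable borel"
  shows "iter_nn K W d j h \<in> borel_measurable borel"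
proof -
  have "(\<lambda>(l::real, x). h x) \<in> borel_measurable (borel \<Otimes>\<^sub>M borel)"
    using h by simp
  from borel_measurable_iter_nn_param[OF assms(1,2) this, where d = d and j = j]
  have "(\<lambda>(l::real, x). iter_nn K W d j h x) \<in> borel_measurable (borel \<Otimes>\<^sub>M borel)" .
  from measurable_compose[OF _ this, of "\<lambda>x. (0, x)" borel] show ?thesis
    by simp
qed

lemma measurable_section:
  assumes "case_prod K \<in> borel_measurable (borel \<Otimes>\<^sub>M borel)"
  shows "K x \<in> borel_measurable borel"
  using measurable_compose[OF _ assms, of "\<lambda>u. (x, u)" borel] by simp

text \<open>The kernel is left open because the same calculus serves three instances: integration
  from the left end, unsigned integration from \<open>z\<close>, and the latter with all weights
  equal to 1.\<close>

locale nn_kernel =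
  fixes K :: "real \<Rightarrow> real \<Rightarrow> ennreal" and W :: "nat \<Rightarrow> real \<Rightarrow> ennreal"
  assumes K: "case_prod K \<in> borel_measurable (borel \<Otimes>\<^sub>M borel)"
    and W: "\<And>j. W j \<in> borel_measurable borel"
begin

lemmas measurable_iter_param = borel_measurable_iter_nn_param[OF K W]
lemmas measurable_iter[measurable (raw)] = borel_measurable_iter_nn[OF K W]
lemmas measurable_K[measurable] = measurable_section[OF K]

lemma iter_nn_add:
  assumes [measurable]: "g \<in> borel_measurable borel" "h \<in> borel_measurable borel"
  shows "iter_nn K W d j (\<lambda>x. g x + h x) = (\<lambda>x. iter_nn K W d j g x + iter_nn K W d j h x)"
  by (induction d arbitrary: j) (simp_all add: distrib_left nn_integral_add)

lemma iter_nn_cmult: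
  assumes [measurable]: "h \<in> borel_measurable borel"
  shows "iter_nn K W d j (\<lambda>x. c * h x) = (\<lambda>x. c * iter_nn K W d j h x)"
proof (induction d arbitrary: j)
  case (Suc d)
  have "(\<integral>\<^sup>+u. K x u * (c * iter_nn K W d (Suc j) h u) \<partial>lborel)
      = c * (\<integral>\<^sup>+u. K x u * iter_nn K W d (Suc j) h u \<partial>lborel)" for x
    by (subst nn_integral_cmult[symmetric]) (simp_all add: ac_simps)
  then show ?case
    by (simp add: Suc.IH ac_simps)
qed simp

lemma iter_nn_zero: "iter_nn K W d j (\<lambda>x. 0) = (\<lambda>x. 0)"
  by (induction d arbitrary: j) simp_all

lemma iter_nn_mono:
  assumes "\<And>x. g x \<le> h x"
  shows "iter_nn K W d j g x \<le> iter_nn K W d j h x"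
  using assms
  by (induction d arbitrary: j x) (auto intro!: mult_left_mono nn_integral_mono)

text \<open>Tonelli's theorem, applied once per integration: a superposition of layers at the top
  level becomes a superposition of iterated integrals.\<close>

lemma iter_nn_nn_integral:
  assumes "sigma_finite_measure M"
    and h: "(\<lambda>(l, x). h l x) \<in> borel_measurable (M \<Otimes>\<^sub>M borel)"
  shows "iter_nn K W d j (\<lambda>x. \<integral>\<^sup>+l. h l x \<partial>M) = (\<lambda>x. \<integral>\<^sup>+l. iter_nn K W d j (h l) x \<partial>M)"
proof (induction d arbitrary: j)
  case (Suc d)
  interpret M: sigma_finite_measure M by fact
  interpret P: pair_sigma_finite M lborel ..
  have m: "(\<lambda>(l, u). iter_nn K W d (Suc j) (h l) u) \<in> borel_measurable (M \<Otimes>\<^sub>M lborel)"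
    using measurable_iter_param[OF h, where d = d and j = "Suc j"] by (simp cong: measurable_cong_sets)
  have m1: "(\<lambda>l. iter_nn K W d' j' (h l) x) \<in> borel_measurable M" for d' j' x
    using measurable_compose[OF _ measurable_iter_param[OF h, where d = d' and j = j'], of "\<lambda>l. (l, x)" M] by simp
  have m2: "(\<lambda>l. \<integral>\<^sup>+u. K x u * iter_nn K W d (Suc j) (h l) u \<partial>lborel) \<in> borel_measurable M" for x
  proof (rule lborel.borel_measurable_nn_integral)
    have "(\<lambda>p. K x (snd p)) \<in> borel_measurable (M \<Otimes>\<^sub>M lborel)" by measurable
    from borel_measurable_times_ennreal[OF this m]
    show "(\<lambda>(l, u). K x u * iter_nn K W d (Suc j) (h l) u) \<in> borel_measurable (M \<Otimes>\<^sub>M lborel)"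
      by (simp add: case_prod_beta')
  qed
  have "(\<integral>\<^sup>+u. K x u * (\<integral>\<^sup>+l. iter_nn K W d (Suc j) (h l) u \<partial>M) \<partial>lborel)
      = (\<integral>\<^sup>+l. (\<integral>\<^sup>+u. K x u * iter_nn K W d (Suc j) (h l) u \<partial>lborel) \<partial>M)" for x
  proof -
    have "(\<lambda>p. K x (snd p)) \<in> borel_measurable (M \<Otimes>\<^sub>M lborel)" by measurable
    from borel_measurable_times_ennreal[OF this m]
    have mm: "(\<lambda>(l, u). K x u * iter_nn K W d (Suc j) (h l) u) \<in> borel_measurable (M \<Otimes>\<^sub>M lborel)"
      by (simp add: case_prod_beta')
    show ?thesis
      by (subst P.Fubini'[OF mm, symmetric], rule nn_integral_cong, rule nn_integral_cmult[symmetric], rule m1)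
  qed
  then show ?case
    by (simp add: Suc.IH nn_integral_cmult[OF m2])
qed simp

lemma iter_nn_SUP:
  fixes h :: "nat \<Rightarrow> real \<Rightarrow> ennreal"
  assumes inc: "incseq h" and h[measurable]: "\<And>i. h i \<in> borel_measurable borel"
  shows "iter_nn K W d j (\<lambda>x. SUP i. h i x) = (\<lambda>x. SUP i. iter_nn K W d j (h i) x)"
proof (induction d arbitrary: j)
  case (Suc d)
  have i: "incseq (\<lambda>i u. K x u * iter_nn K W d (Suc j) (h i) u)" for x
    using inc by (auto simp: incseq_def le_fun_def intro!: mult_left_mono iter_nn_mono)
  have "(\<integral>\<^sup>+u. K x u * (SUP i. iter_nn K W d (Suc j) (h i) u) \<partial>lborel)
      = (SUP i. \<integral>\<^sup>+u. K x u * iter_nn K W d (Suc j) (h i) u \<partial>lborel)" for x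
    by (subst nn_integral_monotone_convergence_SUP[OF i, symmetric]) (simp_all add: SUP_mult_left_ennreal)
  then show ?case
    by (simp add: Suc.IH SUP_mult_left_ennreal)
qed simp

end

definition below_kernel :: "real \<Rightarrow> real \<Rightarrow> ennreal" where
  "below_kernel x u = indicator {..<x} u"

text \<open>The orientation of the integral from \<open>z\<close> is dropped here; the lost sign is
  carried separately by \<open>side\<close>.\<close>

definition between_kernel :: "real \<Rightarrow> real \<Rightarrow> real \<Rightarrow> ennreal" where
  "between_kernel z x u = indicator {min z x<..<max z x} u"

lemma measurable_below_kernel: "case_prod below_kernel \<in> borel_measurable (borel \<Otimes>\<^sub>M borel)"
proof -
  have "case_prod below_kernel = indicator {p \<in> space (borel \<Otimes>\<^sub>M borel). snd p < fst p}"
    by (auto simp: below_kernel_def fun_eq_iff space_pair_measure split: split_indicator)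
  then show ?thesis by simp
qed

lemma measurable_between_kernel: "case_prod (between_kernel z) \<in> borel_measurable (borel \<Otimes>\<^sub>M borel)"
proof -
  have "case_prod (between_kernel z) =
      indicator {p \<in> space (borel \<Otimes>\<^sub>M borel). min z (fst p) < snd p \<and> snd p < max z (fst p)}"
    by (auto simp: between_kernel_def fun_eq_iff space_pair_measure split: split_indicator)
  then show ?thesis by simp
qed

section \<open>Integrals with respect to nonnegative measures\<close>

lemma ext_integral_cong:
  assumes "\<And>x. x \<in> space M \<Longrightarrow> f x = g x"
  shows "ext_integral M f = ext_integral M g" "ext_integral_exists M f = ext_integral_exists M g"
  using assms by (simp_all add: ext_integral_def ext_integral_exists_def cong: nn_integral_cong)

lemma ext_integral_ereal:
  "ext_integral M (\<lambda>x. ereal (f x)) =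
     enn2ereal (\<integral>\<^sup>+x. ennreal (f x) \<partial>M) - enn2ereal (\<integral>\<^sup>+x. ennreal (- f x) \<partial>M)"
  "ext_integral_exists M (\<lambda>x. ereal (f x)) \<longleftrightarrow>
     (\<integral>\<^sup>+x. ennreal (f x) \<partial>M) < \<infinity> \<or> (\<integral>\<^sup>+x. ennreal (- f x) \<partial>M) < \<infinity>"
  by (simp_all add: ext_integral_def ext_integral_exists_def)

lemma ext_integral_nonneg:
  assumes "\<And>x. x \<in> space M \<Longrightarrow> 0 \<le> f x"
  shows "ext_integral M f = enn2ereal (\<integral>\<^sup>+x. e2ennreal (f x) \<partial>M)" "ext_integral_exists M f"
proof -
  have "(\<integral>\<^sup>+x. e2ennreal (- f x) \<partial>M) = (\<integral>\<^sup>+x. 0 \<partial>M)"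
    using assms by (intro nn_integral_cong) (auto simp: e2ennreal_neg)
  then show "ext_integral M f = enn2ereal (\<integral>\<^sup>+x. e2ennreal (f x) \<partial>M)" "ext_integral_exists M f"
    by (simp_all add: ext_integral_def ext_integral_exists_def zero_ennreal.rep_eq)
qed

text \<open>Existence has to be stated beside the bound, because \<infinity> - \<infinity> evaluates
  to \<infinity> in \<open>ereal\<close>: two infinite parts would otherwise satisfy the right-hand
  side.\<close>

lemma neg_part_finite_iff:
  "(\<integral>\<^sup>+x. ennreal (- f x) \<partial>M) < \<infinity> \<longleftrightarrow>
     ext_integral_exists M (\<lambda>x. ereal (f x)) \<and> ext_integral M (\<lambda>x. ereal (f x)) > -\<infinity>"
  (is "?N < \<infinity> \<longleftrightarrow> _")
proof (cases "?N < \<infinity>")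
  case True
  then have "ext_integral M (\<lambda>x. ereal (f x)) > -\<infinity>"
    unfolding ext_integral_ereal
    by (cases ?N; cases "\<integral>\<^sup>+x. ennreal (f x) \<partial>M") (auto simp: enn2ereal_ennreal)
  then show ?thesis using True by (simp add: ext_integral_ereal)
next
  case False
  then have N: "?N = \<infinity>" by (simp add: less_top[symmetric])
  show ?thesis
    unfolding ext_integral_ereal N
    by (cases "\<integral>\<^sup>+x. ennreal (f x) \<partial>M") (auto simp: enn2ereal_ennreal)
qed

lemma ext_integral_real_iff:
  assumes "f \<in> borel_measurable M"
  shows "ext_integral_exists M (\<lambda>x. ereal (f x)) \<and> \<bar>ext_integral M (\<lambda>x. ereal (f x))\<bar> \<noteq> \<infinity>
    \<longleftrightarrow> integrable M f" (is ?a)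
    and "integrable M f \<Longrightarrow> ext_integral M (\<lambda>x. ereal (f x)) = ereal (\<integral>x. f x \<partial>M)" (is "_ \<Longrightarrow> ?b")
proof -
  show ?a
    unfolding real_integrable_def ext_integral_ereal
    using assms
    by (cases "\<integral>\<^sup>+x. ennreal (f x) \<partial>M"; cases "\<integral>\<^sup>+x. ennreal (- f x) \<partial>M")
      (auto simp: enn2ereal_ennreal)
  assume "integrable M f"
  then show ?b
    unfolding ext_integral_ereal real_lebesgue_integral_def[OF \<open>integrable M f\<close>]
    by (cases "\<integral>\<^sup>+x. ennreal (f x) \<partial>M"; cases "\<integral>\<^sup>+x. ennreal (- f x) \<partial>M")
      (auto simp: enn2ereal_ennreal real_integrable_def)
qed

text \<open>The inequality of differences with the negative parts moved across. This is legitimate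
  as they are finite, while the positive parts may be infinite.\<close>

lemma integral_ge_iff_nn:
  assumes "(\<integral>\<^sup>+x. ennreal (- f x) \<partial>\<nu>1) < \<infinity>" "(\<integral>\<^sup>+x. ennreal (- f x) \<partial>\<nu>2) < \<infinity>"
  shows "integral_ge \<nu>1 \<nu>2 (\<lambda>x. ereal (f x)) \<longleftrightarrow>
    (\<integral>\<^sup>+x. ennreal (f x) \<partial>\<nu>2) + (\<integral>\<^sup>+x. ennreal (- f x) \<partial>\<nu>1)
      \<le> (\<integral>\<^sup>+x. ennreal (f x) \<partial>\<nu>1) + (\<integral>\<^sup>+x. ennreal (- f x) \<partial>\<nu>2)"
proof -
  obtain n1 n2 where n: "(\<integral>\<^sup>+x. ennreal (- f x) \<partial>\<nu>1) = ennreal n1" "0 \<le> n1"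
      "(\<integral>\<^sup>+x. ennreal (- f x) \<partial>\<nu>2) = ennreal n2" "0 \<le> n2"
    using assms by (auto simp: less_top_ennreal)
  show ?thesis
    unfolding integral_ge_def ext_integral_ereal n
    by (cases "\<integral>\<^sup>+x. ennreal (f x) \<partial>\<nu>1"; cases "\<integral>\<^sup>+x. ennreal (f x) \<partial>\<nu>2")
      (auto simp: enn2ereal_ennreal n ennreal_plus[symmetric] top_unique simp del: ennreal_plus)
qed

text \<open>The splitting into positive and negative parts of \<open>p\<close>, \<open>h\<close> and
  their sum, rearranged without subtraction, holds pointwise and is then integrated; so it is valid
  for infinite integrals as well.\<close>

lemma nn_integral_pos_neg_parts:
  fixes p h :: "'a \<Rightarrow> real"
  assumes [measurable]: "p \<in> borel_measurable M" "h \<in> borel_measurable M"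
  shows "(\<integral>\<^sup>+x. ennreal (p x + h x) \<partial>M) + (\<integral>\<^sup>+x. ennreal (- p x) \<partial>M) + (\<integral>\<^sup>+x. ennreal (- h x) \<partial>M)
    = (\<integral>\<^sup>+x. ennreal (- (p x + h x)) \<partial>M) + (\<integral>\<^sup>+x. ennreal (p x) \<partial>M) + (\<integral>\<^sup>+x. ennreal (h x) \<partial>M)"
proof -
  have *: "ennreal (a + b) + ennreal (- a) + ennreal (- b) = ennreal (- (a + b)) + ennreal a + ennreal b"
    for a b :: real
    by (cases "0 \<le> a"; cases "0 \<le> b"; cases "0 \<le> a + b")
      (auto simp: ennreal_neg ennreal_plus[symmetric] simp del: ennreal_plus)
  show ?thesis
    by (simp add: nn_integral_add[symmetric] * del: minus_add_distrib)
qed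

lemma integral_ge_cong:
  assumes "space \<nu>1 = I" "space \<nu>2 = I" "\<And>x. x \<in> I \<Longrightarrow> f x = g x"
  shows "integral_ge \<nu>1 \<nu>2 f \<longleftrightarrow> integral_ge \<nu>1 \<nu>2 g"
    "integral_eq_real \<nu>1 \<nu>2 f \<longleftrightarrow> integral_eq_real \<nu>1 \<nu>2 g"
  using ext_integral_cong[of \<nu>1 f g] ext_integral_cong[of \<nu>2 f g] assms
  by (simp_all add: integral_ge_def integral_eq_real_def)

section \<open>Gauge derivatives\<close>

lemma set_integral_neg:
  fixes g :: "real \<Rightarrow> real"
  assumes "x < y" "set_integrable lborel {x<..<y} g" "\<And>u. x < u \<Longrightarrow> u < y \<Longrightarrow> g u < 0"
  shows "(LINT u:{x<..<y}|lborel. g u) < 0"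
proof (rule ccontr)
  let ?f = "\<lambda>u. indicator {x<..<y} u * (- g u)"
  have i: "integrable lborel ?f"
    using assms(2) unfolding set_integrable_def by simp
  have nn: "0 \<le> ?f u" for u
    using assms(3)[of u] by (auto split: split_indicator)
  assume "\<not> ?thesis"
  then have "(\<integral>u. ?f u \<partial>lborel) \<le> 0"
    by (simp add: set_lebesgue_integral_def)
  then have "(\<integral>u. ?f u \<partial>lborel) = 0"
    using integral_nonneg_AE[of ?f lborel] nn by (simp add: order_antisym)
  then have "AE u in lborel. ?f u = 0"
    using integral_nonneg_eq_0_iff_AE[OF i] nn by simp
  then have "AE u in lborel. u \<notin> {x<..<y}"
    by eventually_elim (use assms(3) in \<open>force split: split_indicator\<close>)
  then have "{x<..<y} \<in> null_sets lborel"
    by (subst AE_iff_null_sets) auto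
  then show False
    using assms(1) by (simp add: null_sets_def)
qed

section \<open>Integrals over subintervals of \<open>I\<close>, uniqueness of gauge derivatives, and
  chains of derivatives\<close>

locale gauge_system =
  fixes I :: "real set" and w :: "nat \<Rightarrow> real \<Rightarrow> real"
  assumes interval: "is_interval I"
    and nontrivial: "\<exists>x\<in>I. \<exists>y\<in>I. x < y"
    and gauge: "gauge_seq I w"
begin

lemma I_borel[measurable]: "I \<in> sets borel"
  by (rule real_interval_borel_measurable[OF interval])

lemma mem_I: "\<lbrakk>x \<in> I; y \<in> I; x \<le> u; u \<le> y\<rbrakk> \<Longrightarrow> u \<in> I"
  using mem_is_interval_1_I[OF interval] by blast

lemma w_pos: "x \<in> I \<Longrightarrow> 0 < w j x"
  using gauge by (auto simp: gauge_seq_def pos_borel_funs_def)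

lemma w_borel: "w j \<in> borel_funs I"
  using gauge by (auto simp: gauge_seq_def pos_borel_funs_def)

lemma w_bounded:
  assumes "x \<in> I" "y \<in> I"
  obtains C where "0 \<le> C" "\<And>u. x \<le> u \<Longrightarrow> u \<le> y \<Longrightarrow> w j u \<le> C"
proof -
  have "compact {x..y}" "{x..y} \<subseteq> I"
    using mem_I[OF assms] by auto
  then have "bounded (w j ` {x..y})"
    using gauge by (auto simp: gauge_seq_def)
  then obtain C where "0 < C" "\<forall>u\<in>{x..y}. \<bar>w j u\<bar> \<le> C"
    by (auto simp: bounded_pos)
  then show thesis
    by (intro that[of C]) (auto simp: abs_le_iff)
qed

lemma borel_funs_iff: "f \<in> borel_funs I \<longleftrightarrow> (\<lambda>x. indicator I x * f x) \<in> borel_measurable borel"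
  unfolding borel_funs_def by (subst borel_measurable_restrict_space_iff) auto

lemma borel_funs_cong: "(\<And>x. x \<in> I \<Longrightarrow> f x = g x) \<Longrightarrow> f \<in> borel_funs I \<longleftrightarrow> g \<in> borel_funs I"
  unfolding borel_funs_def by (rule measurable_cong) (simp add: space_restrict_space)

lemma borel_funs_arith:
  assumes "f \<in> borel_funs I" "g \<in> borel_funs I"
  shows "(\<lambda>x. f x * g x) \<in> borel_funs I" "(\<lambda>x. f x / g x) \<in> borel_funs I"
    "(\<lambda>x. f x + g x) \<in> borel_funs I" "(\<lambda>x. f x - g x) \<in> borel_funs I"
  using assms unfolding borel_funs_def by measurable

lemma borel_funs_uminus: "f \<in> borel_funs I \<Longrightarrow> (\<lambda>x. - f x) \<in> borel_funs I"
  unfolding borel_funs_def by measurable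

lemma borel_funs_borel: "f \<in> borel_measurable borel \<Longrightarrow> f \<in> borel_funs I"
  unfolding borel_funs_def by (rule measurable_restrict_space1)

lemma borel_funs_continuous: "continuous_on I f \<Longrightarrow> f \<in> borel_funs I"
  unfolding borel_funs_def by (rule borel_measurable_continuous_on_restrict)

definition locally_integrable :: "(real \<Rightarrow> real) \<Rightarrow> bool" where
  "locally_integrable g \<longleftrightarrow>
     (\<forall>x\<in>I. \<forall>y\<in>I. interval_lebesgue_integrable lborel (ereal x) (ereal y) g)"

lemma locally_integrableD:
  assumes "locally_integrable g" "x \<in> I" "y \<in> I"
  shows "interval_lebesgue_integrable lborel (ereal x) (ereal y) g"
    "x \<le> y \<Longrightarrow> set_integrable lborel {x<..<y} g"
proof -
  show *: "interval_lebesgue_integrable lborel (ereal x) (ereal y) g"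
    using assms by (auto simp: locally_integrable_def)
  show "x \<le> y \<Longrightarrow> set_integrable lborel {x<..<y} g"
    using * by (simp add: interval_lebesgue_integrable_def)
qed

lemma locally_integrableI:
  assumes "\<And>x y. \<lbrakk>x \<in> I; y \<in> I; x < y\<rbrakk> \<Longrightarrow> set_integrable lborel {x<..<y} g"
  shows "locally_integrable g"
  unfolding locally_integrable_def
proof (intro ballI)
  fix x y assume "x \<in> I" "y \<in> I"
  then show "interval_lebesgue_integrable lborel (ereal x) (ereal y) g"
    using assms[of x y] assms[of y x]
    by (cases x y rule: linorder_cases)
      (auto simp: interval_lebesgue_integrable_def einterval_same set_integrable_def)
qed

lemma interval_integral_cong_I:
  assumes "\<And>u. u \<in> I \<Longrightarrow> f u = g u" "x \<in> I" "y \<in> I"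
  shows "(LBINT u=ereal x..ereal y. f u) = (LBINT u=ereal x..ereal y. g u)"
proof (rule interval_integral_cong)
  fix u assume "u \<in> einterval (min (ereal x) (ereal y)) (max (ereal x) (ereal y))"
  then have "u \<in> I"
    using mem_I[OF assms(2,3), of u] mem_I[OF assms(3,2), of u]
    by (auto simp: einterval_def min_def max_def split: if_splits)
  then show "f u = g u" by (rule assms)
qed

lemma locally_integrable_cong:
  assumes "\<And>u. u \<in> I \<Longrightarrow> f u = g u"
  shows "locally_integrable f \<longleftrightarrow> locally_integrable g"
proof -
  have "set_integrable lborel {x<..<y} f = set_integrable lborel {x<..<y} g"
    if "x \<in> I" "y \<in> I" for x y
    using assms mem_I[OF that] by (intro set_integrable_cong) auto
  then show ?thesis
    using locally_integrableI locally_integrableD(2) by (metis less_imp_le)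
qed

lemma locally_integrable_arith:
  assumes "locally_integrable f" "locally_integrable g"
  shows "locally_integrable (\<lambda>x. f x + g x)" "locally_integrable (\<lambda>x. f x - g x)"
    "locally_integrable (\<lambda>x. c * f x)"
  using assms by (auto simp: locally_integrable_def)

lemma interval_integral_split:
  assumes "locally_integrable g" "x \<in> I" "y \<in> I" "z \<in> I"
  shows "(LBINT u=ereal x..ereal y. g u) + (LBINT u=ereal y..ereal z. g u)
    = (LBINT u=ereal x..ereal z. g u)"
proof (rule interval_integral_sum)
  have "min x (min y z) \<in> I" "max x (max y z) \<in> I"
    using assms by (auto simp: min_def max_def)
  from locally_integrableD(1)[OF assms(1) this]
  show "interval_lebesgue_integrable lborel (min (ereal x) (min (ereal y) (ereal z)))
     (max (ereal x) (max (ereal y) (ereal z))) g"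
    by (simp add: ereal_min[symmetric] ereal_max[symmetric] del: ereal_min ereal_max)
qed

lemma continuous_on_interval_integral:
  assumes g: "locally_integrable g" and z: "z \<in> I"
  shows "continuous_on I (\<lambda>x. LBINT u=ereal z..ereal x. g u)"
proof -
  let ?G = "\<lambda>x. LBINT u=ereal z..ereal x. g u"
  have cont: "continuous_on {x..y} ?G" if xy: "x \<in> I" "y \<in> I" for x y
  proof (cases "x \<le> y")
    case True
    have si: "set_integrable lborel {x<..<y'} g" if "y' \<in> {x..y}" for y'
      using locally_integrableD(2)[OF g xy(1), of y'] mem_I[OF xy, of y'] that by auto
    have "g integrable_on {x..y}"
      using set_borel_integral_eq_integral(1)[OF si[of y]] True
      by (simp add: integrable_on_open_interval_real)
    then have "continuous_on {x..y} (\<lambda>t. ?G x + integral {x..t} g)"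
      by (intro continuous_intros indefinite_integral_continuous_1)
    moreover have "?G x + integral {x..t} g = ?G t" if t: "t \<in> {x..y}" for t
    proof -
      have "integral {x..t} g = (LINT u:{x<..<t}|lborel. g u)"
        using set_borel_integral_eq_integral(2)[OF si[OF t]]
        by (simp only: integral_open_interval_real)
      also have "\<dots> = (LBINT u=ereal x..ereal t. g u)"
        using t by (subst interval_lebesgue_integral_le_eq) auto
      finally show ?thesis
        using interval_integral_split[OF g z xy(1), of t] mem_I[OF xy] t by simp
    qed
    ultimately show ?thesis
      by (rule continuous_on_eq)
  qed simp
  \<comment> \<open>\<open>I\<close> may be open, closed or half-open. A convergent sequence
    together with its limit in \<open>I\<close> is compact, so it lies in some \<open>{a..b}\<close>
    with end points in \<open>I\<close>, where the compact case applies.\<close>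
  show ?thesis
    unfolding continuous_on_sequentially
  proof (intro allI ballI impI, elim conjE)
    fix xs :: "nat \<Rightarrow> real" and x
    assume x: "x \<in> I" and xs: "\<forall>n. xs n \<in> I" and lim: "xs \<longlonglongrightarrow> x"
    let ?S = "insert x (range xs)"
    have S: "compact ?S" "?S \<noteq> {}" "?S \<subseteq> I"
      using compact_sequence_with_limit[OF lim] x xs by auto
    obtain a where a: "a \<in> ?S" "\<forall>t\<in>?S. a \<le> t"
      using compact_attains_inf[OF S(1,2)] by blast
    obtain b where b: "b \<in> ?S" "\<forall>t\<in>?S. t \<le> b"
      using compact_attains_sup[OF S(1,2)] by blast
    have "continuous_on {a..b} ?G"
      by (rule cont) (use a b S in blast)+
    then show "(?G \<circ> xs) \<longlonglongrightarrow> ?G x"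
      unfolding continuous_on_sequentially using a b lim by auto
  qed
qed

lemma locally_integrable_w_mult:
  assumes phi: "\<phi> \<in> borel_funs I"
    and bd: "\<And>x y. \<lbrakk>x \<in> I; y \<in> I; x < y\<rbrakk> \<Longrightarrow> \<exists>C. \<forall>u\<in>{x..y}. \<bar>\<phi> u\<bar> \<le> C"
  shows "locally_integrable (\<lambda>x. w j x * \<phi> x)"
proof (rule locally_integrableI)
  fix x y assume xy: "x \<in> I" "y \<in> I" "x < y"
  obtain C where C: "0 \<le> C" "\<And>u. x \<le> u \<Longrightarrow> u \<le> y \<Longrightarrow> w j u \<le> C"
    using w_bounded[OF xy(1,2)] by metis
  obtain D where D: "\<forall>u\<in>{x..y}. \<bar>\<phi> u\<bar> \<le> D"
    using bd[OF xy] by blast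
  have eq: "(\<lambda>u. indicator {x<..<y} u *\<^sub>R (w j u * \<phi> u))
      = (\<lambda>u. indicator {x<..<y} u *\<^sub>R (indicator I u * (w j u * \<phi> u)))"
    using mem_I[OF xy(1,2)] by (auto split: split_indicator)
  have m: "(\<lambda>u. indicator {x<..<y} u *\<^sub>R (w j u * \<phi> u)) \<in> borel_measurable lborel"
    unfolding eq using borel_funs_arith(1)[OF w_borel phi, of j]
    by (simp add: borel_funs_iff)
  show "set_integrable lborel {x<..<y} (\<lambda>x. w j x * \<phi> x)"
    unfolding set_integrable_def
  proof (rule Bochner_Integration.integrable_bound[OF _ m])
    show "integrable lborel (\<lambda>u. indicator {x<..<y} u * (C * D))"
      using xy by simp
    have "norm (indicator {x<..<y} u *\<^sub>R (w j u * \<phi> u)) \<le> norm (indicator {x<..<y} u * (C * D))" for u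
    proof (cases "u \<in> {x<..<y}")
      case True
      have "\<bar>w j u * \<phi> u\<bar> \<le> C * D"
        using True C(2)[of u] C(1) D w_pos[of u j] mem_I[OF xy(1,2), of u]
        by (auto simp: abs_mult intro!: mult_mono)
      then show ?thesis using True by simp
    qed simp
    then show "AE u in lborel. norm (indicator {x<..<y} u *\<^sub>R (w j u * \<phi> u))
        \<le> norm (indicator {x<..<y} u * (C * D))"
      by simp
  qed
qed

lemma locally_integrable_w_mono:
  assumes "\<phi> \<in> borel_funs I" "mono_on I \<phi>"
  shows "locally_integrable (\<lambda>x. w j x * \<phi> x)"
proof (rule locally_integrable_w_mult[OF assms(1)])
  fix x y assume xy: "x \<in> I" "y \<in> I" "x < y"
  then have "\<phi> x \<le> \<phi> u \<and> \<phi> u \<le> \<phi> y" if "u \<in> {x..y}" for u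
    using that mem_I[OF xy(1,2), of u] by (auto intro!: mono_onD[OF assms(2)])
  then show "\<exists>C. \<forall>u\<in>{x..y}. \<bar>\<phi> u\<bar> \<le> C"
    by (intro exI[of _ "\<bar>\<phi> x\<bar> + \<bar>\<phi> y\<bar>"]) fastforce
qed

lemma locally_integrable_w_continuous:
  assumes "continuous_on I \<phi>"
  shows "locally_integrable (\<lambda>x. w j x * \<phi> x)"
proof (rule locally_integrable_w_mult[OF borel_funs_continuous[OF assms]])
  fix x y assume xy: "x \<in> I" "y \<in> I" "x < y"
  then have "continuous_on {x..y} \<phi>"
    using mem_I[OF xy(1,2)] by (intro continuous_on_subset[OF assms]) auto
  then have "bounded (\<phi> ` {x..y})"
    by (intro compact_imp_bounded compact_continuous_image) auto
  then show "\<exists>C. \<forall>u\<in>{x..y}. \<bar>\<phi> u\<bar> \<le> C"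
    by (auto simp: bounded_iff)
qed

lemma above_right_end: "x \<in> I \<Longrightarrow> ereal x \<noteq> right_end I \<Longrightarrow> \<exists>y\<in>I. x < y"
proof -
  assume x: "x \<in> I" "ereal x \<noteq> right_end I"
  then have "ereal x < right_end I"
    by (simp add: right_end_def SUP_upper order_less_le)
  then show ?thesis
    by (auto simp: right_end_def less_Sup_iff)
qed

lemma at_right_end: "x \<in> I \<Longrightarrow> ereal x = right_end I \<Longrightarrow> \<exists>y\<in>I. y < x"
proof -
  assume x: "x \<in> I" "ereal x = right_end I"
  obtain y where y: "y \<in> I" "y \<noteq> x"
    using nontrivial by (metis less_irrefl)
  moreover have "ereal y \<le> ereal x"
    unfolding x right_end_def using y by (auto intro: SUP_upper)
  ultimately show ?thesis by force
qed

lemma continuous_on_RC: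
  assumes "continuous_on I f"
  shows "f \<in> RC I"
  unfolding RC_def
proof (intro CollectI ballI conjI impI)
  fix x assume x: "x \<in> I"
  {
    assume "ereal x \<noteq> right_end I"
    from above_right_end[OF x this] obtain y where y: "y \<in> I" "x < y" by blast
    have "continuous_on {x..y} f"
      using mem_I[OF x y(1)] by (intro continuous_on_subset[OF assms]) auto
    then show "continuous (at_right x) f"
      using y(2) by (metis at_within_Icc_at_right atLeastAtMost_iff continuous_on_eq_continuous_within
          less_imp_le order_refl)
  }
  {
    assume "ereal x = right_end I"
    from at_right_end[OF x this] obtain y where y: "y \<in> I" "y < x" by blast
    have "continuous_on {y..x} f"
      using mem_I[OF y(1) x] by (intro continuous_on_subset[OF assms]) auto
    then show "continuous (at_left x) f"
      using y(2) by (metis at_within_Icc_at_left atLeastAtMost_iff continuous_on_eq_continuous_within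
          less_imp_le order_refl)
  }
qed

text \<open>It is the quotient \<open>g / w j\<close> that is one-sidedly continuous, so a negative
  value at \<open>x\<close> persists on an interval adjoining \<open>x\<close>, to the right or, at
  the right end of \<open>I\<close>, to the left. As \<open>w j\<close> is positive,
  \<open>g\<close> and hence its integral are negative there. Uniqueness of gauge derivatives and
  nonnegativity of derivatives of monotone functions both rest on this.\<close>

lemma RC_gauge_nonneg:
  assumes g: "g \<in> RC_gauge I (w j)" "locally_integrable g"
    and nn: "\<And>x y. \<lbrakk>x \<in> I; y \<in> I; x < y\<rbrakk> \<Longrightarrow> 0 \<le> (LBINT u=ereal x..ereal y. g u)"
    and x: "x \<in> I"
  shows "0 \<le> g x"
proof (rule ccontr)
  assume "\<not> 0 \<le> g x"
  then have neg: "g x / w j x < 0"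
    using w_pos[OF x, of j] by (simp add: divide_neg_pos)
  have no: False if ab: "a \<in> I" "b \<in> I" "a < b" "\<And>u. a < u \<Longrightarrow> u < b \<Longrightarrow> g u / w j u < 0" for a b
  proof -
    have "g u < 0" if "a < u" "u < b" for u
      using ab(4)[OF that] w_pos[OF mem_I[OF ab(1,2), of u], of j] that
      by (simp add: divide_less_0_iff)
    then have "(LINT u:{a<..<b}|lborel. g u) < 0"
      using ab by (intro set_integral_neg locally_integrableD(2)[OF g(2)]) auto
    then show False
      using nn[OF ab(1-3)] ab(3) by (simp add: interval_lebesgue_integral_le_eq)
  qed
  have RC: "(\<lambda>x. g x / w j x) \<in> RC I"
    using g by (simp add: RC_gauge_def)
  show False
  proof (cases "ereal x = right_end I")
    case False
    from above_right_end[OF x False] obtain y where y: "y \<in> I" "x < y" by blast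
    have "((\<lambda>x. g x / w j x) \<longlongrightarrow> g x / w j x) (at_right x)"
      using RC x False by (auto simp: RC_def continuous_within)
    then have "eventually (\<lambda>u. g u / w j u < 0) (at_right x)"
      using neg by (rule order_tendstoD)
    then obtain b where b: "x < b" "\<And>u. x < u \<Longrightarrow> u < b \<Longrightarrow> g u / w j u < 0"
      using y(2) by (auto simp: eventually_at_right)
    show False
      by (rule no[of x "min b y"]) (use x y b mem_I[OF x y(1), of "min b y"] in auto)
  next
    case True
    from at_right_end[OF x True] obtain y where y: "y \<in> I" "y < x" by blast
    have "((\<lambda>x. g x / w j x) \<longlongrightarrow> g x / w j x) (at_left x)"
      using RC x True by (auto simp: RC_def continuous_within)
    then have "eventually (\<lambda>u. g u / w j u < 0) (at_left x)"
      using neg by (rule order_tendstoD)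
    then obtain b where b: "b < x" "\<And>u. b < u \<Longrightarrow> u < x \<Longrightarrow> g u / w j u < 0"
      using y(2) by (auto simp: eventually_at_left)
    show False
      by (rule no[of "max b y" x]) (use x y b mem_I[OF y(1) x, of "max b y"] in auto)
  qed
qed

lemma RC_diff: "f \<in> RC I \<Longrightarrow> g \<in> RC I \<Longrightarrow> (\<lambda>x. f x - g x) \<in> RC I"
  unfolding RC_def by (auto intro!: continuous_intros)

lemma is_gauge_deriv_iff:
  "is_gauge_deriv I (w j) f g \<longleftrightarrow> g \<in> RC_gauge I (w j) \<and> locally_integrable g \<and>
     (\<forall>x\<in>I. \<forall>y\<in>I. f x = f y + (LBINT u=ereal y..ereal x. g u))"
  unfolding is_gauge_deriv_def locally_integrable_def by blast

lemma is_gauge_derivD: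
  assumes "is_gauge_deriv I (w j) f g"
  shows "g \<in> RC_gauge I (w j)" "g \<in> borel_funs I" "(\<lambda>x. g x / w j x) \<in> RC I" "locally_integrable g"
    "\<lbrakk>x \<in> I; y \<in> I\<rbrakk> \<Longrightarrow> f x = f y + (LBINT u=ereal y..ereal x. g u)"
proof -
  note D = assms[unfolded is_gauge_deriv_iff]
  show RC: "g \<in> RC_gauge I (w j)" and "locally_integrable g"
    by (rule D[THEN conjunct1], rule D[THEN conjunct2, THEN conjunct1])
  from RC show "g \<in> borel_funs I" "(\<lambda>x. g x / w j x) \<in> RC I"
    by (simp_all add: RC_gauge_def)
  assume "x \<in> I" "y \<in> I"
  then show "f x = f y + (LBINT u=ereal y..ereal x. g u)"
    using D[THEN conjunct2, THEN conjunct2] by blast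
qed

text \<open>The difference of the two derivatives has integral 0 over every subinterval, so
  \<open>RC_gauge_nonneg\<close> applies to it with either sign. Since \<open>D_gauge\<close> is a
  \<open>SOME\<close> choice, this is what identifies it with an explicitly constructed
  derivative.\<close>

lemma is_gauge_deriv_unique:
  assumes g: "is_gauge_deriv I (w j) f g" and h: "is_gauge_deriv I (w j) f' h"
    and eq: "\<And>x. x \<in> I \<Longrightarrow> f x = f' x" and x: "x \<in> I"
  shows "g x = h x"
proof -
  have *: "g x \<le> h x" if g: "is_gauge_deriv I (w j) f g" and h: "is_gauge_deriv I (w j) f' h"
    and eq: "\<And>x. x \<in> I \<Longrightarrow> f x = f' x" for f f' g h
  proof -
    have "(\<lambda>x. h x / w j x - g x / w j x) \<in> RC I" "g \<in> borel_funs I" "h \<in> borel_funs I"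
      by (rule RC_diff is_gauge_derivD[OF g] is_gauge_derivD[OF h])+
    then have "(\<lambda>u. h u - g u) \<in> RC_gauge I (w j)"
      by (simp add: RC_gauge_def diff_divide_distrib borel_funs_arith(4))
    moreover have "locally_integrable (\<lambda>u. h u - g u)"
      by (rule locally_integrable_arith(2)[OF is_gauge_derivD(4)[OF h] is_gauge_derivD(4)[OF g]])
    moreover have "0 \<le> (LBINT u=ereal a..ereal b. h u - g u)" if ab: "a \<in> I" "b \<in> I" for a b
    proof -
      have "f' b = f' a + (LBINT u=ereal a..ereal b. h u)"
        "f b = f a + (LBINT u=ereal a..ereal b. g u)"
        by (rule is_gauge_derivD(5)[OF h ab(2,1)], rule is_gauge_derivD(5)[OF g ab(2,1)])
      moreover have "(LBINT u=ereal a..ereal b. h u - g u)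
          = (LBINT u=ereal a..ereal b. h u) - (LBINT u=ereal a..ereal b. g u)"
        using locally_integrableD(1)[OF is_gauge_derivD(4)[OF h] ab]
          locally_integrableD(1)[OF is_gauge_derivD(4)[OF g] ab]
        by (rule interval_lebesgue_integral_diff)
      ultimately show ?thesis
        using eq[OF ab(1)] eq[OF ab(2)] by simp
    qed
    ultimately have "0 \<le> h x - g x"
      using RC_gauge_nonneg[of "\<lambda>u. h u - g u" j x] x by simp
    then show ?thesis by simp
  qed
  show ?thesis
    by (rule antisym) (rule *[OF g h eq], assumption, rule *[OF h g eq[symmetric]])
qed

lemma S_spaceD:
  assumes "f \<in> S_space I w n" "j \<le> n"
  shows "f \<in> S_space I w j"
  using assms(2,1) by (induction rule: inc_induct) auto

lemma D_gauge_is_gauge_deriv: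
  "f \<in> S_gauge I (w j) \<Longrightarrow> is_gauge_deriv I (w j) f (D_gauge I (w j) f)"
  unfolding S_gauge_def D_gauge_def by (metis (mono_tags, lifting) mem_Collect_eq someI_ex)

lemma gderiv_borel: "f \<in> S_space I w j \<Longrightarrow> gderiv I w j f \<in> borel_funs I"
proof (cases j)
  case (Suc i)
  assume "f \<in> S_space I w j"
  then have "D_gauge I (w j) (gderiv I w i f) \<in> borel_funs I"
    by (intro is_gauge_derivD(2)[OF D_gauge_is_gauge_deriv]) (simp add: Suc)
  then show ?thesis
    using borel_funs_arith(2) w_borel by (auto simp: Suc)
qed (simp add: borel_funs_arith(2) w_borel)

text \<open>\<open>F j\<close> plays the role of \<open>w\<^sub>j f\<^sup>(\<^sup>j\<^sup>)\<close>.\<close>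

definition chain :: "nat \<Rightarrow> (nat \<Rightarrow> real \<Rightarrow> real) \<Rightarrow> bool" where
  "chain N F \<longleftrightarrow> (\<forall>j\<le>N. F j \<in> borel_funs I) \<and>
     (\<forall>j<N. locally_integrable (F (Suc j)) \<and>
       (\<forall>x\<in>I. \<forall>y\<in>I. F j x / w j x = F j y / w j y + (LBINT u=ereal y..ereal x. F (Suc j) u)))"

lemma chain_D:
  assumes "chain N F"
  shows "j \<le> N \<Longrightarrow> F j \<in> borel_funs I" "j < N \<Longrightarrow> locally_integrable (F (Suc j))"
    "\<lbrakk>j < N; x \<in> I; y \<in> I\<rbrakk> \<Longrightarrow> F j x / w j x = F j y / w j y + (LBINT u=ereal y..ereal x. F (Suc j) u)"
proof -
  note F = assms[unfolded chain_def]
  show "j \<le> N \<Longrightarrow> F j \<in> borel_funs I"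
    using F[THEN conjunct1, rule_format] .
  show "j < N \<Longrightarrow> locally_integrable (F (Suc j))"
    using F[THEN conjunct2, rule_format, THEN conjunct1] .
  assume "j < N" "x \<in> I" "y \<in> I"
  then show "F j x / w j x = F j y / w j y + (LBINT u=ereal y..ereal x. F (Suc j) u)"
    using F[THEN conjunct2, rule_format, THEN conjunct2, rule_format] by blast
qed

lemma chain_mono: "chain N F \<Longrightarrow> n \<le> N \<Longrightarrow> chain n F"
  unfolding chain_def by (meson less_le_trans order_trans)

lemma chain_uminus:
  assumes "chain N F"
  shows "chain N (\<lambda>j x. - F j x)"
  unfolding chain_def
proof (intro conjI allI impI ballI)
  fix j assume j: "j < N"
  show "locally_integrable (\<lambda>x. - F (Suc j) x)"
    using locally_integrable_arith(3)[OF chain_D(2)[OF assms j] chain_D(2)[OF assms j], of "-1"] by simp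
  fix x y assume "x \<in> I" "y \<in> I"
  from chain_D(3)[OF assms j this]
  show "- F j x / w j x = - F j y / w j y + (LBINT u=ereal y..ereal x. - F (Suc j) u)"
    by (simp add: interval_lebesgue_integral_uminus)
qed (simp add: borel_funs_uminus chain_D(1)[OF assms])

lemma chain_diff:
  assumes "chain N F" "chain N G"
  shows "chain N (\<lambda>j x. F j x - G j x)"
  unfolding chain_def
proof (intro conjI allI impI ballI)
  fix j assume j: "j < N"
  note li = chain_D(2)[OF assms(1) j] chain_D(2)[OF assms(2) j]
  show "locally_integrable (\<lambda>x. F (Suc j) x - G (Suc j) x)"
    using li by (rule locally_integrable_arith)
  fix x y assume xy: "x \<in> I" "y \<in> I"
  show "(F j x - G j x) / w j x = (F j y - G j y) / w j y
      + (LBINT u=ereal y..ereal x. F (Suc j) u - G (Suc j) u)"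
    using chain_D(3)[OF assms(1) j xy] chain_D(3)[OF assms(2) j xy]
      interval_lebesgue_integral_diff(2)[OF li[THEN locally_integrableD(1), OF xy(2,1)]]
    by (simp add: diff_divide_distrib)
qed (simp add: borel_funs_arith(4) chain_D(1)[OF assms(1)] chain_D(1)[OF assms(2)])

lemma chain_continuous:
  assumes "chain N F" "j < N"
  shows "continuous_on I (\<lambda>x. F j x / w j x)"
proof -
  obtain z where z: "z \<in> I" using nontrivial by blast
  have "continuous_on I (\<lambda>x. F j z / w j z + (LBINT u=ereal z..ereal x. F (Suc j) u))"
    by (intro continuous_intros continuous_on_interval_integral chain_D(2)[OF assms] z)
  then show ?thesis
    by (rule continuous_on_eq) (rule chain_D(3)[OF assms _ z, symmetric])
qed

text \<open>Quotients below the top are integrals, hence continuous, and the top one vanishes; so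
  every \<open>F j / w j\<close> is continuous and belongs to \<open>RC I\<close>. Uniqueness then
  identifies \<open>D_gauge\<close> at each level with the next \<open>F\<close>.\<close>

lemma chain_in_S_space:
  assumes F: "chain N F" and top: "\<And>x. x \<in> I \<Longrightarrow> F N x = 0"
    and f: "\<And>x. x \<in> I \<Longrightarrow> f x = F 0 x" and j: "j \<le> N"
  shows "f \<in> S_space I w j \<and> (\<forall>x\<in>I. gderiv I w j f x = F j x / w j x)"
  using j
proof (induction j)
  case 0
  have "f \<in> borel_funs I"
    using borel_funs_cong[of f "F 0", OF f] chain_D(1)[OF F, of 0] by simp
  then show ?case using f by auto
next
  case (Suc j)
  then have IH: "f \<in> S_space I w j" "\<And>x. x \<in> I \<Longrightarrow> gderiv I w j f x = F j x / w j x" and j: "j < N"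
    by auto
  have "continuous_on I (\<lambda>x. F (Suc j) x / w (Suc j) x)"
  proof (cases "Suc j = N")
    case True
    show ?thesis
      by (rule continuous_on_eq[of _ "\<lambda>x. 0"]) (use True top in auto)
  next
    case False
    then show ?thesis using j by (intro chain_continuous[OF F]) auto
  qed
  then have D: "is_gauge_deriv I (w (Suc j)) (gderiv I w j f) (F (Suc j))"
    unfolding is_gauge_deriv_iff
  proof (intro conjI ballI)
    show "F (Suc j) \<in> RC_gauge I (w (Suc j))" if "continuous_on I (\<lambda>x. F (Suc j) x / w (Suc j) x)"
      using chain_D(1)[OF F Suc.prems] continuous_on_RC[OF that] by (simp add: RC_gauge_def)
    show "locally_integrable (F (Suc j))"
      by (rule chain_D(2)[OF F j])
    fix x y assume "x \<in> I" "y \<in> I"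
    with chain_D(3)[OF F j this] IH(2)
    show "gderiv I w j f x = gderiv I w j f y + (LBINT u=ereal y..ereal x. F (Suc j) u)"
      by simp
  qed
  then have S: "gderiv I w j f \<in> S_gauge I (w (Suc j))"
    using gderiv_borel[OF IH(1)] by (auto simp: S_gauge_def)
  have "D_gauge I (w (Suc j)) (gderiv I w j f) x = F (Suc j) x" if "x \<in> I" for x
    by (rule is_gauge_deriv_unique[OF D_gauge_is_gauge_deriv[OF S] D _ that]) simp
  then show ?case
    using S IH(1) by auto
qed

text \<open>The factor \<open>w j\<close> undoes the division in \<open>gderiv\<close>, so
  consecutive levels are linked by integrating \<open>D_gauge\<close>.\<close>

lemma S_space_chain:
  assumes "f \<in> S_space I w n"
  shows "chain n (\<lambda>j x. w j x * gderiv I w j f x)"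
  unfolding chain_def
proof (intro conjI allI impI ballI)
  fix j assume "j \<le> n"
  then show "(\<lambda>x. w j x * gderiv I w j f x) \<in> borel_funs I"
    using gderiv_borel[OF S_spaceD[OF assms]] w_borel borel_funs_arith by blast
next
  fix j assume j: "j < n"
  have D: "is_gauge_deriv I (w (Suc j)) (gderiv I w j f) (D_gauge I (w (Suc j)) (gderiv I w j f))"
    using S_spaceD[OF assms Suc_leI[OF j]] by (intro D_gauge_is_gauge_deriv) simp
  have eq: "w (Suc j) x * gderiv I w (Suc j) f x = D_gauge I (w (Suc j)) (gderiv I w j f) x" if "x \<in> I" for x
    using w_pos[OF that, of "Suc j"] by simp
  show "locally_integrable (\<lambda>x. w (Suc j) x * gderiv I w (Suc j) f x)"
    using is_gauge_derivD(4)[OF D] locally_integrable_cong[OF eq] by simp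
  fix x y assume xy: "x \<in> I" "y \<in> I"
  have "gderiv I w j f x = gderiv I w j f y
      + (LBINT u=ereal y..ereal x. D_gauge I (w (Suc j)) (gderiv I w j f) u)"
    by (rule is_gauge_derivD(5)[OF D xy])
  then show "w j x * gderiv I w j f x / w j x = w j y * gderiv I w j f y / w j y
      + (LBINT u=ereal y..ereal x. w (Suc j) u * gderiv I w (Suc j) f u)"
    using w_pos[of x j] w_pos[of y j] interval_integral_cong_I[OF eq xy(2,1)] xy
    by simp
qed

lemma gderiv_Suc_nonneg:
  assumes f: "f \<in> S_space I w (Suc j)" and mono: "mono_on I (gderiv I w j f)" and x: "x \<in> I"
  shows "0 \<le> gderiv I w (Suc j) f x"
proof -
  let ?D = "D_gauge I (w (Suc j)) (gderiv I w j f)"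
  have D: "is_gauge_deriv I (w (Suc j)) (gderiv I w j f) ?D"
    using f by (intro D_gauge_is_gauge_deriv) simp
  have "0 \<le> ?D x"
  proof (rule RC_gauge_nonneg[of ?D "Suc j", OF _ _ _ x])
    fix a b assume ab: "a \<in> I" "b \<in> I" "a < b"
    have "gderiv I w j f b = gderiv I w j f a + (LBINT u=ereal a..ereal b. ?D u)"
      by (rule is_gauge_derivD(5)[OF D ab(2,1)])
    then show "0 \<le> (LBINT u=ereal a..ereal b. ?D u)"
      using mono_onD[OF mono ab(1,2)] ab by simp
  qed (rule is_gauge_derivD[OF D])+
  then show ?thesis
    using w_pos[OF x, of "Suc j"] by simp
qed

end

section \<open>Iterated signed integrals\<close>

primrec iter_re ::
    "(nat \<Rightarrow> real \<Rightarrow> real) \<Rightarrow> real \<Rightarrow> nat \<Rightarrow> nat \<Rightarrow> (real \<Rightarrow> real) \<Rightarrow> real \<Rightarrow> real" where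
  "iter_re w z 0 j g = g"
| "iter_re w z (Suc d) j g =
     (\<lambda>x. w j x * (LBINT u=ereal z..ereal x. iter_re w z d (Suc j) g u))"

definition side :: "real \<Rightarrow> real \<Rightarrow> real" where
  "side z x = (if z \<le> x then 1 else -1)"

context gauge_system
begin

text \<open>Since the weights vanish off \<open>I\<close>, integrating over \<open>{..<x}\<close> amounts to integrating from
  \<open>a\<close>, whether or not \<open>a \<in> I\<close>.\<close>

definition W :: "nat \<Rightarrow> real \<Rightarrow> ennreal" where
  "W j x = ennreal (indicator I x * w j x)"

lemma W_measurable[measurable]: "W j \<in> borel_measurable borel"
  using w_borel[of j] unfolding W_def borel_funs_iff by simp

lemma W_I: "x \<in> I \<Longrightarrow> W j x = ennreal (w j x)" and W_not_I: "x \<notin> I \<Longrightarrow> W j x = 0"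
  by (simp_all add: W_def)

lemma W_pos_finite: "x \<in> I \<Longrightarrow> 0 < W j x \<and> W j x < \<infinity>"
  by (simp add: W_I w_pos)

sublocale below: nn_kernel below_kernel W
  by unfold_locales (rule measurable_below_kernel W_measurable)+

sublocale between: nn_kernel "between_kernel z" W for z
  by unfold_locales (rule measurable_between_kernel W_measurable)+

lemma between_in_I:
  assumes "z \<in> I" "x \<in> I"
  shows "between_kernel z x u \<noteq> 0 \<Longrightarrow> u \<in> I"
  using mem_I[of z x u] mem_I[of x z u] assms
  by (auto simp: between_kernel_def min_def max_def split: split_indicator_asm if_splits)

lemma nn_integral_between_cong:
  assumes "z \<in> I" "x \<in> I" "\<And>u. u \<in> I \<Longrightarrow> f u = g u"
  shows "(\<integral>\<^sup>+u. between_kernel z x u * f u \<partial>lborel) = (\<integral>\<^sup>+u. between_kernel z x u * g u \<partial>lborel)"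
  using between_in_I[OF assms(1,2)] assms(3)
  by (intro nn_integral_cong) (metis mult_zero_left)

lemma nn_integral_interval:
  assumes g: "locally_integrable g" and nn: "\<And>u. u \<in> I \<Longrightarrow> 0 \<le> g u"
    and xy: "y \<in> I" "x \<in> I" "y \<le> x"
  shows "(\<integral>\<^sup>+u. indicator {y<..<x} u * ennreal (g u) \<partial>lborel) = ennreal (LBINT u=ereal y..ereal x. g u)"
    "0 \<le> (LBINT u=ereal y..ereal x. g u)"
proof -
  have eq: "(LBINT u=ereal y..ereal x. g u) = (\<integral>u. indicator {y<..<x} u * g u \<partial>lborel)"
    using xy(3) by (simp add: interval_lebesgue_integral_le_eq set_lebesgue_integral_def)
  have nn': "0 \<le> indicator {y<..<x} u * g u" for u
    using nn[OF mem_I[OF xy(1,2), of u]] by (auto split: split_indicator)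
  have "(\<integral>\<^sup>+u. ennreal (indicator {y<..<x} u * g u) \<partial>lborel)
      = ennreal (\<integral>u. indicator {y<..<x} u * g u \<partial>lborel)"
    using locally_integrableD(2)[OF g xy] nn'
    by (intro nn_integral_eq_integral) (simp_all add: set_integrable_def)
  moreover have "(\<integral>\<^sup>+u. ennreal (indicator {y<..<x} u * g u) \<partial>lborel)
      = (\<integral>\<^sup>+u. indicator {y<..<x} u * ennreal (g u) \<partial>lborel)"
    by (intro nn_integral_cong) (auto split: split_indicator)
  ultimately show "(\<integral>\<^sup>+u. indicator {y<..<x} u * ennreal (g u) \<partial>lborel) = ennreal (LBINT u=ereal y..ereal x. g u)"
    using eq by simp
  show "0 \<le> (LBINT u=ereal y..ereal x. g u)"
    unfolding eq using nn' by (intro integral_nonneg_AE) simp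
qed

text \<open>To the left of \<open>z\<close> the orientation of the integral contributes one further
  factor -1, which raises the exponent of \<open>side\<close> by one. As \<open>g\<close> keeps one
  sign between \<open>z\<close> and \<open>x\<close>, nothing cancels and the modulus may be taken
  inside.\<close>

lemma interval_integral_side:
  assumes g: "locally_integrable g" and z: "z \<in> I" and x: "x \<in> I"
    and side: "\<And>u. u \<in> I \<Longrightarrow> g u = side z u ^ e * \<bar>g u\<bar>"
  shows "(LBINT u=ereal z..ereal x. g u) = side z x ^ Suc e * \<bar>LBINT u=ereal z..ereal x. g u\<bar>"
    "ennreal \<bar>LBINT u=ereal z..ereal x. g u\<bar>
      = (\<integral>\<^sup>+u. between_kernel z x u * ennreal \<bar>g u\<bar> \<partial>lborel)"
proof -
  have ab: "locally_integrable (\<lambda>u. \<bar>g u\<bar>)"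
  proof (rule locally_integrableI)
    fix a b assume "a \<in> I" "b \<in> I" "a < b"
    then have "set_integrable lborel {a<..<b} g"
      by (intro locally_integrableD(2)[OF g]) auto
    then show "set_integrable lborel {a<..<b} (\<lambda>u. \<bar>g u\<bar>)"
      unfolding set_integrable_def
      using integrable_abs[of lborel "\<lambda>u. indicator {a<..<b} u *\<^sub>R g u"] by (simp add: abs_mult)
  qed
  show "(LBINT u=ereal z..ereal x. g u) = side z x ^ Suc e * \<bar>LBINT u=ereal z..ereal x. g u\<bar>"
    "ennreal \<bar>LBINT u=ereal z..ereal x. g u\<bar>
      = (\<integral>\<^sup>+u. between_kernel z x u * ennreal \<bar>g u\<bar> \<partial>lborel)"
  proof (atomize (full), cases "z \<le> x")
    case True
    have "(LBINT u=ereal z..ereal x. g u) = (LBINT u=ereal z..ereal x. \<bar>g u\<bar>)"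
    proof (rule interval_integral_cong)
      fix u assume "u \<in> einterval (min (ereal z) (ereal x)) (max (ereal z) (ereal x))"
      then have "z < u" "u < x"
        using True by (auto simp: einterval_def)
      then show "g u = \<bar>g u\<bar>"
        using side[OF mem_I[OF z x, of u]] by (simp add: side_def)
    qed
    moreover have "between_kernel z x u = indicator {z<..<x} u" for u
      using True by (simp add: between_kernel_def)
    ultimately show "(LBINT u=ereal z..ereal x. g u) = side z x ^ Suc e * \<bar>LBINT u=ereal z..ereal x. g u\<bar> \<and>
       ennreal \<bar>LBINT u=ereal z..ereal x. g u\<bar>
      = (\<integral>\<^sup>+u. between_kernel z x u * ennreal \<bar>g u\<bar> \<partial>lborel)"
      using nn_integral_interval[OF ab _ z x True] True by (simp add: side_def)
  next
    case False
    then have xz: "x \<le> z" by simp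
    have "(LBINT u=ereal x..ereal z. g u) = (LBINT u=ereal x..ereal z. (-1) ^ e * \<bar>g u\<bar>)"
    proof (rule interval_integral_cong)
      fix u assume "u \<in> einterval (min (ereal x) (ereal z)) (max (ereal x) (ereal z))"
      then have "x < u" "u < z"
        using xz by (auto simp: einterval_def)
      then show "g u = (-1) ^ e * \<bar>g u\<bar>"
        using side[OF mem_I[OF x z, of u]] by (simp add: side_def)
    qed
    then have "(LBINT u=ereal x..ereal z. g u) = (-1) ^ e * (LBINT u=ereal x..ereal z. \<bar>g u\<bar>)"
      by simp
    then have eq: "(LBINT u=ereal z..ereal x. g u) = (-1) ^ Suc e * (LBINT u=ereal x..ereal z. \<bar>g u\<bar>)"
      by (subst interval_integral_endpoints_reverse) simp
    have "between_kernel z x u = indicator {x<..<z} u" for u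
      using xz by (simp add: between_kernel_def)
    then show "(LBINT u=ereal z..ereal x. g u) = side z x ^ Suc e * \<bar>LBINT u=ereal z..ereal x. g u\<bar> \<and>
       ennreal \<bar>LBINT u=ereal z..ereal x. g u\<bar>
      = (\<integral>\<^sup>+u. between_kernel z x u * ennreal \<bar>g u\<bar> \<partial>lborel)"
      using nn_integral_interval[OF ab _ x z xz] False
      unfolding eq by (simp add: side_def abs_mult power_abs)
  qed
qed

lemma iter_re_locally_integrable:
  assumes "locally_integrable g" "z \<in> I"
  shows "locally_integrable (iter_re w z d j g)"
proof (induction d arbitrary: j)
  case (Suc d)
  show ?case
    using locally_integrable_w_continuous[OF continuous_on_interval_integral[OF Suc.IH assms(2)]]
    by simp
qed (use assms in simp)

lemma iter_re_borel:
  assumes "d > 0 \<Longrightarrow> locally_integrable g" "z \<in> I" "g \<in> borel_funs I"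
  shows "iter_re w z d j g \<in> borel_funs I"
proof (cases d)
  case (Suc d')
  have "locally_integrable g" using assms(1) Suc by simp
  then show ?thesis
    using borel_funs_arith(1)[OF w_borel borel_funs_continuous[OF
        continuous_on_interval_integral[OF iter_re_locally_integrable assms(2)]]] assms(2)
    by (simp add: Suc)
qed (use assms in simp)

text \<open>Each of the \<open>d\<close> integrations from \<open>z\<close> adds one to the exponent
  of \<open>side\<close>. Sign and modulus go through the induction together, since the constant
  sign is what allows the modulus of the next integral to be computed without cancellation.\<close>

lemma iter_re_side:
  assumes g: "d > 0 \<Longrightarrow> locally_integrable g" and z: "z \<in> I"
    and side: "\<And>u. u \<in> I \<Longrightarrow> g u = side z u ^ e * \<bar>g u\<bar>" and x: "x \<in> I"
  shows "iter_re w z d j g x = side z x ^ (d + e) * \<bar>iter_re w z d j g x\<bar> \<and>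
    ennreal \<bar>iter_re w z d j g x\<bar> = iter_nn (between_kernel z) W d j (\<lambda>u. ennreal \<bar>g u\<bar>) x"
  using x g
proof (induction d arbitrary: j x)
  case 0
  then show ?case using side by simp
next
  case (Suc d)
  let ?g = "iter_re w z d (Suc j) g"
  have IH: "?g u = side z u ^ (d + e) * \<bar>?g u\<bar>"
    "ennreal \<bar>?g u\<bar> = iter_nn (between_kernel z) W d (Suc j) (\<lambda>u. ennreal \<bar>g u\<bar>) u" if "u \<in> I" for u
    using Suc.IH[OF that, of "Suc j"] Suc.prems(2) by blast+
  have li: "locally_integrable ?g"
    using Suc.prems(2) z by (simp add: iter_re_locally_integrable)
  note i = interval_integral_side[OF li z Suc.prems(1) IH(1)]
  have w: "0 < w j x" by (rule w_pos[OF Suc.prems(1)])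
  have "iter_re w z (Suc d) j g x = side z x ^ (Suc d + e) * \<bar>iter_re w z (Suc d) j g x\<bar>"
    using i(1) w by (simp add: abs_mult)
  moreover have "ennreal \<bar>iter_re w z (Suc d) j g x\<bar>
      = iter_nn (between_kernel z) W (Suc d) j (\<lambda>u. ennreal \<bar>g u\<bar>) x"
    using i(2) w nn_integral_between_cong[OF z Suc.prems(1) IH(2)]
    by (simp add: abs_mult ennreal_mult W_I[OF Suc.prems(1)])
  ultimately show ?case by blast
qed

lemma chain_iter_re:
  assumes g: "m > 0 \<Longrightarrow> locally_integrable g" and z: "z \<in> I" and b: "g \<in> borel_funs I"
  shows "chain m (\<lambda>j. iter_re w z (m - j) j g)"
  unfolding chain_def
proof (intro conjI allI impI ballI)
  show "iter_re w z (m - j) j g \<in> borel_funs I" if "j \<le> m" for j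
    using g by (intro iter_re_borel z b) simp
  fix j assume j: "j < m"
  then have li: "locally_integrable (iter_re w z d i g)" for d i
    using iter_re_locally_integrable g z by simp
  then show "locally_integrable (iter_re w z (m - Suc j) (Suc j) g)" .
  have e: "m - j = Suc (m - Suc j)" using j by simp
  fix x y assume xy: "x \<in> I" "y \<in> I"
  show "iter_re w z (m - j) j g x / w j x = iter_re w z (m - j) j g y / w j y
      + (LBINT u=ereal y..ereal x. iter_re w z (m - Suc j) (Suc j) g u)"
    using interval_integral_split[OF li z xy(2,1), of "m - Suc j" "Suc j"] w_pos[OF xy(1), of j] w_pos[OF xy(2), of j]
    unfolding e by simp
qed

lemma w_locally_integrable: "locally_integrable (w j)"
  using locally_integrable_w_continuous[of "\<lambda>x. 1" j] by simp

lemma interval_integral_linear_combination: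
  fixes d :: nat
  assumes s: "s \<in> I" and x: "x \<in> I" and P: "\<And>i. i \<le> d \<Longrightarrow> locally_integrable (P i)"
  shows "(LBINT u=ereal s..ereal x. (\<Sum>i\<le>d. c i * P i u)) = (\<Sum>i\<le>d. c i * (LBINT u=ereal s..ereal x. P i u))
    \<and> interval_lebesgue_integrable lborel (ereal s) (ereal x) (\<lambda>u. \<Sum>i\<le>d. c i * P i u)"
  using P
proof (induction d)
  case 0
  then show ?case using locally_integrableD(1)[OF 0[of 0] s x] by simp
next
  case (Suc d)
  have "interval_lebesgue_integrable lborel (ereal s) (ereal x) (\<lambda>u. c (Suc d) * P (Suc d) u)"
    using locally_integrableD(1)[OF Suc.prems[of "Suc d"] s x] by simp
  then show ?case
    using Suc.IH Suc.prems by simp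
qed

text \<open>Taylor's formula at \<open>s\<close>, by descending through the levels: the top quotient
  is constant, and each integration from \<open>s\<close> shifts the coefficients up and inserts the
  value of the quotient at \<open>s\<close> as the new one of index 0.\<close>

lemma chain_polynomial:
  assumes F: "chain m F" and top: "\<And>x. x \<in> I \<Longrightarrow> F m x = c * w m x" and s: "s \<in> I"
  shows "\<exists>c. \<forall>x\<in>I. F 0 x = (\<Sum>i\<le>m. c i * iter_re w s i 0 (w i) x)"
proof -
  have "\<exists>c. \<forall>x\<in>I. F (m - d) x = (\<Sum>i\<le>d. c i * iter_re w s i (m - d) (w (m - d + i)) x)"
    if "d \<le> m" for d
    using that
  proof (induction d)
    case 0
    then show ?case using top by (intro exI[of _ "\<lambda>_. c"]) simp
  next
    case (Suc d)
    let ?j = "m - Suc d"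
    have j: "?j < m" "m - d = Suc ?j" using Suc.prems by auto
    obtain c where c: "\<And>x. x \<in> I \<Longrightarrow> F (Suc ?j) x = (\<Sum>i\<le>d. c i * iter_re w s i (Suc ?j) (w (Suc ?j + i)) x)"
      using Suc j(2) by auto
    define c' where "c' i = (case i of 0 \<Rightarrow> F ?j s / w ?j s | Suc i \<Rightarrow> c i)" for i
    have "F ?j x = (\<Sum>i\<le>Suc d. c' i * iter_re w s i ?j (w (?j + i)) x)" if x: "x \<in> I" for x
    proof -
      have "F ?j x / w ?j x = F ?j s / w ?j s + (LBINT u=ereal s..ereal x. F (Suc ?j) u)"
        by (rule chain_D(3)[OF F j(1) x s])
      also have "(LBINT u=ereal s..ereal x. F (Suc ?j) u)
          = (LBINT u=ereal s..ereal x. (\<Sum>i\<le>d. c i * iter_re w s i (Suc ?j) (w (Suc ?j + i)) u))"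
        by (rule interval_integral_cong_I[OF c s x])
      also have "\<dots> = (\<Sum>i\<le>d. c i * (LBINT u=ereal s..ereal x. iter_re w s i (Suc ?j) (w (Suc ?j + i)) u))"
        by (rule interval_integral_linear_combination[OF s x, THEN conjunct1])
          (rule iter_re_locally_integrable[OF w_locally_integrable s])
      finally have "F ?j x = w ?j x * (F ?j s / w ?j s
          + (\<Sum>i\<le>d. c i * (LBINT u=ereal s..ereal x. iter_re w s i (Suc ?j) (w (Suc ?j + i)) u)))"
        using w_pos[OF x, of ?j] by (simp add: field_simps)
      then show ?thesis
        by (simp add: sum.atMost_Suc_shift c'_def distrib_left sum_distrib_left ac_simps del: sum.atMost_Suc)
    qed
    then show ?case by blast
  qed
  from this[of m] show ?thesis by simp
qed

text \<open>A constant quotient at level \<open>m\<close> has derivative 0, so the chain continues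
  with zeros. This gives polynomials the vanishing top level demanded by
  \<open>chain_in_S_space\<close>.\<close>

lemma chain_extend:
  assumes F: "chain m F" and top: "\<And>x. x \<in> I \<Longrightarrow> F m x = c * w m x"
  shows "chain N (\<lambda>j. if j \<le> m then F j else (\<lambda>x. 0))"
  unfolding chain_def
proof (intro conjI allI impI ballI)
  show "(if j \<le> m then F j else (\<lambda>x. 0)) \<in> borel_funs I" for j
    using chain_D(1)[OF F] by (auto intro: borel_funs_borel)
  fix j
  show "locally_integrable (if Suc j \<le> m then F (Suc j) else (\<lambda>x. 0))"
    using chain_D(2)[OF F, of j] locally_integrable_arith(3)[OF w_locally_integrable w_locally_integrable, of 0]
    by (auto simp: Suc_le_eq)
  fix x y assume xy: "x \<in> I" "y \<in> I"
  consider "j < m" | "j = m" | "m < j" by linarith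
  then show "(if j \<le> m then F j else (\<lambda>x. 0)) x / w j x = (if j \<le> m then F j else (\<lambda>x. 0)) y / w j y +
       (LBINT u=ereal y..ereal x. (if Suc j \<le> m then F (Suc j) else (\<lambda>x. 0)) u)"
  proof cases
    case 1
    then show ?thesis using chain_D(3)[OF F 1 xy] by simp
  next
    case 2
    then show ?thesis using top xy w_pos[of x m] w_pos[of y m] by simp
  qed simp
qed

lemma ext_interval_integral_real:
  assumes g: "locally_integrable g" and z: "z \<in> I" and x: "x \<in> I"
    and f: "\<And>u. u \<in> I \<Longrightarrow> f u = ereal (g u)"
  shows "ext_interval_integral (ereal z) x f = ereal (LBINT u=ereal z..ereal x. g u)"
proof -
  have *: "ext_integral lborel (\<lambda>u. indicator (einterval (ereal a) (ereal b)) u * f u)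
      = ereal (LINT u:{a<..<b}|lborel. g u)" if ab: "a \<in> I" "b \<in> I" "a \<le> b" for a b
  proof -
    have "ext_integral lborel (\<lambda>u. indicator (einterval (ereal a) (ereal b)) u * f u)
        = ext_integral lborel (\<lambda>u. ereal (indicator {a<..<b} u * g u))"
      using f mem_I[OF ab(1,2)] by (intro ext_integral_cong) (auto split: split_indicator)
    then show ?thesis
      using ext_integral_real_iff(2)[of "\<lambda>u. indicator {a<..<b} u * g u" lborel]
        locally_integrableD(2)[OF g ab]
      by (simp add: set_lebesgue_integral_def set_integrable_def borel_measurable_integrable)
  qed
  show ?thesis
    using *[of z x] *[of x z] z x
    by (simp add: ext_interval_integral_def interval_lebesgue_integral_def)
qed

lemma iter_integral_real:
  assumes g: "locally_integrable g" and z: "z \<in> I"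
    and f: "\<And>u. u \<in> I \<Longrightarrow> f u = ereal (g u)" and x: "x \<in> I"
  shows "iter_integral w (ereal z) f j (j + d) x = ereal (iter_re w z d j g x)"
  using x
proof (induction d arbitrary: j x)
  case 0
  then show ?case using f by (simp add: iter_integral.simps)
next
  case (Suc d)
  have "iter_integral w (ereal z) f j (j + Suc d) x
      = ereal (w j x) * ext_interval_integral (ereal z) x (iter_integral w (ereal z) f (Suc j) (j + Suc d))"
    by (subst iter_integral.simps) simp
  also have "ext_interval_integral (ereal z) x (iter_integral w (ereal z) f (Suc j) (j + Suc d))
      = ereal (LBINT u=ereal z..ereal x. iter_re w z d (Suc j) g u)"
    using Suc.IH[of _ "Suc j"]
    by (intro ext_interval_integral_real iter_re_locally_integrable g z Suc.prems) simp
  finally show ?case by simp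
qed

end

section \<open>Iterated integrals from the left end\<close>

lemma ext_interval_integral_nn:
  assumes "t \<le> ereal x" "\<And>u. u \<in> einterval t (ereal x) \<Longrightarrow> f u = enn2ereal (g u)"
  shows "ext_interval_integral t x f = enn2ereal (\<integral>\<^sup>+u. indicator (einterval t (ereal x)) u * g u \<partial>lborel)"
proof -
  have "ext_interval_integral t x f
      = ext_integral lborel (\<lambda>u. enn2ereal (indicator (einterval t (ereal x)) u * g u))"
    unfolding ext_interval_integral_def using assms
    by (simp, intro ext_integral_cong) (auto simp: zero_ennreal.rep_eq split: split_indicator)
  also have "\<dots> = enn2ereal (\<integral>\<^sup>+u. indicator (einterval t (ereal x)) u * g u \<partial>lborel)"
    by (subst ext_integral_nonneg(1)) simp_all
  finally show ?thesis .
qed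

context gauge_system
begin

text \<open>With \<open>h\<close> constantly 1 this is the function p_{a;i,i+d}, and with
  \<open>h\<close> the indicator of \<open>{t..}\<close> it is the truncated p_{t;i,i+d}^+. Both
  families of test functions are thus instances of one operator and differ only in the factor at the
  top level.\<close>

definition V :: "nat \<Rightarrow> nat \<Rightarrow> (real \<Rightarrow> ennreal) \<Rightarrow> real \<Rightarrow> ennreal" where
  "V d i h = iter_nn below_kernel W d i (\<lambda>x. W (i + d) x * h x)"

lemma V_0: "V 0 i h = (\<lambda>x. W i x * h x)"
  by (simp add: V_def)

lemma V_Suc: "V (Suc d) i h = (\<lambda>x. W i x * (\<integral>\<^sup>+u. below_kernel x u * V d (Suc i) h u \<partial>lborel))"
  by (simp add: V_def)

lemma V_measurable[measurable]: "h \<in> borel_measurable borel \<Longrightarrow> V d i h \<in> borel_measurable borel"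
  unfolding V_def by measurable

lemma V_not_I: "x \<notin> I \<Longrightarrow> V d i h x = 0"
  by (cases d) (simp_all add: V_0 V_Suc W_not_I)

lemma V_mono: "(\<And>x. g x \<le> h x) \<Longrightarrow> V d i g x \<le> V d i h x"
  unfolding V_def by (intro below.iter_nn_mono mult_left_mono) auto

lemma below_integral_mono:
  "x \<le> y \<Longrightarrow> (\<integral>\<^sup>+u. below_kernel x u * g u \<partial>lborel) \<le> (\<integral>\<^sup>+u. below_kernel y u * g u \<partial>lborel)"
  by (intro nn_integral_mono mult_right_mono) (auto simp: below_kernel_def split: split_indicator)

text \<open>Extracting the weight as a factor avoids a quotient by \<open>W i\<close>, which
  vanishes off \<open>I\<close>.\<close>

lemma V_factor:
  assumes "mono h"
  obtains q where "mono q" "\<And>x. V d i h x = W i x * q x"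
proof (cases d)
  case 0
  then show thesis using assms by (intro that[of h]) (auto simp: V_0)
next
  case (Suc d')
  then show thesis
    by (intro that[of "\<lambda>x. \<integral>\<^sup>+u. below_kernel x u * V d' (Suc i) h u \<partial>lborel"])
      (auto simp: V_Suc mono_def below_integral_mono)
qed

definition Vr :: "nat \<Rightarrow> nat \<Rightarrow> (real \<Rightarrow> ennreal) \<Rightarrow> real \<Rightarrow> real" where
  "Vr d i h x = enn2real (V d i h x)"

lemma Vr_nonneg: "0 \<le> Vr d i h x"
  by (simp add: Vr_def)

lemma ennreal_Vr: "V d i h x < \<infinity> \<Longrightarrow> ennreal (Vr d i h x) = V d i h x"
  by (simp add: Vr_def)

lemma Vr_borel: "h \<in> borel_measurable borel \<Longrightarrow> Vr d i h \<in> borel_funs I"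
  unfolding Vr_def by (intro borel_funs_borel) measurable

lemma Vr_mono_on:
  assumes h: "mono h" and fin: "\<And>x. x \<in> I \<Longrightarrow> V d i h x < \<infinity>"
  shows "mono_on I (\<lambda>x. Vr d i h x / w i x)"
proof (rule mono_onI)
  obtain q where q: "mono q" "\<And>x. V d i h x = W i x * q x"
    using V_factor[OF h] by blast
  have e: "Vr d i h x / w i x = enn2real (q x)" "q x < \<infinity>" if "x \<in> I" for x
  proof -
    have "W i x * q x < \<infinity>" "0 < W i x"
      using fin[OF that] W_pos_finite[OF that] by (auto simp: q)
    then show "q x < \<infinity>" by (auto simp: ennreal_mult_less_top)
    show "Vr d i h x / w i x = enn2real (q x)"
      using that w_pos[OF that, of i] by (simp add: Vr_def q enn2real_mult W_I)
  qed
  fix x y assume "x \<in> I" "y \<in> I" "x \<le> y"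
  then show "Vr d i h x / w i x \<le> Vr d i h y / w i y"
    using e monoD[OF q(1), of x y] by (simp add: enn2real_mono)
qed

lemma Vr_locally_integrable:
  assumes h: "mono h" "h \<in> borel_measurable borel" and fin: "\<And>x. x \<in> I \<Longrightarrow> V d i h x < \<infinity>"
  shows "locally_integrable (Vr d i h)"
proof -
  have "locally_integrable (\<lambda>x. w i x * (Vr d i h x / w i x))"
    by (intro locally_integrable_w_mono Vr_mono_on borel_funs_arith Vr_borel w_borel assms)
  moreover have "w i x * (Vr d i h x / w i x) = Vr d i h x" if "x \<in> I" for x
    using w_pos[OF that, of i] by simp
  ultimately show ?thesis
    using locally_integrable_cong[of "\<lambda>x. w i x * (Vr d i h x / w i x)" "Vr d i h"] by blast
qed

lemma below_integral_split:
  assumes [measurable]: "g \<in> borel_measurable borel" and "y \<le> x"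
  shows "(\<integral>\<^sup>+u. below_kernel x u * g u \<partial>lborel)
    = (\<integral>\<^sup>+u. below_kernel y u * g u \<partial>lborel) + (\<integral>\<^sup>+u. indicator {y<..<x} u * g u \<partial>lborel)"
proof -
  have "(\<integral>\<^sup>+u. below_kernel x u * g u \<partial>lborel)
      = (\<integral>\<^sup>+u. below_kernel y u * g u + indicator {y<..<x} u * g u \<partial>lborel)"
  proof (rule nn_integral_cong_AE)
    show "AE u in lborel. below_kernel x u * g u = below_kernel y u * g u + indicator {y<..<x} u * g u"
      using AE_lborel_singleton[of y]
      by eventually_elim (use \<open>y \<le> x\<close> in \<open>auto simp: below_kernel_def split: split_indicator\<close>)
  qed
  then show ?thesis
    by (simp add: nn_integral_add)
qed

text \<open>If the inner function were infinite throughout the interval from \<open>y'\<close> to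
  \<open>y\<close>, which has positive length, the integral up to \<open>y\<close> would be
  infinite. The point found lies strictly above \<open>y'\<close>, as the induction in
  \<open>V_finite_everywhere\<close> requires.\<close>

lemma V_finite_step:
  assumes "V (Suc d) i h y < \<infinity>" "y' \<in> I" "y \<in> I" "y' < y"
  obtains u where "u \<in> I" "y' < u" "V d (Suc i) h u < \<infinity>"
proof (rule ccontr)
  note obtained = that
  assume no: "\<not> thesis"
  have inf: "V d (Suc i) h u = \<infinity>" if "y' < u" "u < y" for u
    using mem_I[OF assms(2,3), of u] that no obtained[of u] by (auto simp: less_top[symmetric])
  have "\<infinity> = (\<integral>\<^sup>+u. \<infinity> * indicator {y'<..<y} u \<partial>lborel)"
    using assms(4) by (subst nn_integral_cmult_indicator) (auto simp: ennreal_top_mult)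
  also have "\<dots> \<le> (\<integral>\<^sup>+u. below_kernel y u * V d (Suc i) h u \<partial>lborel)"
    by (intro nn_integral_mono) (auto simp: below_kernel_def inf split: split_indicator)
  finally have "(\<integral>\<^sup>+u. below_kernel y u * V d (Suc i) h u \<partial>lborel) = \<infinity>"
    by (simp add: top_unique)
  then show False
    using assms(1) W_pos_finite[OF assms(3), of i] by (auto simp: V_Suc ennreal_mult_less_top)
qed

text \<open>The dichotomy for \<open>p\<^bsub>a;j,m\<^esub>\<close>. The point \<open>y\<close> must not be the left end, where the integral is
  trivially finite.\<close>

lemma V_finite_everywhere:
  assumes h: "mono h" "h \<in> borel_measurable borel" "\<And>x. h x < \<infinity>"
    and y: "V d i h y < \<infinity>" "y' \<in> I" "y \<in> I" "y' < y" and x: "x \<in> I"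
  shows "V d i h x < \<infinity>"
  using y x
proof (induction d arbitrary: i y x)
  case 0
  then show ?case
    using h(3)[of x] W_pos_finite[of x i] by (simp add: V_0 ennreal_mult_less_top)
next
  case (Suc d)
  obtain u where "u \<in> I" "y' < u" "V d (Suc i) h u < \<infinity>"
    using V_finite_step[OF Suc.prems(1-4)] by blast
  then have fin: "V d (Suc i) h v < \<infinity>" if "v \<in> I" for v
    using Suc.IH[of "Suc i" u v] Suc.prems that by blast
  let ?G = "\<lambda>x. \<integral>\<^sup>+u. below_kernel x u * V d (Suc i) h u \<partial>lborel"
  have Gy: "?G y < \<infinity>"
    using Suc.prems W_pos_finite[of y i] by (auto simp: V_Suc ennreal_mult_less_top)
  have "?G x < \<infinity>"
  proof (cases "x \<le> y")
    case True
    then show ?thesis using below_integral_mono[OF True] Gy by (metis le_less_trans)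
  next
    case False
    then have yx: "y \<le> x" by simp
    \<comment> \<open>Beyond \<open>y\<close> only a compact interval contributes, and there the
      inner function, finite on \<open>I\<close> by induction, is locally integrable.\<close>
    have "(\<integral>\<^sup>+u. indicator {y<..<x} u * V d (Suc i) h u \<partial>lborel)
        = (\<integral>\<^sup>+u. indicator {y<..<x} u * ennreal (Vr d (Suc i) h u) \<partial>lborel)"
      using mem_I[OF Suc.prems(3,5)] fin
      by (intro nn_integral_cong) (auto simp: ennreal_Vr split: split_indicator)
    also have "\<dots> < \<infinity>"
      using nn_integral_interval(1)[OF Vr_locally_integrable[OF h(1,2) fin] Vr_nonneg Suc.prems(3,5) yx] by simp
    finally show ?thesis
      using Gy h(2) by (subst below_integral_split[OF _ yx]) auto
  qed
  then show ?case
    using W_pos_finite[OF Suc.prems(5), of i] by (auto simp: V_Suc ennreal_mult_less_top)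
qed

lemma V_finite_Suc:
  assumes h: "mono h" "h \<in> borel_measurable borel" "\<And>x. h x < \<infinity>"
    and fin: "\<And>x. x \<in> I \<Longrightarrow> V (Suc d) i h x < \<infinity>" and x: "x \<in> I"
  shows "V d (Suc i) h x < \<infinity>"
proof -
  obtain y y' where y: "y' \<in> I" "y \<in> I" "y' < y"
    using nontrivial by blast
  obtain u where "u \<in> I" "y' < u" "V d (Suc i) h u < \<infinity>"
    using V_finite_step[OF fin y] y(2) by blast
  with V_finite_everywhere[OF h] y(1) x show ?thesis by blast
qed

lemma V_finite_le:
  assumes h: "mono h" "h \<in> borel_measurable borel" "\<And>x. h x < \<infinity>"
    and fin: "\<And>x. x \<in> I \<Longrightarrow> V (d + e) i h x < \<infinity>" and x: "x \<in> I"
  shows "V d (i + e) h x < \<infinity>"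
  using fin x
proof (induction e arbitrary: i x)
  case (Suc e)
  have "V (d + e) (Suc i) h y < \<infinity>" if "y \<in> I" for y
    using V_finite_Suc[OF h _ that, of "d + e" i] Suc.prems(1) by simp
  from Suc.IH[OF this Suc.prems(2)] show ?case by simp
qed simp

lemma V_left_of_support:
  assumes "\<And>x. x < t \<Longrightarrow> h x = 0" "x < t"
  shows "V d i h x = 0"
  using assms(2)
proof (induction d arbitrary: i x)
  case (Suc d)
  then have "(\<integral>\<^sup>+u. below_kernel x u * V d (Suc i) h u \<partial>lborel) = (\<integral>\<^sup>+(u::real). 0 \<partial>lborel)"
    by (intro nn_integral_cong) (auto simp: below_kernel_def split: split_indicator)
  then show ?case by (simp add: V_Suc)
qed (simp add: V_0 assms(1))

text \<open>The integrals effectively start at \<open>t\<close>, so on \<open>{t..y}\<close> every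
  level costs only a gauge bound and the length of the interval. The induction carries a bound
  uniform in \<open>x \<le> y\<close>, since pointwise finiteness would not control the next
  integral.\<close>

lemma V_finite_of_support:
  assumes h: "\<And>x. x < t \<Longrightarrow> h x = 0" "\<And>x. h x \<le> 1" and t: "t \<in> I" and x: "x \<in> I"
  shows "V d i h x < \<infinity>"
proof -
  have "\<exists>C\<ge>0. \<forall>x\<in>I. x \<le> y \<longrightarrow> V d i h x \<le> ennreal C" if y: "y \<in> I" for y
  proof (induction d arbitrary: i)
    case 0
    obtain C where C: "0 \<le> C" "\<And>u. t \<le> u \<Longrightarrow> u \<le> y \<Longrightarrow> w i u \<le> C"
      using w_bounded[OF t y] by blast
    have "V 0 i h x \<le> ennreal C" if "x \<in> I" "x \<le> y" for x
    proof (cases "x < t")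
      case True
      then show ?thesis by (simp add: V_0 h)
    next
      case False
      have "W i x * h x \<le> ennreal C * 1"
        using C False that h(2) by (intro mult_mono) (auto simp: W_I intro!: ennreal_leI)
      then show ?thesis by (simp add: V_0)
    qed
    then show ?case using C(1) by blast
  next
    case (Suc d)
    obtain C where C: "0 \<le> C" "\<And>u. t \<le> u \<Longrightarrow> u \<le> y \<Longrightarrow> w i u \<le> C"
      using w_bounded[OF t y] by blast
    obtain D where D: "0 \<le> D" "\<And>x. x \<in> I \<Longrightarrow> x \<le> y \<Longrightarrow> V d (Suc i) h x \<le> ennreal D"
      using Suc.IH by blast
    \<comment> \<open>\<open>C\<close> bounds the gauge function on \<open>{t..y}\<close>,
      \<open>D\<close> the inner level, and the last factor is the length; the modulus keeps it
      nonnegative when \<open>y < t\<close>.\<close>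
    let ?E = "C * (D * \<bar>y - t\<bar>)"
    have "V (Suc d) i h x \<le> ennreal ?E" if x: "x \<in> I" "x \<le> y" for x
    proof (cases "x < t")
      case True
      then show ?thesis by (simp add: V_left_of_support[OF h(1)])
    next
      case False
      have "(\<integral>\<^sup>+u. below_kernel x u * V d (Suc i) h u \<partial>lborel) \<le> (\<integral>\<^sup>+u. ennreal D * indicator {t..y} u \<partial>lborel)"
      proof (intro nn_integral_mono)
        fix u
        show "below_kernel x u * V d (Suc i) h u \<le> ennreal D * indicator {t..y} u"
        proof (cases "u \<in> {t..y}")
          case True
          then show ?thesis
            using D(2)[of u] mem_I[OF t y, of u] by (auto simp: below_kernel_def split: split_indicator)
        next
          case False
          then show ?thesis
            using x V_left_of_support[of t h u, OF h(1)] by (auto simp: below_kernel_def split: split_indicator)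
        qed
      qed
      also have "\<dots> = ennreal (D * \<bar>y - t\<bar>)"
        using False x D(1) by (subst nn_integral_cmult_indicator) (auto simp: ennreal_mult)
      finally have "W i x * (\<integral>\<^sup>+u. below_kernel x u * V d (Suc i) h u \<partial>lborel) \<le> ennreal C * ennreal (D * \<bar>y - t\<bar>)"
        using C False x by (intro mult_mono) (auto simp: W_I intro!: ennreal_leI)
      then show ?thesis
        using C(1) D(1) by (simp add: V_Suc ennreal_mult)
    qed
    moreover have "0 \<le> ?E" using C(1) D(1) by simp
    ultimately show ?case by blast
  qed
  from this[OF x] obtain C where "V d i h x \<le> ennreal C"
    using x by blast
  then show ?thesis
    using ennreal_less_top[of C] by (simp add: le_less_trans)
qed

text \<open>Two integrals from the left end differ by one over a compact interval, so
  \<open>Vr\<close> obeys the linking equation of a chain; by positivity the modulus of the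
  increment is an unsigned integral. In that last form, increments of test functions can be matched
  with the layers of \<open>f\<close>.\<close>

lemma V_link:
  assumes h: "mono h" "h \<in> borel_measurable borel" "\<And>x. h x < \<infinity>"
    and fin: "\<And>x. x \<in> I \<Longrightarrow> V (Suc d) i h x < \<infinity>"
  shows "locally_integrable (Vr d (Suc i) h)"
    "\<lbrakk>x \<in> I; y \<in> I\<rbrakk> \<Longrightarrow> Vr (Suc d) i h x / w i x
      = Vr (Suc d) i h y / w i y + (LBINT u=ereal y..ereal x. Vr d (Suc i) h u)"
    "\<lbrakk>x \<in> I; y \<in> I\<rbrakk> \<Longrightarrow> ennreal \<bar>Vr (Suc d) i h x / w i x - Vr (Suc d) i h y / w i y\<bar>
      = (\<integral>\<^sup>+u. between_kernel y x u * V d (Suc i) h u \<partial>lborel)"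
proof -
  have fin': "V d (Suc i) h x < \<infinity>" if "x \<in> I" for x
    by (rule V_finite_Suc[OF h fin that])
  show li: "locally_integrable (Vr d (Suc i) h)"
    by (rule Vr_locally_integrable[OF h(1,2) fin'])
  let ?G = "\<lambda>x. \<integral>\<^sup>+u. below_kernel x u * V d (Suc i) h u \<partial>lborel"
  have G: "?G x < \<infinity>" "Vr (Suc d) i h x / w i x = enn2real (?G x)" if "x \<in> I" for x
  proof -
    show "?G x < \<infinity>"
      using fin[OF that] W_pos_finite[OF that, of i] by (auto simp: V_Suc ennreal_mult_less_top)
    show "Vr (Suc d) i h x / w i x = enn2real (?G x)"
      using w_pos[OF that, of i] by (simp add: Vr_def V_Suc enn2real_mult W_I[OF that])
  qed
  have le: "enn2real (?G x) = enn2real (?G y) + (LBINT u=ereal y..ereal x. Vr d (Suc i) h u)"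
    if xy: "x \<in> I" "y \<in> I" "y \<le> x" for x y
  proof -
    have "(\<integral>\<^sup>+u. indicator {y<..<x} u * V d (Suc i) h u \<partial>lborel)
        = (\<integral>\<^sup>+u. indicator {y<..<x} u * ennreal (Vr d (Suc i) h u) \<partial>lborel)"
      using mem_I[OF xy(2,1)] fin'
      by (intro nn_integral_cong) (auto simp: ennreal_Vr split: split_indicator)
    also have "\<dots> = ennreal (LBINT u=ereal y..ereal x. Vr d (Suc i) h u)"
      by (rule nn_integral_interval(1)[OF li Vr_nonneg xy(2,1,3)])
    finally have "?G x = ?G y + ennreal (LBINT u=ereal y..ereal x. Vr d (Suc i) h u)"
      using h(2) below_integral_split[OF _ xy(3), of "V d (Suc i) h"] by simp
    then show ?thesis
      using G(1)[OF xy(2)] nn_integral_interval(2)[OF li Vr_nonneg xy(2,1,3)]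
      by (simp add: enn2real_plus)
  qed
  assume xy: "x \<in> I" "y \<in> I"
  show step: "Vr (Suc d) i h x / w i x
      = Vr (Suc d) i h y / w i y + (LBINT u=ereal y..ereal x. Vr d (Suc i) h u)"
    using le[OF xy] le[OF xy(2,1)] interval_integral_endpoints_reverse[of "ereal x" "ereal y" "Vr d (Suc i) h"]
    by (cases "y \<le> x") (simp_all add: G(2) xy)
  have "ennreal \<bar>LBINT u=ereal y..ereal x. Vr d (Suc i) h u\<bar>
      = (\<integral>\<^sup>+u. between_kernel y x u * ennreal \<bar>Vr d (Suc i) h u\<bar> \<partial>lborel)"
    by (rule interval_integral_side(2)[where e = 0, OF li xy(2,1)]) (simp add: Vr_nonneg)
  also have "\<dots> = (\<integral>\<^sup>+u. between_kernel y x u * V d (Suc i) h u \<partial>lborel)"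
    by (rule nn_integral_between_cong[OF xy(2,1)]) (simp add: Vr_nonneg ennreal_Vr[OF fin'])
  finally show "ennreal \<bar>Vr (Suc d) i h x / w i x - Vr (Suc d) i h y / w i y\<bar>
      = (\<integral>\<^sup>+u. between_kernel y x u * V d (Suc i) h u \<partial>lborel)"
    using step by simp
qed

lemma chain_Vr:
  assumes h: "mono h" "h \<in> borel_measurable borel" "\<And>x. h x < \<infinity>"
    and fin: "\<And>x. x \<in> I \<Longrightarrow> V n 0 h x < \<infinity>"
  shows "chain n (\<lambda>j. Vr (n - j) j h)"
  unfolding chain_def
proof (intro conjI allI impI ballI)
  show "Vr (n - j) j h \<in> borel_funs I" for j
    by (rule Vr_borel[OF h(2)])
  fix j assume j: "j < n"
  then have n: "n - j = Suc (n - Suc j)" "n = Suc (n - Suc j) + j" by auto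
  have f: "V (Suc (n - Suc j)) j h x < \<infinity>" if "x \<in> I" for x
    using V_finite_le[OF h, where d = "Suc (n - Suc j)" and e = j and i = 0] fin that n(2) by simp
  show "locally_integrable (Vr (n - Suc j) (Suc j) h)"
    by (rule V_link(1)[OF h f])
  fix x y assume "x \<in> I" "y \<in> I"
  from V_link(2)[OF h f this]
  show "Vr (n - j) j h x / w j x = Vr (n - j) j h y / w j y
      + (LBINT u=ereal y..ereal x. Vr (n - Suc j) (Suc j) h u)"
    by (simp only: n(1))
qed

lemma ereal_W_mult: "x \<in> I \<Longrightarrow> ereal (w i x) * enn2ereal c = enn2ereal (W i x * c)"
  using w_pos[of x i] by (simp add: times_ennreal.rep_eq W_I enn2ereal_ennreal)

lemma left_end_le: "x \<in> I \<Longrightarrow> left_end I \<le> ereal x"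
  unfolding left_end_def by (rule INF_lower)

lemma left_end_less:
  assumes "x \<in> I" "left_end I < ereal u" "u < x"
  shows "u \<in> I"
proof -
  obtain y where "y \<in> I" "y < u"
    using assms(2) by (auto simp: left_end_def Inf_less_iff)
  then show ?thesis using mem_I[of y x u] assms by simp
qed

lemma p_fun_left_end: "x \<in> I \<Longrightarrow> p_fun w (left_end I) i (i + d) x = enn2ereal (V d i (\<lambda>_. 1) x)"
proof (induction d arbitrary: i x)
  case 0
  then show ?case
    using w_pos[of x i] by (simp add: p_fun_same V_0 W_I enn2ereal_ennreal)
next
  case (Suc d)
  have "p_fun w (left_end I) i (i + Suc d) x
      = ereal (w i x) * ext_interval_integral (left_end I) x (p_fun w (left_end I) (Suc i) (i + Suc d))"
    by (rule p_fun_less) simp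
  also have "ext_interval_integral (left_end I) x (p_fun w (left_end I) (Suc i) (i + Suc d))
      = enn2ereal (\<integral>\<^sup>+u. indicator (einterval (left_end I) (ereal x)) u * V d (Suc i) (\<lambda>_. 1) u \<partial>lborel)"
  proof (rule ext_interval_integral_nn[OF left_end_le[OF Suc.prems]])
    fix u assume "u \<in> einterval (left_end I) (ereal x)"
    then have "u \<in> I"
      using left_end_less[OF Suc.prems] by (auto simp: einterval_def)
    from Suc.IH[OF this, of "Suc i"]
    show "p_fun w (left_end I) (Suc i) (i + Suc d) u = enn2ereal (V d (Suc i) (\<lambda>_. 1) u)" by simp
  qed
  also have "(\<integral>\<^sup>+u. indicator (einterval (left_end I) (ereal x)) u * V d (Suc i) (\<lambda>_. 1) u \<partial>lborel)
      = (\<integral>\<^sup>+u. below_kernel x u * V d (Suc i) (\<lambda>_. 1) u \<partial>lborel)"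
  proof (rule nn_integral_cong_AE)
    show "AE u in lborel. indicator (einterval (left_end I) (ereal x)) u * V d (Suc i) (\<lambda>_. 1) u
        = below_kernel x u * V d (Suc i) (\<lambda>_. 1) u"
      \<comment> \<open>When the left end belongs to \<open>I\<close>, it is the one point of
        \<open>I\<close> below \<open>x\<close> at which the integrands may differ. If the left end
        is -\<infinity>, \<open>real_of_ereal\<close> returns 0 and a harmless point is
        discarded.\<close>
      using AE_lborel_singleton[of "real_of_ereal (left_end I)"]
    proof eventually_elim
      case (elim u)
      have "left_end I < ereal u" if "u \<in> I"
        using left_end_le[OF that] elim by (metis order_le_less real_of_ereal.simps(1))
      then show ?case
        using V_not_I[of u] by (cases "u \<in> I") (auto simp: below_kernel_def einterval_def split: split_indicator)
    qed
  qed
  finally show ?case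
    by (simp add: ereal_W_mult[OF Suc.prems] V_Suc)
qed

text \<open>Truncating the top factor is enough: the outer integrals then vanish to the left of
  \<open>t\<close> of their own accord, so integrating from \<open>t\<close> and from the left end
  gives the same value.\<close>

lemma p_fun_plus_V:
  assumes "t \<in> I" "x \<in> I"
  shows "p_fun_plus w t i (i + d) x = enn2ereal (V d i (indicator {t..}) x)"
  using assms(2)
proof (induction d arbitrary: i x)
  case 0
  then show ?case
    using w_pos[of x i]
    by (auto simp: p_fun_plus_def p_fun_same V_0 W_I enn2ereal_ennreal zero_ennreal.rep_eq)
next
  case (Suc d)
  have z: "V d' j (indicator {t..}) u = 0" if "u < t" for d' j u
    by (rule V_left_of_support[OF _ that]) simp
  show ?case
  proof (cases "t \<le> x")
    case True
    have "p_fun w (ereal t) i (i + Suc d) x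
        = ereal (w i x) * ext_interval_integral (ereal t) x (p_fun w (ereal t) (Suc i) (i + Suc d))"
      by (rule p_fun_less) simp
    also have "ext_interval_integral (ereal t) x (p_fun w (ereal t) (Suc i) (i + Suc d))
        = enn2ereal (\<integral>\<^sup>+u. indicator (einterval (ereal t) (ereal x)) u * V d (Suc i) (indicator {t..}) u \<partial>lborel)"
    proof (rule ext_interval_integral_nn)
      fix u assume "u \<in> einterval (ereal t) (ereal x)"
      then have "t < u" "u < x" by (auto simp: einterval_def)
      then show "p_fun w (ereal t) (Suc i) (i + Suc d) u = enn2ereal (V d (Suc i) (indicator {t..}) u)"
        using Suc.IH[of u "Suc i"] mem_I[OF assms(1) Suc.prems, of u] by (simp add: p_fun_plus_def)
    qed (use True in simp)
    also have "(\<integral>\<^sup>+u. indicator (einterval (ereal t) (ereal x)) u * V d (Suc i) (indicator {t..}) u \<partial>lborel)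
        = (\<integral>\<^sup>+u. below_kernel x u * V d (Suc i) (indicator {t..}) u \<partial>lborel)"
    proof (rule nn_integral_cong_AE)
      show "AE u in lborel. indicator (einterval (ereal t) (ereal x)) u * V d (Suc i) (indicator {t..}) u
          = below_kernel x u * V d (Suc i) (indicator {t..}) u"
        using AE_lborel_singleton[of t]
        by eventually_elim (use z in \<open>force simp: below_kernel_def einterval_def split: split_indicator\<close>)
    qed
    finally show ?thesis
      using True by (simp add: ereal_W_mult[OF Suc.prems] V_Suc p_fun_plus_def)
  next
    case False
    then show ?thesis by (simp add: p_fun_plus_def z zero_ennreal.rep_eq)
  qed
qed

end

section \<open>Perturbation of integrals and polynomials in the cone\<close>

text \<open>For each of the two measures, \<open>a\<close> and \<open>b\<close> stand for the
  integrals of the positive and negative part of \<open>f\<close>, \<open>p\<close> and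
  \<open>q\<close> for those of the polynomial, \<open>x\<close> and \<open>y\<close> for those of
  the remainder. Only the \<open>a\<close> and \<open>x\<close> may be infinite.\<close>

lemma neg_part_comparison:
  fixes a1 a2 b1 b2 p1 p2 q1 q2 x1 x2 y1 y2 :: ennreal
  assumes "a1 + q1 + y1 = b1 + p1 + x1" "a2 + q2 + y2 = b2 + p2 + x2" "p1 + q2 = p2 + q1"
    and "p1 < top" "p2 < top" "q1 < top" "q2 < top" "b1 < top" "b2 < top" "y1 < top" "y2 < top"
  shows "a2 + b1 \<le> a1 + b2 \<longleftrightarrow> x2 + y1 \<le> x1 + y2"
proof -
  have *: "\<exists>r\<ge>0. c = ennreal r" if "c < top" for c
    using that by (cases c) auto
  obtain r1 r2 s1 s2 d1 d2 e1 e2 where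
    r: "p1 = ennreal r1" "p2 = ennreal r2" "q1 = ennreal s1" "q2 = ennreal s2"
      "b1 = ennreal d1" "b2 = ennreal d2" "y1 = ennreal e1" "y2 = ennreal e2"
    and nn: "0 \<le> r1" "0 \<le> r2" "0 \<le> s1" "0 \<le> s2" "0 \<le> d1" "0 \<le> d2" "0 \<le> e1" "0 \<le> e2"
    using assms(4-11)[THEN *] by blast
  have r3: "r1 + s2 = r2 + s1"
    using assms(3) nn unfolding r by (simp add: ennreal_plus[symmetric] del: ennreal_plus)
  show ?thesis
    using assms(1,2) nn r3 unfolding r
    by (cases a1; cases a2; cases x1; cases x2)
      (auto simp: ennreal_plus[symmetric] top_unique simp del: ennreal_plus)
qed

text \<open>\<open>p\<close> has equal finite integrals, so it drops out of the comparison even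
  where the positive parts of \<open>f\<close> and \<open>h\<close> have infinite integrals. The
  first claim is asserted for \<open>\<nu>1\<close>; exchanging the measures yields it for
  \<open>\<nu>2\<close>.\<close>

lemma integral_ge_perturb:
  fixes f p h :: "real \<Rightarrow> real"
  assumes p: "integrable \<nu>1 p" "integrable \<nu>2 p" "(\<integral>x. p x \<partial>\<nu>1) = (\<integral>x. p x \<partial>\<nu>2)"
    and h: "h \<in> borel_measurable \<nu>1" "h \<in> borel_measurable \<nu>2"
    and f: "\<And>x. x \<in> space \<nu>1 \<Longrightarrow> f x = p x + h x" and sp: "space \<nu>2 = space \<nu>1"
  shows "(\<integral>\<^sup>+x. ennreal (- h x) \<partial>\<nu>1) < \<infinity> \<longleftrightarrow> (\<integral>\<^sup>+x. ennreal (- f x) \<partial>\<nu>1) < \<infinity>"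
    "\<lbrakk>(\<integral>\<^sup>+x. ennreal (- h x) \<partial>\<nu>1) < \<infinity>; (\<integral>\<^sup>+x. ennreal (- h x) \<partial>\<nu>2) < \<infinity>\<rbrakk> \<Longrightarrow>
      integral_ge \<nu>1 \<nu>2 (\<lambda>x. ereal (f x)) \<longleftrightarrow>
        (\<integral>\<^sup>+x. ennreal (h x) \<partial>\<nu>2) + (\<integral>\<^sup>+x. ennreal (- h x) \<partial>\<nu>1)
          \<le> (\<integral>\<^sup>+x. ennreal (h x) \<partial>\<nu>1) + (\<integral>\<^sup>+x. ennreal (- h x) \<partial>\<nu>2)"
proof -
  have *: "(\<integral>\<^sup>+x. ennreal (- h x) \<partial>\<nu>) < \<infinity> \<longleftrightarrow> (\<integral>\<^sup>+x. ennreal (- f x) \<partial>\<nu>) < \<infinity>"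
    if \<nu>: "integrable \<nu> p" "h \<in> borel_measurable \<nu>" "space \<nu> = space \<nu>1" for \<nu>
  proof -
    have [measurable]: "p \<in> borel_measurable \<nu>" "h \<in> borel_measurable \<nu>" using \<nu> by auto
    have fin: "(\<integral>\<^sup>+x. ennreal (p x) \<partial>\<nu>) < \<infinity>" "(\<integral>\<^sup>+x. ennreal (- p x) \<partial>\<nu>) < \<infinity>"
      using \<nu>(1) by (auto simp: real_integrable_def less_top[symmetric])
    have sum: "ennreal (a + b) \<le> ennreal a + ennreal b" for a b
      by (cases "0 \<le> a"; cases "0 \<le> b")
        (auto simp: ennreal_plus[symmetric] ennreal_neg simp del: ennreal_plus intro!: ennreal_leI)
    have le: "ennreal (- f x) \<le> ennreal (- p x) + ennreal (- h x)" "ennreal (- h x) \<le> ennreal (p x) + ennreal (- f x)"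
      if "x \<in> space \<nu>" for x
      using sum[of "- p x" "- h x"] sum[of "p x" "- f x"] that f \<nu>(3) by auto
    have fm[measurable]: "(\<lambda>x. f x) \<in> borel_measurable \<nu>"
      using measurable_cong[of \<nu> f "\<lambda>x. p x + h x" borel] f \<nu>(3) by simp
    have "(\<integral>\<^sup>+x. ennreal (- f x) \<partial>\<nu>) \<le> (\<integral>\<^sup>+x. ennreal (- p x) + ennreal (- h x) \<partial>\<nu>)"
      "(\<integral>\<^sup>+x. ennreal (- h x) \<partial>\<nu>) \<le> (\<integral>\<^sup>+x. ennreal (p x) + ennreal (- f x) \<partial>\<nu>)"
      by (intro nn_integral_mono le; assumption)+
    then show ?thesis
      using fin by (auto simp: nn_integral_add le_less_trans)
  qed
  show "(\<integral>\<^sup>+x. ennreal (- h x) \<partial>\<nu>1) < \<infinity> \<longleftrightarrow> (\<integral>\<^sup>+x. ennreal (- f x) \<partial>\<nu>1) < \<infinity>"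
    by (rule *) (use p h in auto)
  assume fin: "(\<integral>\<^sup>+x. ennreal (- h x) \<partial>\<nu>1) < \<infinity>" "(\<integral>\<^sup>+x. ennreal (- h x) \<partial>\<nu>2) < \<infinity>"
  then have finf: "(\<integral>\<^sup>+x. ennreal (- f x) \<partial>\<nu>1) < \<infinity>" "(\<integral>\<^sup>+x. ennreal (- f x) \<partial>\<nu>2) < \<infinity>"
    using *[of \<nu>1] *[of \<nu>2] p h sp by auto
  have id: "(\<integral>\<^sup>+x. ennreal (f x) \<partial>\<nu>) + (\<integral>\<^sup>+x. ennreal (- p x) \<partial>\<nu>) + (\<integral>\<^sup>+x. ennreal (- h x) \<partial>\<nu>)
      = (\<integral>\<^sup>+x. ennreal (- f x) \<partial>\<nu>) + (\<integral>\<^sup>+x. ennreal (p x) \<partial>\<nu>) + (\<integral>\<^sup>+x. ennreal (h x) \<partial>\<nu>)"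
    if \<nu>: "integrable \<nu> p" "h \<in> borel_measurable \<nu>" "space \<nu> = space \<nu>1" for \<nu>
  proof -
    have "(\<integral>\<^sup>+x. ennreal (f x) \<partial>\<nu>) = (\<integral>\<^sup>+x. ennreal (p x + h x) \<partial>\<nu>)"
      "(\<integral>\<^sup>+x. ennreal (- f x) \<partial>\<nu>) = (\<integral>\<^sup>+x. ennreal (- (p x + h x)) \<partial>\<nu>)"
      by (intro nn_integral_cong; use f \<nu>(3) in simp)+
    then show ?thesis
      using nn_integral_pos_neg_parts[of p \<nu> h] \<nu>(1,2) by simp
  qed
  have pint: "(\<integral>\<^sup>+x. ennreal (p x) \<partial>\<nu>1) + (\<integral>\<^sup>+x. ennreal (- p x) \<partial>\<nu>2)
      = (\<integral>\<^sup>+x. ennreal (p x) \<partial>\<nu>2) + (\<integral>\<^sup>+x. ennreal (- p x) \<partial>\<nu>1)"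
    using p unfolding real_lebesgue_integral_def[OF p(1)] real_lebesgue_integral_def[OF p(2)]
    by (cases "\<integral>\<^sup>+x. ennreal (p x) \<partial>\<nu>1"; cases "\<integral>\<^sup>+x. ennreal (- p x) \<partial>\<nu>1";
        cases "\<integral>\<^sup>+x. ennreal (p x) \<partial>\<nu>2"; cases "\<integral>\<^sup>+x. ennreal (- p x) \<partial>\<nu>2")
      (auto simp: real_integrable_def ennreal_plus[symmetric] simp del: ennreal_plus)
  show "integral_ge \<nu>1 \<nu>2 (\<lambda>x. ereal (f x)) \<longleftrightarrow>
        (\<integral>\<^sup>+x. ennreal (h x) \<partial>\<nu>2) + (\<integral>\<^sup>+x. ennreal (- h x) \<partial>\<nu>1)
          \<le> (\<integral>\<^sup>+x. ennreal (h x) \<partial>\<nu>1) + (\<integral>\<^sup>+x. ennreal (- h x) \<partial>\<nu>2)"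
    unfolding integral_ge_iff_nn[OF finf]
    by (rule neg_part_comparison[OF id[OF p(1) h(1)] id[OF p(2) h(2) sp] pint])
      (use fin finf p in \<open>auto simp: real_integrable_def less_top[symmetric]\<close>)
qed

section \<open>Polynomials and the functions of (ii') as members of the cone\<close>

context gauge_system
begin

lemma N_plusD:
  assumes "\<nu> \<in> N_plus I"
  shows "space \<nu> = I" "f \<in> borel_funs I \<Longrightarrow> f \<in> borel_measurable \<nu>"
    "h \<in> borel_measurable borel \<Longrightarrow> h \<in> borel_measurable \<nu>"
proof -
  have s: "sets \<nu> = sets (restrict_space borel I)" using assms by (simp add: N_plus_def)
  show "space \<nu> = I" using sets_eq_imp_space_eq[OF s] by (simp add: space_restrict_space)
  show "f \<in> borel_funs I \<Longrightarrow> f \<in> borel_measurable \<nu>"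
    using measurable_cong_sets[OF s refl] by (auto simp: borel_funs_def)
  show "h \<in> borel_measurable borel \<Longrightarrow> h \<in> borel_measurable \<nu>"
    using measurable_cong_sets[OF s refl] measurable_restrict_space1 by blast
qed

lemma P_plus_of_chain:
  assumes F: "chain (Suc n) F" and top: "\<And>x. x \<in> I \<Longrightarrow> F (Suc n) x = 0"
    and mono: "\<And>j. k - 1 \<le> j \<Longrightarrow> j \<le> n \<Longrightarrow> mono_on I (\<lambda>x. F j x / w j x)"
  shows "F 0 \<in> P_plus I w k n"
proof -
  have S: "F 0 \<in> S_space I w j" "\<And>x. x \<in> I \<Longrightarrow> gderiv I w j (F 0) x = F j x / w j x" if "j \<le> Suc n" for j
    using chain_in_S_space[OF F top refl that] by auto
  have "mono_on I (gderiv I w j (F 0))" if "k - 1 \<le> j" "j \<le> n" for j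
  proof (rule mono_onI)
    fix x y assume "x \<in> I" "y \<in> I" "x \<le> y"
    then show "gderiv I w j (F 0) x \<le> gderiv I w j (F 0) y"
      using mono_onD[OF mono[OF that], of x y] S(2)[of j] that(2) by simp
  qed
  then show ?thesis
    using S(1)[of n] S(1)[of "Suc n"] S(2)[of "Suc n"] top by (auto simp: P_plus_def P_le_def F_plus_def)
qed

text \<open>From order \<open>k - 1 \<ge> i\<close> on, the derivatives are the constants 1 (at
  order \<open>i\<close>) or 0, and a constant is nondecreasing with either sign. Having both signs
  in the cone is what turns an inequality into the equality (i').\<close>

lemma polynomial_in_P_plus:
  assumes s: "s \<in> I" and i: "i < k" and n: "k \<le> n + 1"
  shows "iter_re w s i 0 (w i) \<in> P_plus I w k n"
    "(\<lambda>x. - iter_re w s i 0 (w i) x) \<in> P_plus I w k n"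
proof -
  define F where "F j = (if j \<le> i then iter_re w s (i - j) j (w i) else (\<lambda>x. 0))" for j
  have "chain i (\<lambda>j. iter_re w s (i - j) j (w i))"
    by (intro chain_iter_re s w_locally_integrable w_borel)
  then have F: "chain N F" for N
    unfolding F_def by (rule chain_extend[where c = 1]) simp
  have F0: "F 0 = iter_re w s i 0 (w i)" by (simp add: F_def)
  have const: "F j x / w j x = (if j = i then 1 else 0)" if "k - 1 \<le> j" "x \<in> I" for j x
    using i that w_pos[OF that(2), of i] by (auto simp: F_def)
  have top: "F (Suc n) x = 0" for x
    using i n by (simp add: F_def)
  show "iter_re w s i 0 (w i) \<in> P_plus I w k n"
    unfolding F0[symmetric] using F top by (rule P_plus_of_chain) (auto intro!: mono_onI simp: const)
  show "(\<lambda>x. - iter_re w s i 0 (w i) x) \<in> P_plus I w k n"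
    unfolding F0[symmetric] using chain_uminus[OF F]
    by (rule P_plus_of_chain[where F = "\<lambda>j x. - F j x"]) (auto intro!: mono_onI simp: const top)
qed

lemma Vr_one_top: "x \<in> I \<Longrightarrow> Vr 0 j (\<lambda>_. 1) x = w j x"
  using w_pos[of x j] by (simp add: Vr_def V_0 W_I)

lemma F_index_iff:
  "j \<in> F_index I w k n \<longleftrightarrow> k \<le> j \<and> j \<le> n \<and> (\<forall>x\<in>I. V (j - k) k (\<lambda>_. 1) x < \<infinity>)"
proof -
  have "p_fun w (left_end I) k j x < \<infinity> \<longleftrightarrow> V (j - k) k (\<lambda>_. 1) x < \<infinity>" if "k \<le> j" "x \<in> I" for x
    using p_fun_left_end[OF that(2), of k "j - k"] that(1)
    by (cases "V (j - k) k (\<lambda>_. 1) x") (auto simp: enn2ereal_ennreal)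
  then show ?thesis by (auto simp: F_index_def)
qed

lemma p_az_fun_real:
  assumes j: "j \<in> F_index I w k n" and z: "z \<in> I" and x: "x \<in> I"
  shows "p_az_fun I w z 0 k j x = ereal (iter_re w z k 0 (Vr (j - k) k (\<lambda>_. 1)) x)"
proof -
  have j': "k \<le> j" and fin: "\<And>x. x \<in> I \<Longrightarrow> V (j - k) k (\<lambda>_. 1) x < \<infinity>"
    using j by (auto simp: F_index_iff)
  have "p_fun w (left_end I) k j u = ereal (Vr (j - k) k (\<lambda>_. 1) u)" if "u \<in> I" for u
    using p_fun_left_end[OF that, of k "j - k"] j' fin[OF that]
    by (simp add: Vr_def) (cases "V (j - k) k (\<lambda>_. 1) u"; simp add: enn2ereal_ennreal)
  moreover have "locally_integrable (Vr (j - k) k (\<lambda>_. 1))"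
    by (rule Vr_locally_integrable[OF _ _ fin]) (auto simp: mono_def)
  ultimately show ?thesis
    unfolding p_az_fun_def using iter_integral_real[of _ z _ x 0 k] z x by simp
qed

text \<open>Two chains are glued at level \<open>k\<close>: integrals from \<open>z\<close> below
  it, integrals from the left end from there on. Monotonicity at order \<open>k - 1\<close> comes
  from the nonnegative integrand, at orders \<open>k\<close> to \<open>j\<close> from
  \<open>Vr_mono_on\<close>, and above \<open>j\<close> the derivatives vanish.\<close>

lemma p_az_in_P_plus:
  assumes j: "j \<in> F_index I w k n" and z: "z \<in> I" and k: "1 \<le> k"
  shows "iter_re w z k 0 (Vr (j - k) k (\<lambda>_. 1)) \<in> P_plus I w k n"
proof -
  let ?one = "\<lambda>_::real. 1::ennreal"
  let ?g = "Vr (j - k) k ?one"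
  have one: "mono ?one" "?one \<in> borel_measurable borel" "\<And>x. ?one x < \<infinity>"
    by (auto simp: mono_def)
  have j': "k \<le> j" "j \<le> n" and fin0: "\<And>x. x \<in> I \<Longrightarrow> V (j - k) k ?one x < \<infinity>"
    using j by (auto simp: F_index_iff)
  have fin: "V (j - i) i ?one x < \<infinity>" if "k \<le> i" "i \<le> j" "x \<in> I" for i x
    using V_finite_le[OF one, where d = "j - i" and e = "i - k" and i = k] fin0 that by simp
  have li: "locally_integrable ?g"
    by (rule Vr_locally_integrable[OF one(1,2) fin0])
  define E where "E i = (if i < k then iter_re w z (k - i) i ?g else Vr (j - i) i ?one)" for i
  define F where "F i = (if i \<le> j then E i else (\<lambda>x. 0))" for i
  have I: "chain k (\<lambda>i. iter_re w z (k - i) i ?g)"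
    by (intro chain_iter_re li z Vr_borel one)
  have E: "chain j E"
    unfolding chain_def
  proof (intro conjI allI impI ballI)
    show "E i \<in> borel_funs I" for i
      using chain_D(1)[OF I, of i] Vr_borel[OF one(2)] by (auto simp: E_def)
    fix i assume i: "i < j"
    \<comment> \<open>At the seam \<open>Suc i = k\<close> the signed iterate has no integration
      left and is \<open>?g\<close> itself, so both branches of \<open>E\<close> agree
      there.\<close>
    have low: "E i = iter_re w z (k - i) i ?g" "E (Suc i) = iter_re w z (k - Suc i) (Suc i) ?g" if "i < k"
      using that by (cases "Suc i = k"; simp add: E_def)+
    have high: "E i = Vr (Suc (j - Suc i)) i ?one" "E (Suc i) = Vr (j - Suc i) (Suc i) ?one"
      "\<And>x. x \<in> I \<Longrightarrow> V (Suc (j - Suc i)) i ?one x < \<infinity>" if "k \<le> i"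
    proof -
      have "j - i = Suc (j - Suc i)" using i by simp
      then show "E i = Vr (Suc (j - Suc i)) i ?one" "E (Suc i) = Vr (j - Suc i) (Suc i) ?one"
        "\<And>x. x \<in> I \<Longrightarrow> V (Suc (j - Suc i)) i ?one x < \<infinity>"
        using that fin[of i] i by (simp_all add: E_def)
    qed
    show "locally_integrable (E (Suc i))"
    proof (cases "i < k")
      case True
      then show ?thesis using chain_D(2)[OF I True] low by simp
    next
      case False
      then show ?thesis using V_link(1)[OF one high(3)] high by simp
    qed
    fix x y assume xy: "x \<in> I" "y \<in> I"
    show "E i x / w i x = E i y / w i y + (LBINT u=ereal y..ereal x. E (Suc i) u)"
    proof (cases "i < k")
      case True
      then show ?thesis using chain_D(3)[OF I True xy] low by simp
    next
      case False
      then show ?thesis using V_link(2)[OF one high(3) xy] high by simp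
    qed
  qed
  have Etop: "E j x = 1 * w j x" if "x \<in> I" for x
    using j' Vr_one_top[OF that] by (simp add: E_def)
  have F: "chain N F" for N
    unfolding F_def using E Etop by (rule chain_extend)
  have "F 0 = iter_re w z k 0 ?g"
    using k j' by (simp add: F_def E_def)
  moreover have "F 0 \<in> P_plus I w k n"
  proof (rule P_plus_of_chain[OF F])
    show "F (Suc n) x = 0" for x using j' by (simp add: F_def)
    fix i assume i: "k - 1 \<le> i" "i \<le> n"
    consider "i = k - 1" | "k \<le> i" "i \<le> j" | "j < i" using i j' by linarith
    then show "mono_on I (\<lambda>x. F i x / w i x)"
    proof cases
      case 1
      have Fi: "F i x / w i x = (LBINT u=ereal z..ereal x. ?g u)" if "x \<in> I" for x
      proof -
        have e: "k - i = Suc 0" "Suc i = k" using 1 k by auto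
        have "F i x = iter_re w z (Suc 0) i ?g x"
          using 1 k j' e by (simp add: F_def E_def)
        then show ?thesis using w_pos[OF that, of i] by simp
      qed
      show ?thesis
      proof (rule mono_onI)
        fix x y assume xy: "x \<in> I" "y \<in> I" "x \<le> y"
        have "0 \<le> (LBINT u=ereal x..ereal y. ?g u)"
          by (rule nn_integral_interval(2)[OF li Vr_nonneg xy])
        then show "F i x / w i x \<le> F i y / w i y"
          using interval_integral_split[OF li z xy(1,2)] Fi xy by simp
      qed
    next
      case 2
      then have "F i = Vr (j - i) i ?one" by (simp add: F_def E_def)
      then show ?thesis using Vr_mono_on[OF one(1) fin[OF 2]] by simp
    next
      case 3
      then show ?thesis by (simp add: F_def mono_onI)
    qed
  qed
  ultimately show ?thesis by simp
qed

end

section \<open>Comparison of signed remainders\<close>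

text \<open>The places where a remainder formed at \<open>z\<close> by \<open>k\<close> integrations
  of a nonnegative function is nonpositive; for even \<open>k\<close> there are none.\<close>

definition neg_side :: "real \<Rightarrow> nat \<Rightarrow> real set" where
  "neg_side z k = {x. x < z \<and> odd k}"

lemma side_power: "side z x ^ k = (if x \<in> neg_side z k then -1 else 1)"
  by (auto simp: side_def neg_side_def)

lemma neg_side_borel[measurable]: "neg_side z k \<in> sets borel"
  by (cases "odd k") (simp_all add: neg_side_def)

context gauge_system
begin

text \<open>With \<open>h\<close> the modulus of the increment from \<open>z\<close> of the
  derivative of order \<open>m\<close>, this is the modulus of the Taylor remainder at
  \<open>z\<close>; its sign is kept apart in \<open>neg_side\<close>.\<close>

definition T :: "real \<Rightarrow> nat \<Rightarrow> (real \<Rightarrow> ennreal) \<Rightarrow> real \<Rightarrow> ennreal" where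
  "T z m h = iter_nn (between_kernel z) W m 0 (\<lambda>x. W m x * h x)"

lemma T_measurable[measurable]: "h \<in> borel_measurable borel \<Longrightarrow> T z m h \<in> borel_measurable borel"
  unfolding T_def by measurable

lemma T_cong:
  assumes "\<And>x. x \<in> I \<Longrightarrow> g x = h x"
  shows "T z m g = T z m h"
proof -
  have "W m x * g x = W m x * h x" for x
    using assms[of x] W_not_I[of x m] by (cases "x \<in> I") auto
  then show ?thesis by (simp add: T_def)
qed

lemma iter_between_cong:
  assumes z: "z \<in> I" and eq: "\<And>x. x \<in> I \<Longrightarrow> g x = h x" and x: "x \<in> I"
  shows "iter_nn (between_kernel z) W d j g x = iter_nn (between_kernel z) W d j h x"
  using x
proof (induction d arbitrary: j x)
  case (Suc d)
  show ?case
    using nn_integral_between_cong[OF z Suc.prems Suc.IH] by simp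
qed (simp add: eq)

text \<open>Modulo polynomials, \<open>F 0\<close> is the iterated integral from \<open>z\<close> of the increment of \<open>\<phi>\<close>,
  whose sign is constant on either side of \<open>z\<close>.\<close>

lemma signed_remainder:
  assumes F: "chain m F" and top: "\<And>x. x \<in> I \<Longrightarrow> F m x = w m x * \<phi> x" and mono: "mono_on I \<phi>"
    and z: "z \<in> I" and s: "s \<in> I"
  obtains c H where "H \<in> borel_funs I"
    "\<And>x. x \<in> I \<Longrightarrow> F 0 x = (\<Sum>i\<le>m. c i * iter_re w s i 0 (w i) x) + H x"
    "\<And>x. x \<in> I \<Longrightarrow> ennreal (H x)
      = indicator (- neg_side z (Suc m)) x * T z m (\<lambda>x. ennreal \<bar>\<phi> x - \<phi> z\<bar>) x"
    "\<And>x. x \<in> I \<Longrightarrow> ennreal (- H x)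
      = indicator (neg_side z (Suc m)) x * T z m (\<lambda>x. ennreal \<bar>\<phi> x - \<phi> z\<bar>) x"
proof -
  define g where "g x = w m x * (\<phi> x - \<phi> z)" for x
  have "(\<lambda>x. F m x / w m x) \<in> borel_funs I"
    by (intro borel_funs_arith chain_D(1)[OF F] w_borel) simp
  moreover have "F m x / w m x = \<phi> x" if "x \<in> I" for x
    using top[OF that] w_pos[OF that, of m] by simp
  ultimately have "\<phi> \<in> borel_funs I"
    using borel_funs_cong[of "\<lambda>x. F m x / w m x" \<phi>] by blast
  then have b: "(\<lambda>x. \<phi> x - \<phi> z) \<in> borel_funs I"
    by (intro borel_funs_arith) (auto intro: borel_funs_borel)
  have m: "mono_on I (\<lambda>x. \<phi> x - \<phi> z)"
    using mono by (auto simp: mono_on_def)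
  have li: "locally_integrable g"
    unfolding g_def by (rule locally_integrable_w_mono[OF b m])
  have gb: "g \<in> borel_funs I"
    unfolding g_def by (rule borel_funs_arith(1)[OF w_borel b])
  \<comment> \<open>Monotonicity gives the increment the exponent 1, and the \<open>m\<close>
    integrations raise it to \<open>Suc m\<close>.\<close>
  have side: "g u = side z u ^ 1 * \<bar>g u\<bar>" if "u \<in> I" for u
    using mono_onD[OF mono z that] mono_onD[OF mono that z] w_pos[OF that, of m]
    by (auto simp: g_def side_def abs_mult)
  define H where "H = iter_re w z m 0 g"
  have H: "H x = side z x ^ Suc m * \<bar>H x\<bar>"
    "ennreal \<bar>H x\<bar> = T z m (\<lambda>x. ennreal \<bar>\<phi> x - \<phi> z\<bar>) x" if x: "x \<in> I" for x
  proof -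
    note S = iter_re_side[OF li z side x, where d = m and j = 0]
    show "H x = side z x ^ Suc m * \<bar>H x\<bar>"
      using S[THEN conjunct1] by (simp only: H_def Suc_eq_plus1)
    have "ennreal \<bar>g u\<bar> = W m u * ennreal \<bar>\<phi> u - \<phi> z\<bar>" if "u \<in> I" for u
      using w_pos[OF that, of m] by (simp add: g_def abs_mult ennreal_mult W_I that)
    from iter_between_cong[OF z this x, where d = m and j = 0]
    show "ennreal \<bar>H x\<bar> = T z m (\<lambda>x. ennreal \<bar>\<phi> x - \<phi> z\<bar>) x"
      using S[THEN conjunct2] unfolding H_def T_def by (rule trans[rotated])
  qed
  have G: "chain m (\<lambda>j. iter_re w z (m - j) j g)"
    by (intro chain_iter_re li z gb)
  \<comment> \<open>Subtracting the remainder leaves a chain whose top quotient is the constant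
    \<open>\<phi> z\<close>, hence a polynomial. It is expanded at \<open>s\<close>, where (i')
    supplies the integrals, although the remainder is formed at \<open>z\<close>.\<close>
  have "\<exists>c. \<forall>x\<in>I. F 0 x - iter_re w z (m - 0) 0 g x = (\<Sum>i\<le>m. c i * iter_re w s i 0 (w i) x)"
  proof (rule chain_polynomial[OF chain_diff[OF F G] _ s])
    show "F m x - iter_re w z (m - m) m g x = \<phi> z * w m x" if "x \<in> I" for x
      using top[OF that] by (simp add: g_def algebra_simps)
  qed
  then obtain c where c: "\<And>x. x \<in> I \<Longrightarrow> F 0 x - H x = (\<Sum>i\<le>m. c i * iter_re w s i 0 (w i) x)"
    unfolding H_def by auto
  show thesis
  proof (rule that[of H c])
    show "H \<in> borel_funs I"
      unfolding H_def by (rule iter_re_borel[OF li z gb])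
    fix x assume x: "x \<in> I"
    show "F 0 x = (\<Sum>i\<le>m. c i * iter_re w s i 0 (w i) x) + H x"
      using c[OF x] by simp
    show "ennreal (H x) = indicator (- neg_side z (Suc m)) x * T z m (\<lambda>x. ennreal \<bar>\<phi> x - \<phi> z\<bar>) x"
      "ennreal (- H x) = indicator (neg_side z (Suc m)) x * T z m (\<lambda>x. ennreal \<bar>\<phi> x - \<phi> z\<bar>) x"
      unfolding H(2)[OF x, symmetric]
    proof -
      have "H x = (if x \<in> neg_side z (Suc m) then - \<bar>H x\<bar> else \<bar>H x\<bar>)"
        using H(1)[OF x] unfolding side_power by (simp split: if_splits)
      then consider "x \<in> neg_side z (Suc m)" "H x \<le> 0" | "x \<notin> neg_side z (Suc m)" "0 \<le> H x"
        by (metis abs_ge_zero neg_le_0_iff_le)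
      then show "ennreal (H x) = indicator (- neg_side z (Suc m)) x * ennreal \<bar>H x\<bar>"
        "ennreal (- H x) = indicator (neg_side z (Suc m)) x * ennreal \<bar>H x\<bar>"
        by (cases; simp add: ennreal_neg)+
    qed
  qed
qed

end

text \<open>Of the three conditions only (i') is assumed here, with \<open>m = k - 1\<close>; (ii')
  and (iii) enter later as premises of individual lemmas.\<close>

locale dual_problem = gauge_system +
  fixes \<nu>1 \<nu>2 :: "real measure" and s z :: real and m :: nat
  assumes \<nu>1: "\<nu>1 \<in> N_plus I" and \<nu>2: "\<nu>2 \<in> N_plus I" and s: "s \<in> I" and z: "z \<in> I"
    and poly: "\<And>i. i \<le> m \<Longrightarrow> integrable \<nu>1 (iter_re w s i 0 (w i))"
      "\<And>i. i \<le> m \<Longrightarrow> integrable \<nu>2 (iter_re w s i 0 (w i))"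
      "\<And>i. i \<le> m \<Longrightarrow> (\<integral>x. iter_re w s i 0 (w i) x \<partial>\<nu>1) = (\<integral>x. iter_re w s i 0 (w i) x \<partial>\<nu>2)"
begin

abbreviation "Neg \<equiv> neg_side z (Suc m)"

definition half :: "real measure \<Rightarrow> real set \<Rightarrow> (real \<Rightarrow> ennreal) \<Rightarrow> ennreal" where
  "half \<nu> A h = (\<integral>\<^sup>+x. indicator A x * T z m h x \<partial>\<nu>)"

text \<open>The inequality \<open>\<nu>\<^sub>1(F) \<ge> \<nu>\<^sub>2(F)\<close> for the signed remainder \<open>F\<close> with increment \<open>h\<close>, rearranged
  so that no subtraction occurs.\<close>

definition dominates :: "(real \<Rightarrow> ennreal) \<Rightarrow> bool" where
  "dominates h \<longleftrightarrow> (half \<nu>1 Neg h < \<infinity> \<longrightarrow> half \<nu>2 Neg h < \<infinity> \<longrightarrow>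
     half \<nu>2 (- Neg) h + half \<nu>1 Neg h \<le> half \<nu>1 (- Neg) h + half \<nu>2 Neg h)"

lemma half_cong: "(\<And>x. x \<in> I \<Longrightarrow> g x = h x) \<Longrightarrow> half \<nu> A g = half \<nu> A h"
  using T_cong[of g h z m] by (simp add: half_def)

lemma dominates_cong: "(\<And>x. x \<in> I \<Longrightarrow> g x = h x) \<Longrightarrow> dominates g \<longleftrightarrow> dominates h"
  using half_cong[of g h] by (simp add: dominates_def)

text \<open>\<open>F 0\<close> and its remainder differ by a polynomial whose integrals agree, and
  the two halves of the remainder are its positive and negative parts.\<close>

lemma chain_comparison:
  fixes \<phi> :: "real \<Rightarrow> real"
  assumes F: "chain m F" and top: "\<And>x. x \<in> I \<Longrightarrow> F m x = w m x * \<phi> x" and mono: "mono_on I \<phi>"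
  defines "h \<equiv> \<lambda>x. ennreal \<bar>\<phi> x - \<phi> z\<bar>"
  shows "half \<nu>1 Neg h < \<infinity> \<longleftrightarrow> (\<integral>\<^sup>+x. ennreal (- F 0 x) \<partial>\<nu>1) < \<infinity>"
    "half \<nu>2 Neg h < \<infinity> \<longleftrightarrow> (\<integral>\<^sup>+x. ennreal (- F 0 x) \<partial>\<nu>2) < \<infinity>"
    "\<lbrakk>half \<nu>1 Neg h < \<infinity>; half \<nu>2 Neg h < \<infinity>\<rbrakk> \<Longrightarrow>
      integral_ge \<nu>1 \<nu>2 (\<lambda>x. ereal (F 0 x)) \<longleftrightarrow> dominates h"
proof -
  obtain H c where H: "H \<in> borel_funs I"
    "\<And>x. x \<in> I \<Longrightarrow> F 0 x = (\<Sum>i\<le>m. c i * iter_re w s i 0 (w i) x) + H x"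
    "\<And>x. x \<in> I \<Longrightarrow> ennreal (H x) = indicator (- Neg) x * T z m h x"
    "\<And>x. x \<in> I \<Longrightarrow> ennreal (- H x) = indicator Neg x * T z m h x"
    by (rule signed_remainder[OF F top mono z s, folded h_def]) (assumption, rule that)
  let ?p = "\<lambda>x. \<Sum>i\<le>m. c i * iter_re w s i 0 (w i) x"
  have sp: "space \<nu>1 = I" "space \<nu>2 = I"
    using N_plusD(1) \<nu>1 \<nu>2 by auto
  have p: "integrable \<nu>1 ?p" "integrable \<nu>2 ?p"
    using poly by auto
  have p3: "(\<integral>x. ?p x \<partial>\<nu>1) = (\<integral>x. ?p x \<partial>\<nu>2)"
    using poly by (subst (1 2) Bochner_Integration.integral_sum) auto
  have Hm: "H \<in> borel_measurable \<nu>1" "H \<in> borel_measurable \<nu>2"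
    using H(1) N_plusD(2) \<nu>1 \<nu>2 by auto
  have half: "(\<integral>\<^sup>+x. ennreal (H x) \<partial>\<nu>) = half \<nu> (- Neg) h" "(\<integral>\<^sup>+x. ennreal (- H x) \<partial>\<nu>) = half \<nu> Neg h"
    if "space \<nu> = I" for \<nu>
    unfolding half_def by (intro nn_integral_cong; use H that in simp)+
  have eq: "F 0 x = ?p x + H x" if "x \<in> space \<nu>1" for x
    using H(2) that sp by simp
  have eq': "F 0 x = ?p x + H x" if "x \<in> space \<nu>2" for x
    using H(2) that sp by simp
  note G = integral_ge_perturb[OF p p3 Hm eq sp(2)[folded sp(1)], unfolded half[OF sp(1)] half[OF sp(2)]]
  note G' = integral_ge_perturb(1)[OF p(2,1) p3[symmetric] Hm(2,1) eq' sp(1)[folded sp(2)], unfolded half[OF sp(2)]]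
  show 1: "half \<nu>1 Neg h < \<infinity> \<longleftrightarrow> (\<integral>\<^sup>+x. ennreal (- F 0 x) \<partial>\<nu>1) < \<infinity>"
    by (rule G(1))
  show 2: "half \<nu>2 Neg h < \<infinity> \<longleftrightarrow> (\<integral>\<^sup>+x. ennreal (- F 0 x) \<partial>\<nu>2) < \<infinity>"
    by (rule G')
  assume fin: "half \<nu>1 Neg h < \<infinity>" "half \<nu>2 Neg h < \<infinity>"
  show "integral_ge \<nu>1 \<nu>2 (\<lambda>x. ereal (F 0 x)) \<longleftrightarrow> dominates h"
    unfolding dominates_def using G(2)[OF _ fin] fin by blast
qed

text \<open>The finiteness that \<open>chain_comparison\<close> asks for is already a premise inside
  \<open>dominates\<close>, so an inequality between the two integrals suffices.\<close>

lemma dominatesI: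
  assumes "chain m F" "\<And>x. x \<in> I \<Longrightarrow> F m x = w m x * \<phi> x" "mono_on I \<phi>"
    and "integral_ge \<nu>1 \<nu>2 (\<lambda>x. ereal (F 0 x))"
    and "\<And>x. x \<in> I \<Longrightarrow> h x = ennreal \<bar>\<phi> x - \<phi> z\<bar>"
  shows "dominates h"
proof -
  let ?h = "\<lambda>x. ennreal \<bar>\<phi> x - \<phi> z\<bar>"
  have "dominates ?h"
    using chain_comparison(3)[OF assms(1-3)] assms(4) unfolding dominates_def by blast
  then show ?thesis
    using dominates_cong[of h ?h] assms(5) by blast
qed

text \<open>By Markov's inequality the sets where \<open>w 0\<close> is at least 1/n have finite
  measure, and they exhaust \<open>I\<close> because \<open>w 0\<close> is positive. In
  \<open>poly\<close>, \<open>w 0\<close> is the polynomial of index 0.\<close>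

lemma sigma_finite: "sigma_finite_measure \<nu>1" "sigma_finite_measure \<nu>2"
proof -
  have *: "sigma_finite_measure \<nu>" if \<nu>: "\<nu> \<in> N_plus I" "integrable \<nu> (w 0)" for \<nu>
  proof
    let ?A = "\<lambda>n::nat. {x \<in> space \<nu>. 1 \<le> of_nat n * ennreal (w 0 x)}"
    have [measurable]: "w 0 \<in> borel_measurable \<nu>" using \<nu>(2) by auto
    have sp: "space \<nu> = I" by (rule N_plusD(1)[OF \<nu>(1)])
    have "(\<integral>\<^sup>+x. ennreal (w 0 x) \<partial>\<nu>) < \<infinity>"
      using \<nu>(2) by (auto simp: real_integrable_def less_top[symmetric])
    then have "emeasure \<nu> (?A n) \<noteq> \<infinity>" for n
      using nn_integral_Markov_inequality[of "\<lambda>x. ennreal (w 0 x)" "space \<nu>" \<nu> "of_nat n"]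
      by (auto simp: top_unique ennreal_mult_eq_top_iff cong: nn_integral_cong)
    moreover have "space \<nu> \<subseteq> (\<Union>n. ?A n)"
    proof
      fix x assume x: "x \<in> space \<nu>"
      obtain n where "1 < of_nat n * w 0 x"
        using reals_Archimedean3[of "w 0 x"] w_pos[of x 0] x sp by blast
      then have "ennreal 1 \<le> ennreal (of_nat n * w 0 x)"
        by (intro ennreal_leI) simp
      also have "\<dots> = of_nat n * ennreal (w 0 x)"
        using w_pos[of x 0] x sp by (simp add: ennreal_mult ennreal_of_nat_eq_real_of_nat)
      finally have "x \<in> ?A n" using x by simp
      then show "x \<in> (\<Union>n. ?A n)" by blast
    qed
    ultimately show "\<exists>A. countable A \<and> A \<subseteq> sets \<nu> \<and> \<Union> A = space \<nu> \<and> (\<forall>a\<in>A. emeasure \<nu> a \<noteq> \<infinity>)"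
      by (intro exI[of _ "range ?A"]) auto
  qed
  show "sigma_finite_measure \<nu>1" "sigma_finite_measure \<nu>2"
    using *[OF \<nu>1] *[OF \<nu>2] poly(1,2)[of 0] by simp_all
qed

lemma half_measurable:
  assumes "\<nu> \<in> N_plus I" "h \<in> borel_measurable borel" "A \<in> sets borel"
  shows "(\<lambda>x. indicator A x * T z m h x) \<in> borel_measurable \<nu>"
proof -
  note [measurable] = assms(2,3)
  show ?thesis by (intro N_plusD(3)[OF assms(1)]) measurable
qed

lemma half_add:
  assumes "\<nu> \<in> N_plus I" "A \<in> sets borel" "g \<in> borel_measurable borel" "h \<in> borel_measurable borel"
  shows "half \<nu> A (\<lambda>x. g x + h x) = half \<nu> A g + half \<nu> A h"
proof -
  note [measurable] = assms(3,4)
  have "T z m (\<lambda>x. g x + h x) = (\<lambda>x. T z m g x + T z m h x)"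
    unfolding T_def distrib_left by (intro between.iter_nn_add) measurable
  then show ?thesis
    using half_measurable assms by (simp add: half_def distrib_left nn_integral_add)
qed

lemma half_cmult:
  assumes "\<nu> \<in> N_plus I" "A \<in> sets borel" "h \<in> borel_measurable borel"
  shows "half \<nu> A (\<lambda>x. c * h x) = c * half \<nu> A h"
proof -
  note [measurable] = assms(3)
  have "T z m (\<lambda>x. c * h x) = (\<lambda>x. c * T z m h x)"
    unfolding T_def using between.iter_nn_cmult[of "\<lambda>x. W m x * h x" z m 0 c] assms(3)
    by (simp add: ac_simps)
  then show ?thesis
    using nn_integral_cmult[OF half_measurable[OF assms(1,3,2)], of c] by (simp add: half_def ac_simps)
qed

lemma T_zero: "T z m (\<lambda>x. 0) = (\<lambda>x. 0)"
  by (simp add: T_def between.iter_nn_zero)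

lemma half_sum:
  assumes "\<nu> \<in> N_plus I" "A \<in> sets borel" "finite J" "\<And>j. g j \<in> borel_measurable borel"
  shows "half \<nu> A (\<lambda>x. \<Sum>j\<in>J. g j x) = (\<Sum>j\<in>J. half \<nu> A (g j))"
  using assms(3)
proof induction
  case empty
  then show ?case by (simp add: half_def T_zero)
next
  case (insert j J)
  then show ?case using assms(4) half_add[OF assms(1,2)] by simp
qed

lemma half_nn_integral:
  assumes \<nu>: "\<nu> \<in> N_plus I" "sigma_finite_measure \<nu>" and A[measurable]: "A \<in> sets borel"
    and h: "(\<lambda>(l, x). h l x) \<in> borel_measurable (lborel \<Otimes>\<^sub>M borel)"
  shows "half \<nu> A (\<lambda>x. \<integral>\<^sup>+l. h l x \<partial>lborel) = (\<integral>\<^sup>+l. half \<nu> A (h l) \<partial>lborel)"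
    "(\<lambda>l. half \<nu> A (h l)) \<in> borel_measurable lborel"
proof -
  interpret \<nu>: sigma_finite_measure \<nu> by fact
  interpret P: pair_sigma_finite lborel \<nu> ..
  have hm: "(\<lambda>l. h l x) \<in> borel_measurable lborel" for x
    using measurable_compose[OF _ h, of "\<lambda>l. (l, x)" lborel] by simp
  have Wh: "(\<lambda>(l, x). W m x * h l x) \<in> borel_measurable (lborel \<Otimes>\<^sub>M borel)"
  proof -
    have "(\<lambda>p. W m (snd p)) \<in> borel_measurable (lborel \<Otimes>\<^sub>M borel)" by measurable
    from borel_measurable_times_ennreal[OF this h] show ?thesis by (simp add: case_prod_beta')
  qed
  have "T z m (\<lambda>x. \<integral>\<^sup>+l. h l x \<partial>lborel) = (\<lambda>x. \<integral>\<^sup>+l. T z m (h l) x \<partial>lborel)"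
    unfolding T_def
    using between.iter_nn_nn_integral[OF lborel.sigma_finite_measure_axioms Wh, of z m 0]
    by (simp add: nn_integral_cmult[OF hm])
  moreover
  have "(\<lambda>(l, x). T z m (h l) x) \<in> borel_measurable (lborel \<Otimes>\<^sub>M borel)"
    unfolding T_def by (rule between.measurable_iter_param[OF Wh])
  moreover have "(\<lambda>p. indicator A (snd p) :: ennreal) \<in> borel_measurable (lborel \<Otimes>\<^sub>M borel)"
    by measurable
  ultimately have TT: "T z m (\<lambda>x. \<integral>\<^sup>+l. h l x \<partial>lborel) = (\<lambda>x. \<integral>\<^sup>+l. T z m (h l) x \<partial>lborel)"
    and Tm: "(\<lambda>(l, x). indicator A x * T z m (h l) x) \<in> borel_measurable (lborel \<Otimes>\<^sub>M borel)"
    using borel_measurable_times_ennreal[of "\<lambda>p. indicator A (snd p)" "lborel \<Otimes>\<^sub>M borel"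
        "\<lambda>(l, x). T z m (h l) x"]
    by (simp_all add: case_prod_beta')
  have "(\<lambda>p. (fst p, snd p)) \<in> lborel \<Otimes>\<^sub>M \<nu> \<rightarrow>\<^sub>M lborel \<Otimes>\<^sub>M borel"
  proof (rule measurable_Pair)
    show "snd \<in> lborel \<Otimes>\<^sub>M \<nu> \<rightarrow>\<^sub>M borel"
      using measurable_compose[OF measurable_snd N_plusD(3)[OF \<nu>(1), of "\<lambda>x. x"]] by simp
  qed simp
  from measurable_compose[OF this Tm]
  have Tm': "(\<lambda>(l, x). indicator A x * T z m (h l) x) \<in> borel_measurable (lborel \<Otimes>\<^sub>M \<nu>)"
    by (simp add: case_prod_beta')
  have Tl: "(\<lambda>l. T z m (h l) x) \<in> borel_measurable lborel" for x
    using measurable_compose[OF _ between.measurable_iter_param[OF Wh, where d = m and j = 0 and z = z],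
        of "\<lambda>l. (l, x)" lborel]
    by (simp add: T_def)
  show "half \<nu> A (\<lambda>x. \<integral>\<^sup>+l. h l x \<partial>lborel) = (\<integral>\<^sup>+l. half \<nu> A (h l) \<partial>lborel)"
    unfolding half_def TT using P.Fubini'[OF Tm']
    by (simp add: nn_integral_cmult[OF Tl])
  show "(\<lambda>l. half \<nu> A (h l)) \<in> borel_measurable lborel"
    unfolding half_def by (rule \<nu>.borel_measurable_nn_integral[OF Tm'])
qed

lemma dominates_zero: "dominates (\<lambda>x. 0)"
  by (simp add: dominates_def half_def T_zero)

text \<open>Each half of the target is the same mixture of the halves of the components. A finite
  negative half is therefore inherited by every summand with nonzero coefficient and by almost every
  layer, after which the inequalities are summed and integrated. Zero coefficients are exempt
  because such a component may be infinite and obey no inequality, while 0 times infinity is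
  0.\<close>

lemma dominates_mixture:
  fixes c :: "nat \<Rightarrow> ennreal"
  assumes J: "finite J" and g[measurable]: "\<And>j. g j \<in> borel_measurable borel"
    and h: "(\<lambda>(l, x). h l x) \<in> borel_measurable (lborel \<Otimes>\<^sub>M borel)"
    and f: "\<And>x. x \<in> I \<Longrightarrow> f x = (\<Sum>j\<in>J. c j * g j x) + (\<integral>\<^sup>+l. h l x \<partial>lborel)"
    and dg: "\<And>j. j \<in> J \<Longrightarrow> c j \<noteq> 0 \<Longrightarrow> dominates (g j)" and dh: "\<And>l. dominates (h l)"
  shows "dominates f"
proof -
  have hm[measurable]: "(\<lambda>x. \<integral>\<^sup>+l. h l x \<partial>lborel) \<in> borel_measurable borel"
  proof (rule lborel.borel_measurable_nn_integral)
    have "(\<lambda>p. (snd p, fst p)) \<in> borel \<Otimes>\<^sub>M lborel \<rightarrow>\<^sub>M lborel \<Otimes>\<^sub>M borel" by measurable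
    from measurable_compose[OF this h]
    show "(\<lambda>(x, l). h l x) \<in> borel_measurable (borel \<Otimes>\<^sub>M lborel)"
      by (simp add: case_prod_beta')
  qed
  have half_f: "half \<nu> A f = (\<Sum>j\<in>J. c j * half \<nu> A (g j)) + (\<integral>\<^sup>+l. half \<nu> A (h l) \<partial>lborel)"
    if "\<nu> \<in> N_plus I" "sigma_finite_measure \<nu>" "A \<in> sets borel" for \<nu> A
  proof -
    have "half \<nu> A f = half \<nu> A (\<lambda>x. (\<Sum>j\<in>J. c j * g j x) + (\<integral>\<^sup>+l. h l x \<partial>lborel))"
      by (rule half_cong[OF f])
    also have "\<dots> = half \<nu> A (\<lambda>x. \<Sum>j\<in>J. c j * g j x) + half \<nu> A (\<lambda>x. \<integral>\<^sup>+l. h l x \<partial>lborel)"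
      by (rule half_add[OF that(1,3)]) measurable
    also have "half \<nu> A (\<lambda>x. \<Sum>j\<in>J. c j * g j x) = (\<Sum>j\<in>J. half \<nu> A (\<lambda>x. c j * g j x))"
      by (rule half_sum[OF that(1,3) J]) measurable
    also have "\<dots> = (\<Sum>j\<in>J. c j * half \<nu> A (g j))"
      by (simp add: half_cmult[OF that(1,3)])
    finally show ?thesis
      by (simp add: half_nn_integral(1)[OF that h])
  qed
  note f1 = half_f[OF \<nu>1 sigma_finite(1)] and f2 = half_f[OF \<nu>2 sigma_finite(2)]
  have N: "Neg \<in> sets borel" "- Neg \<in> sets borel" by auto
  note m1 = half_nn_integral(2)[OF \<nu>1 sigma_finite(1) _ h] and m2 = half_nn_integral(2)[OF \<nu>2 sigma_finite(2) _ h]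
  show ?thesis
    unfolding dominates_def
  proof (intro impI)
    assume fin: "half \<nu>1 Neg f < \<infinity>" "half \<nu>2 Neg f < \<infinity>"
    have sums: "(\<Sum>j\<in>J. c j * half \<nu>2 (- Neg) (g j)) + (\<Sum>j\<in>J. c j * half \<nu>1 Neg (g j))
        \<le> (\<Sum>j\<in>J. c j * half \<nu>1 (- Neg) (g j)) + (\<Sum>j\<in>J. c j * half \<nu>2 Neg (g j))"
      unfolding sum.distrib[symmetric] distrib_left[symmetric]
    proof (rule sum_mono)
      fix j assume j: "j \<in> J"
      show "c j * (half \<nu>2 (- Neg) (g j) + half \<nu>1 Neg (g j)) \<le> c j * (half \<nu>1 (- Neg) (g j) + half \<nu>2 Neg (g j))"
      proof (cases "c j = 0")
        case False
        have le: "c j * half \<nu> Neg (g j) < \<infinity>" if "(\<Sum>j\<in>J. c j * half \<nu> Neg (g j)) < \<infinity>" for \<nu>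
          using member_le_sum[OF j _ J, of "\<lambda>j. c j * half \<nu> Neg (g j)"] that by (auto intro: le_less_trans)
        have "half \<nu>1 Neg (g j) < \<infinity>" "half \<nu>2 Neg (g j) < \<infinity>"
          using fin False le[of \<nu>1] le[of \<nu>2] unfolding f1[OF N(1)] f2[OF N(1)] by (auto simp: ennreal_mult_less_top)
        then show ?thesis
          using dg[OF j False] by (intro mult_left_mono) (auto simp: dominates_def)
      qed simp
    qed
    have "AE l in lborel. half \<nu>1 Neg (h l) \<noteq> \<infinity>"
      by (rule nn_integral_PInf_AE[OF m1[OF N(1)]]) (use fin in \<open>auto simp: f1[OF N(1)]\<close>)
    moreover have "AE l in lborel. half \<nu>2 Neg (h l) \<noteq> \<infinity>"
      by (rule nn_integral_PInf_AE[OF m2[OF N(1)]]) (use fin in \<open>auto simp: f2[OF N(1)]\<close>)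
    ultimately have "AE l in lborel. half \<nu>2 (- Neg) (h l) + half \<nu>1 Neg (h l)
        \<le> half \<nu>1 (- Neg) (h l) + half \<nu>2 Neg (h l)"
      by eventually_elim (use dh in \<open>auto simp: dominates_def less_top\<close>)
    then have "(\<integral>\<^sup>+l. half \<nu>2 (- Neg) (h l) + half \<nu>1 Neg (h l) \<partial>lborel)
        \<le> (\<integral>\<^sup>+l. half \<nu>1 (- Neg) (h l) + half \<nu>2 Neg (h l) \<partial>lborel)"
      by (rule nn_integral_mono_AE)
    then have "(\<integral>\<^sup>+l. half \<nu>2 (- Neg) (h l) \<partial>lborel) + (\<integral>\<^sup>+l. half \<nu>1 Neg (h l) \<partial>lborel)
        \<le> (\<integral>\<^sup>+l. half \<nu>1 (- Neg) (h l) \<partial>lborel) + (\<integral>\<^sup>+l. half \<nu>2 Neg (h l) \<partial>lborel)"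
      unfolding nn_integral_add[OF m2[OF N(2)] m1[OF N(1)]] nn_integral_add[OF m1[OF N(2)] m2[OF N(1)]] .
    from add_mono[OF sums this]
    show "half \<nu>2 (- Neg) f + half \<nu>1 Neg f \<le> half \<nu>1 (- Neg) f + half \<nu>2 Neg f"
      unfolding f1[OF N(1)] f2[OF N(1)] f1[OF N(2)] f2[OF N(2)] by (simp add: ac_simps)
  qed
qed

end

section \<open>Decomposition of generalised multiply monotone functions\<close>

lemma integral_ge_nonneg:
  assumes "\<And>x. x \<in> space \<nu>1 \<Longrightarrow> 0 \<le> f x" "\<And>x. x \<in> space \<nu>2 \<Longrightarrow> 0 \<le> f x"
  shows "integral_ge \<nu>1 \<nu>2 f \<longleftrightarrow> (\<integral>\<^sup>+x. e2ennreal (f x) \<partial>\<nu>2) \<le> (\<integral>\<^sup>+x. e2ennreal (f x) \<partial>\<nu>1)"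
  using ext_integral_nonneg[of \<nu>1 f] ext_integral_nonneg[of \<nu>2 f] assms
  by (simp add: integral_ge_def less_eq_ennreal.rep_eq)

context gauge_system
begin

text \<open>\<open>t\<close> is the infimum of \<open>U\<close>; it lies in \<open>I\<close> because
  a point of \<open>I\<close> outside \<open>U\<close> bounds \<open>U\<close> from below. Open
  half-lines do occur, for instance at order 0, where a derivative need not be one-sidedly
  continuous.\<close>

lemma upper_subset_of_I:
  assumes "U \<subseteq> I" and up: "\<And>x y. \<lbrakk>x \<in> U; y \<in> I; x \<le> y\<rbrakk> \<Longrightarrow> y \<in> U"
  shows "U = {} \<or> U = I \<or> (\<exists>t\<in>I. U = I \<inter> {t..} \<or> U = I \<inter> {t<..})"
proof (cases "U = {} \<or> U = I")
  case False
  then obtain u y where u: "u \<in> U" and y: "y \<in> I" "y \<notin> U"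
    using assms(1) by blast
  have lb: "y \<le> x" if "x \<in> U" for x
    using up[OF that y(1)] y(2) by linarith
  then have bdd: "bdd_below U" by (rule bdd_belowI)
  define t where "t = Inf U"
  have tl: "t \<le> x" if "x \<in> U" for x
    unfolding t_def using that bdd by (rule cInf_lower)
  have "y \<le> t" unfolding t_def using u lb by (intro cInf_greatest) auto
  then have t: "t \<in> I"
    using mem_I[OF y(1), of u t] u tl[OF u] assms(1) by blast
  have gt: "x \<in> U" if x: "x \<in> I" "t < x" for x
  proof -
    obtain v where "v \<in> U" "v < x"
      using cInf_lessD[of U x] u x(2) unfolding t_def by blast
    then show ?thesis using up[of v x] x(1) by simp
  qed
  have "U = I \<inter> {t..} \<or> U = I \<inter> {t<..}"
  proof (cases "t \<in> U")
    case True
    have "U = I \<inter> {t..}"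
      using up[OF True] tl assms(1) by (intro equalityI subsetI) auto
    then show ?thesis ..
  next
    case False
    have "t < x" if "x \<in> U" for x
      using tl[OF that] that False by (cases "t = x") auto
    then have "U = I \<inter> {t<..}"
      using gt assms(1) by (intro equalityI subsetI) auto
    then show ?thesis ..
  qed
  with t show ?thesis by blast
qed blast

lemma V_cong:
  assumes "\<And>x. x \<in> I \<Longrightarrow> g x = h x"
  shows "V d i g = V d i h"
proof -
  have "W (i + d) x * g x = W (i + d) x * h x" for x
    using assms[of x] W_not_I[of x "i + d"] by (cases "x \<in> I") auto
  then show ?thesis by (simp add: V_def)
qed

lemma V_zero: "V d i (\<lambda>x. 0) = (\<lambda>x. 0)"
  by (simp add: V_def below.iter_nn_zero)

lemma V_cmult: "h \<in> borel_measurable borel \<Longrightarrow> V d i (\<lambda>x. c * h x) x = c * V d i h x"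
proof -
  assume [measurable]: "h \<in> borel_measurable borel"
  show ?thesis
    using below.iter_nn_cmult[of "\<lambda>x. W (i + d) x * h x" d i c] by (simp add: V_def ac_simps)
qed

text \<open>The open half-line is the increasing union of closed ones whose end points in
  \<open>I\<close> decrease to \<open>t\<close>, so monotone convergence carries (iii) over. If no
  point of \<open>I\<close> exceeds \<open>t\<close>, the half-line misses \<open>I\<close>
  altogether.\<close>

lemma V_open_upper_set:
  assumes t: "t \<in> I" and \<nu>: "\<nu>1 \<in> N_plus I" "\<nu>2 \<in> N_plus I"
    and le: "\<And>t. t \<in> I \<Longrightarrow> (\<integral>\<^sup>+x. V n 0 (indicator {t..}) x \<partial>\<nu>2) \<le> (\<integral>\<^sup>+x. V n 0 (indicator {t..}) x \<partial>\<nu>1)"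
  shows "(\<integral>\<^sup>+x. V n 0 (indicator {t<..}) x \<partial>\<nu>2) \<le> (\<integral>\<^sup>+x. V n 0 (indicator {t<..}) x \<partial>\<nu>1)"
proof (cases "\<exists>b\<in>I. t < b")
  case False
  then have "V n 0 (indicator {t<..}) = V n 0 (\<lambda>x. 0)"
    by (intro V_cong) (auto split: split_indicator)
  then show ?thesis by (simp add: V_zero)
next
  case True
  then obtain b where b: "b \<in> I" "t < b" by blast
  define a where "a i = t + (b - t) / real (Suc i)" for i
  have a: "t < a i" "a i \<le> b" for i
    using b(2) mult_right_mono[of t b "real i"] by (auto simp: a_def field_simps)
  have aI: "a i \<in> I" for i
    using mem_I[OF t b(1), of "a i"] a[of i] by simp
  have dec: "a j \<le> a i" if "i \<le> j" for i j
    using b(2) that by (auto simp: a_def intro!: divide_left_mono)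
  have ex: "\<exists>i. a i \<le> x" if "t < x" for x
  proof -
    have "(\<lambda>i. (b - t) / real i) \<longlonglongrightarrow> 0"
      by (rule lim_const_over_n)
    then have "(\<lambda>i. (b - t) / real (Suc i)) \<longlonglongrightarrow> 0"
      by (rule LIMSEQ_Suc)
    then have "(\<lambda>i. t + (b - t) / real (Suc i)) \<longlonglongrightarrow> t + 0"
      by (rule tendsto_add[OF tendsto_const])
    then have "a \<longlonglongrightarrow> t + 0"
      by (simp only: a_def[abs_def])
    then have "eventually (\<lambda>i. a i < x) sequentially"
      using that by (intro order_tendstoD) auto
    then obtain N where "\<And>i. i \<ge> N \<Longrightarrow> a i < x" by (auto simp: eventually_sequentially)
    then have "a N < x" by simp
    then show ?thesis by (auto intro: less_imp_le)
  qed
  have ind: "indicator {a i..} x \<le> (indicator {a j..} x :: ennreal)" if "i \<le> j" for i j x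
    using dec[OF that] by (auto split: split_indicator)
  define q where "q i x = W n x * indicator {a i..} x" for i x
  have qm[measurable]: "q i \<in> borel_measurable borel" for i
    unfolding q_def by measurable
  have inc: "incseq q"
    unfolding incseq_def le_fun_def q_def by (intro allI impI mult_left_mono ind) auto
  have SUP: "(SUP i. indicator {a i..} x) = (indicator {t<..} x :: ennreal)" for x
  proof (cases "t < x")
    case True
    then obtain i where "a i \<le> x" using ex by blast
    then have "(1::ennreal) \<le> (SUP i. indicator {a i..} x)"
      by (intro SUP_upper2[of i]) auto
    moreover have "(SUP i. indicator {a i..} x) \<le> (1::ennreal)"
      by (intro SUP_least) (auto split: split_indicator)
    ultimately have "(SUP i. indicator {a i..} x) = (1::ennreal)"
      by (intro antisym)
    then show ?thesis using True by simp
  next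
    case False
    then have "x < a i" for i using a(1)[of i] by simp
    then have "indicator {a i..} x = (0::ennreal)" for i
      by (simp add: not_le)
    then have "(SUP i. indicator {a i..} x) = (SUP i::nat. 0::ennreal)"
      by simp
    then show ?thesis using False by simp
  qed
  have "V n 0 (indicator {t<..}) = iter_nn below_kernel W n 0 (\<lambda>x. SUP i. q i x)"
    unfolding V_def q_def SUP_mult_left_ennreal[symmetric] SUP by simp
  also have "\<dots> = (\<lambda>x. SUP i. iter_nn below_kernel W n 0 (q i) x)"
    by (rule below.iter_nn_SUP[OF inc qm])
  also have "\<dots> = (\<lambda>x. SUP i. V n 0 (indicator {a i..}) x)"
    by (simp add: V_def q_def[abs_def])
  finally have V: "V n 0 (indicator {t<..}) = (\<lambda>x. SUP i. V n 0 (indicator {a i..}) x)" .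
  have "incseq (\<lambda>i. V n 0 (indicator {a i..}))"
    unfolding incseq_def le_fun_def by (intro allI impI V_mono ind)
  then have "(\<integral>\<^sup>+x. V n 0 (indicator {t<..}) x \<partial>\<nu>) = (SUP i. \<integral>\<^sup>+x. V n 0 (indicator {a i..}) x \<partial>\<nu>)"
    if "\<nu> \<in> N_plus I" for \<nu>
    unfolding V by (rule nn_integral_monotone_convergence_SUP) (rule N_plusD(3)[OF that], measurable)
  note int = this
  show ?thesis
    unfolding int[OF \<nu>(1)] int[OF \<nu>(2)] by (rule SUP_mono') (rule le[OF aI])
qed

text \<open>The sequence stands in for a limit at the left end and treats attained, unattained and
  infinite left ends alike.\<close>

lemma cofinal_decreasing_sequence:
  assumes x: "x \<in> I"
  obtains y :: "nat \<Rightarrow> real" where "decseq y" "\<And>i. y i \<in> I" "\<And>i. y i \<le> x" "\<And>v. v \<in> I \<Longrightarrow> \<exists>i. y i \<le> v"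
proof (cases "\<exists>a\<in>I. \<forall>v\<in>I. a \<le> v")
  case True
  then obtain a where "a \<in> I" "\<forall>v\<in>I. a \<le> v" by blast
  then show thesis using x by (intro that[of "\<lambda>_. a"]) (auto simp: decseq_def)
next
  case False
  obtain f :: "nat \<Rightarrow> ereal" where f: "decseq f" "range f \<subseteq> ereal ` I" "Inf (ereal ` I) = (INF i. f i)"
    using Inf_countable_INF[of "ereal ` I"] x by auto
  have "\<exists>r\<in>I. f i = ereal r" for i using f(2) by auto
  then obtain r where r: "\<And>i. r i \<in> I" "\<And>i. f i = ereal (r i)" by metis
  show thesis
  proof (rule that[of "\<lambda>i. min (r i) x"])
    show "decseq (\<lambda>i. min (r i) x)"
      using f(1) by (auto simp: decseq_def r(2) intro: min.coboundedI1)
    show "min (r i) x \<in> I" "min (r i) x \<le> x" for i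
      using r(1) x by (auto simp: min_def)
    fix v assume "v \<in> I"
    then obtain v' where v': "v' \<in> I" "v' < v" using False by force
    have "(INF i. f i) \<le> ereal v'"
      unfolding f(3)[symmetric] using v'(1) by (intro Inf_lower) auto
    also have "\<dots> < ereal v" using v'(2) by simp
    finally obtain i where "f i < ereal v"
      by (auto simp: INF_less_iff)
    then have "min (r i) x \<le> v" by (simp add: r(2) min.coboundedI1)
    then show "\<exists>i. min (r i) x \<le> v" ..
  qed
qed

text \<open>As \<open>y\<close> descends to the left end, the boundary value decreases and the
  integral increases, so both converge in \<open>ennreal\<close> and the identity passes to the
  limit.\<close>

lemma limit_at_left_end:
  assumes \<phi>: "\<And>x. x \<in> I \<Longrightarrow> 0 \<le> \<phi> x" "mono_on I \<phi>"
    and g: "g \<in> borel_funs I" "locally_integrable g" "\<And>u. u \<in> I \<Longrightarrow> 0 \<le> g u"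
    and eq: "\<And>x y. \<lbrakk>x \<in> I; y \<in> I\<rbrakk> \<Longrightarrow> \<phi> x = \<phi> y + (LBINT u=ereal y..ereal x. g u)"
    and x: "x \<in> I"
  shows "ennreal (\<phi> x) = (INF y\<in>I. ennreal (\<phi> y))
    + (\<integral>\<^sup>+u. below_kernel x u * ennreal (indicator I u * g u) \<partial>lborel)"
proof -
  obtain y :: "nat \<Rightarrow> real" where y: "decseq y" "\<And>i. y i \<in> I" "\<And>i. y i \<le> x" "\<And>v. v \<in> I \<Longrightarrow> \<exists>i. y i \<le> v"
    using cofinal_decreasing_sequence[OF x] by blast
  \<comment> \<open>Closed on the left, so that the supremum over \<open>i\<close> is exact even at
    the minimum of \<open>I\<close>, if there is one.\<close>
  define f where "f i u = indicator {y i..<x} u * ennreal (indicator I u * g u)" for i u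
  have gm[measurable]: "(\<lambda>u. indicator I u * g u) \<in> borel_measurable borel"
    using g(1) by (simp add: borel_funs_iff)
  have fm: "f i \<in> borel_measurable lborel" for i
    unfolding f_def by measurable
  have inc: "incseq f"
    using y(1) by (auto simp: incseq_def decseq_def le_fun_def f_def split: split_indicator) (meson order_trans)
  have fsup: "(SUP i. f i u) = below_kernel x u * ennreal (indicator I u * g u)" for u
  proof (rule antisym)
    show "(SUP i. f i u) \<le> below_kernel x u * ennreal (indicator I u * g u)"
      by (intro SUP_least) (auto simp: f_def below_kernel_def split: split_indicator)
    show "below_kernel x u * ennreal (indicator I u * g u) \<le> (SUP i. f i u)"
    proof (cases "u \<in> I")
      case True
      then obtain i where "y i \<le> u" using y(4) by blast
      then show ?thesis
        by (intro SUP_upper2[of i]) (auto simp: f_def below_kernel_def split: split_indicator)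
    qed simp
  qed
  have fi: "ennreal (\<phi> x) = ennreal (\<phi> (y i)) + (\<integral>\<^sup>+u. f i u \<partial>lborel)" for i
  proof -
    have "(\<integral>\<^sup>+u. f i u \<partial>lborel) = (\<integral>\<^sup>+u. indicator {y i<..<x} u * ennreal (g u) \<partial>lborel)"
    proof (rule nn_integral_cong_AE)
      show "AE u in lborel. f i u = indicator {y i<..<x} u * ennreal (g u)"
        using AE_lborel_singleton[of "y i"]
        by eventually_elim (use mem_I[OF y(2)[of i] x] in \<open>auto simp: f_def split: split_indicator\<close>)
    qed
    also have "\<dots> = ennreal (LBINT u=ereal (y i)..ereal x. g u)"
      by (rule nn_integral_interval(1)[OF g(2,3) y(2) x y(3)])
    finally show ?thesis
      using eq[OF x y(2)[of i]] \<phi>(1)[OF y(2)[of i]] nn_integral_interval(2)[OF g(2,3) y(2) x y(3)]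
      by simp
  qed
  have "decseq (\<lambda>i. ennreal (\<phi> (y i)))"
    using y(1,2) by (auto simp: decseq_def intro!: ennreal_leI mono_onD[OF \<phi>(2)])
  then have L1: "(\<lambda>i. ennreal (\<phi> (y i))) \<longlonglongrightarrow> (INF i. ennreal (\<phi> (y i)))"
    by (rule LIMSEQ_INF)
  have INF: "(INF i. ennreal (\<phi> (y i))) = (INF v\<in>I. ennreal (\<phi> v))"
  proof (rule antisym)
    show "(INF v\<in>I. ennreal (\<phi> v)) \<le> (INF i. ennreal (\<phi> (y i)))"
      using y(2) by (intro INF_greatest INF_lower)
    show "(INF i. ennreal (\<phi> (y i))) \<le> (INF v\<in>I. ennreal (\<phi> v))"
    proof (rule INF_greatest)
      fix v assume v: "v \<in> I"
      then obtain i where "y i \<le> v" using y(4) by blast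
      then show "(INF i. ennreal (\<phi> (y i))) \<le> ennreal (\<phi> v)"
        using y(2) v by (intro INF_lower2[of i] ennreal_leI mono_onD[OF \<phi>(2)]) auto
    qed
  qed
  have "incseq (\<lambda>i. \<integral>\<^sup>+u. f i u \<partial>lborel)"
    using inc by (auto simp: incseq_def le_fun_def intro!: nn_integral_mono)
  then have "(\<lambda>i. \<integral>\<^sup>+u. f i u \<partial>lborel) \<longlonglongrightarrow> (SUP i. \<integral>\<^sup>+u. f i u \<partial>lborel)"
    by (rule LIMSEQ_SUP)
  also have "(SUP i. \<integral>\<^sup>+u. f i u \<partial>lborel) = (\<integral>\<^sup>+u. (SUP i. f i u) \<partial>lborel)"
    by (rule nn_integral_monotone_convergence_SUP[OF inc fm, symmetric])
  finally have L2: "(\<lambda>i. \<integral>\<^sup>+u. f i u \<partial>lborel)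
      \<longlonglongrightarrow> (\<integral>\<^sup>+u. below_kernel x u * ennreal (indicator I u * g u) \<partial>lborel)"
    by (simp add: fsup)
  have "(\<lambda>i. ennreal (\<phi> x)) \<longlonglongrightarrow> (INF v\<in>I. ennreal (\<phi> v))
      + (\<integral>\<^sup>+u. below_kernel x u * ennreal (indicator I u * g u) \<partial>lborel)"
    using tendsto_add[OF L1 L2] unfolding INF fi[symmetric] .
  then show ?thesis
    by (rule LIMSEQ_unique[OF tendsto_const])
qed

text \<open>The expansion of \<open>f\<^sup>(\<^sup>j\<^sup>)\<close> at the left end of \<open>I\<close>; the boundary value of \<open>f\<^sup>(\<^sup>i\<^sup>)\<close> is the
  coefficient of \<open>p\<^bsub>a;j,i\<^esub>\<close>.\<close>

lemma left_end_expansion: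
  assumes f: "f \<in> S_space I w n"
    and nn: "\<And>j x. \<lbrakk>k \<le> j; j \<le> n; x \<in> I\<rbrakk> \<Longrightarrow> 0 \<le> gderiv I w j f x"
    and mono: "\<And>j. \<lbrakk>k \<le> j; j \<le> n\<rbrakk> \<Longrightarrow> mono_on I (gderiv I w j f)"
    and d: "d \<le> n - k" "k \<le> n"
  defines "lv \<equiv> \<lambda>i. INF y\<in>I. ennreal (gderiv I w i f y)"
    and "h \<equiv> \<lambda>x. ennreal (indicator I x * gderiv I w n f x)"
  shows "W (n - d) x * ennreal (gderiv I w (n - d) f x)
    = (\<Sum>i\<in>{n - d..<n}. lv i * V (i - (n - d)) (n - d) (\<lambda>_. 1) x) + V d (n - d) h x"
  using d(1)
proof (induction d arbitrary: x)
  \<comment> \<open>The top derivative is not split, as no further derivative is available; the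
    boundary terms therefore stop before \<open>n\<close>.\<close>
  case 0
  then show ?case by (cases "x \<in> I") (simp_all add: V_0 h_def W_not_I)
next
  case (Suc d)
  let ?j = "n - Suc d"
  have j: "k \<le> ?j" "?j < n" "n - d = Suc ?j" using Suc.prems d(2) by auto
  note C = S_space_chain[OF f]
  have [measurable]: "h \<in> borel_measurable borel"
    using gderiv_borel[OF f] unfolding h_def borel_funs_iff by simp
  have IH: "ennreal (indicator I u * (w (Suc ?j) u * gderiv I w (Suc ?j) f u))
      = (\<Sum>i\<in>{Suc ?j..<n}. lv i * V (i - Suc ?j) (Suc ?j) (\<lambda>_. 1) u) + V d (Suc ?j) h u" for u
  proof -
    have "ennreal (indicator I u * (w (Suc ?j) u * gderiv I w (Suc ?j) f u))
        = W (Suc ?j) u * ennreal (gderiv I w (Suc ?j) f u)"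
      using w_pos[of u "Suc ?j"] nn[of "Suc ?j" u] j
      by (cases "u \<in> I") (auto simp: W_def ennreal_mult simp del: gderiv.simps)
    then show ?thesis using Suc.IH[of u] Suc.prems unfolding j(3) by simp
  qed
  show ?case
  proof (cases "x \<in> I")
    case False
    then show ?thesis by (simp add: W_not_I V_not_I)
  next
    case x: True
    have "ennreal (gderiv I w ?j f x) = lv ?j + (\<integral>\<^sup>+u. below_kernel x u
        * ennreal (indicator I u * (w (Suc ?j) u * gderiv I w (Suc ?j) f u)) \<partial>lborel)"
      unfolding lv_def
    proof (rule limit_at_left_end[OF _ mono _ _ _ _ x])
      show "(\<lambda>u. w (Suc ?j) u * gderiv I w (Suc ?j) f u) \<in> borel_funs I"
        by (rule chain_D(1)[OF C]) (use j in simp)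
      show "locally_integrable (\<lambda>u. w (Suc ?j) u * gderiv I w (Suc ?j) f u)"
        by (rule chain_D(2)[OF C]) (use j in simp)
      show "0 \<le> w (Suc ?j) u * gderiv I w (Suc ?j) f u" if "u \<in> I" for u
        using nn[of "Suc ?j" u] w_pos[OF that, of "Suc ?j"] j that by (simp del: gderiv.simps)
      show "gderiv I w ?j f a = gderiv I w ?j f b
          + (LBINT u=ereal b..ereal a. w (Suc ?j) u * gderiv I w (Suc ?j) f u)" if "a \<in> I" "b \<in> I" for a b
        using chain_D(3)[OF C j(2) that] w_pos[OF that(1), of ?j] w_pos[OF that(2), of ?j] by simp
    qed (use nn j in auto)
    also have "(\<integral>\<^sup>+u. below_kernel x u
        * ennreal (indicator I u * (w (Suc ?j) u * gderiv I w (Suc ?j) f u)) \<partial>lborel)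
      = (\<Sum>i\<in>{Suc ?j..<n}. lv i * (\<integral>\<^sup>+u. below_kernel x u * V (i - Suc ?j) (Suc ?j) (\<lambda>_. 1) u \<partial>lborel))
        + (\<integral>\<^sup>+u. below_kernel x u * V d (Suc ?j) h u \<partial>lborel)"
    proof -
      have "(\<integral>\<^sup>+u. below_kernel x u * (lv i * V (i - Suc ?j) (Suc ?j) (\<lambda>_. 1) u) \<partial>lborel)
          = lv i * (\<integral>\<^sup>+u. below_kernel x u * V (i - Suc ?j) (Suc ?j) (\<lambda>_. 1) u \<partial>lborel)" for i
        by (subst nn_integral_cmult[symmetric]) (simp_all add: ac_simps)
      then show ?thesis
        unfolding IH by (simp add: distrib_left sum_distrib_left nn_integral_add nn_integral_sum)
    qed
    finally have "W ?j x * ennreal (gderiv I w ?j f x) = W ?j x * lv ?j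
        + (\<Sum>i\<in>{Suc ?j..<n}. W ?j x * (lv i * (\<integral>\<^sup>+u. below_kernel x u * V (i - Suc ?j) (Suc ?j) (\<lambda>_. 1) u \<partial>lborel)))
        + W ?j x * (\<integral>\<^sup>+u. below_kernel x u * V d (Suc ?j) h u \<partial>lborel)"
      by (simp add: distrib_left sum_distrib_left add.assoc)
    also have "W ?j x * (\<integral>\<^sup>+u. below_kernel x u * V d (Suc ?j) h u \<partial>lborel) = V (Suc d) ?j h x"
      by (simp add: V_Suc)
    also have "(\<Sum>i\<in>{Suc ?j..<n}. W ?j x * (lv i * (\<integral>\<^sup>+u. below_kernel x u * V (i - Suc ?j) (Suc ?j) (\<lambda>_. 1) u \<partial>lborel)))
        = (\<Sum>i\<in>{Suc ?j..<n}. lv i * V (i - ?j) ?j (\<lambda>_. 1) x)"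
    proof (rule sum.cong[OF refl])
      fix i assume "i \<in> {Suc ?j..<n}"
      then have "i - ?j = Suc (i - Suc ?j)" by auto
      then show "W ?j x * (lv i * (\<integral>\<^sup>+u. below_kernel x u * V (i - Suc ?j) (Suc ?j) (\<lambda>_. 1) u \<partial>lborel))
          = lv i * V (i - ?j) ?j (\<lambda>_. 1) x"
        by (simp add: V_Suc ac_simps)
    qed
    \<comment> \<open>The boundary value at level \<open>?j\<close> becomes the summand with
      \<open>i = ?j\<close>, because \<open>V 0\<close> of the constant 1 is the weight
      itself.\<close>
    also have "W ?j x * lv ?j + (\<Sum>i\<in>{Suc ?j..<n}. lv i * V (i - ?j) ?j (\<lambda>_. 1) x)
        = (\<Sum>i\<in>{?j..<n}. lv i * V (i - ?j) ?j (\<lambda>_. 1) x)"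
      using j(2) by (subst (2) sum.atLeast_Suc_lessThan) (simp_all add: V_0 ac_simps)
    finally show ?thesis .
  qed
qed

end

section \<open>Domination for the building blocks and for their mixtures\<close>

context dual_problem
begin

text \<open>\<open>V n 0 q\<close> is nonnegative, so its integrals always exist, and level
  \<open>m\<close> of its chain supplies the increment.\<close>

lemma dominates_of_V:
  assumes q: "mono q" "q \<in> borel_measurable borel" "\<And>x. q x < \<infinity>"
    and fin: "\<And>x. x \<in> I \<Longrightarrow> V n 0 q x < \<infinity>"
    and le: "(\<integral>\<^sup>+x. V n 0 q x \<partial>\<nu>2) \<le> (\<integral>\<^sup>+x. V n 0 q x \<partial>\<nu>1)" and mn: "m \<le> n"
    and h: "\<And>x. x \<in> I \<Longrightarrow> h x = ennreal \<bar>Vr (n - m) m q x / w m x - Vr (n - m) m q z / w m z\<bar>"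
  shows "dominates h"
proof (rule dominatesI[where F = "\<lambda>j. Vr (n - j) j q" and \<phi> = "\<lambda>x. Vr (n - m) m q x / w m x"])
  show "chain m (\<lambda>j. Vr (n - j) j q)"
    by (rule chain_mono[OF chain_Vr[OF q fin] mn])
  show "Vr (n - m) m q x = w m x * (Vr (n - m) m q x / w m x)" if "x \<in> I" for x
    using w_pos[OF that, of m] by simp
  have "V (n - m) m q x < \<infinity>" if "x \<in> I" for x
    using V_finite_le[OF q, where d = "n - m" and e = m and i = 0] fin that mn by simp
  then show "mono_on I (\<lambda>x. Vr (n - m) m q x / w m x)"
    by (rule Vr_mono_on[OF q(1)])
  have sp: "space \<nu>1 = I" "space \<nu>2 = I"
    using N_plusD(1) \<nu>1 \<nu>2 by auto
  have "(\<integral>\<^sup>+x. ennreal (Vr n 0 q x) \<partial>\<nu>) = (\<integral>\<^sup>+x. V n 0 q x \<partial>\<nu>)" if "space \<nu> = I" for \<nu>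
    by (intro nn_integral_cong) (simp add: that ennreal_Vr[OF fin])
  then show "integral_ge \<nu>1 \<nu>2 (\<lambda>x. ereal (Vr (n - 0) 0 q x))"
    using le sp by (subst integral_ge_nonneg) (auto simp: Vr_nonneg)
qed (rule h)

text \<open>Layers reach order \<open>m\<close> in two ways: for \<open>m = n\<close> the indicator
  is itself the derivative of order \<open>m\<close>, whereas for \<open>m < n\<close> one
  integration from \<open>z\<close> over level \<open>Suc m\<close> produces the increment.\<close>

lemma dominates_upper:
  assumes le: "\<And>t. t \<in> I \<Longrightarrow> (\<integral>\<^sup>+x. V n 0 (indicator {t..}) x \<partial>\<nu>2) \<le> (\<integral>\<^sup>+x. V n 0 (indicator {t..}) x \<partial>\<nu>1)"
    and mn: "m \<le> n" and t: "t \<in> I" and U: "U = I \<inter> {t..} \<or> U = I \<inter> {t<..}"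
    and h: "\<And>x. x \<in> I \<Longrightarrow> h x = (if m = n then ennreal \<bar>indicator U x - indicator U z\<bar>
      else \<integral>\<^sup>+u. between_kernel z x u * V (n - Suc m) (Suc m) (indicator U) u \<partial>lborel)"
  shows "dominates h"
proof -
  obtain A where A: "A = {t..} \<or> A = {t<..}" "U = I \<inter> A" using U by blast
  \<comment> \<open>The indicator of the whole half-line, unlike that of \<open>U\<close>, is
    monotone on all reals, as the lemmas on \<open>V\<close> require; on \<open>I\<close> the two
    agree.\<close>
  define q where "q = (indicator A :: real \<Rightarrow> ennreal)"
  have q: "mono q" "q \<in> borel_measurable borel" "\<And>x. q x < \<infinity>"
    "\<And>x. x < t \<Longrightarrow> q x = 0" "\<And>x. q x \<le> 1"
    using A(1) by (auto simp: q_def mono_def split: split_indicator)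
  have fin: "V d i q x < \<infinity>" if "x \<in> I" for d i x
    by (rule V_finite_of_support[OF q(4,5) t that])
  have qU: "q x = indicator U x" if "x \<in> I" for x
    using that A(2) by (auto simp: q_def split: split_indicator)
  have leq: "(\<integral>\<^sup>+x. V n 0 q x \<partial>\<nu>2) \<le> (\<integral>\<^sup>+x. V n 0 q x \<partial>\<nu>1)"
    using A(1) le[OF t] V_open_upper_set[OF t \<nu>1 \<nu>2 le] by (auto simp: q_def)
  show ?thesis
  proof (rule dominates_of_V[OF q(1-3) fin leq mn])
    fix x assume x: "x \<in> I"
    show "h x = ennreal \<bar>Vr (n - m) m q x / w m x - Vr (n - m) m q z / w m z\<bar>"
    proof (cases "m = n")
      case True
      have "Vr 0 m q y / w m y = indicator U y" if "y \<in> I" for y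
        using w_pos[OF that, of m] qU[OF that] by (auto simp: Vr_def V_0 W_I that split: split_indicator)
      then show ?thesis using h[OF x] True x z by simp
    next
      case False
      then have n: "n - m = Suc (n - Suc m)" using mn by simp
      have "V (n - Suc m) (Suc m) q = V (n - Suc m) (Suc m) (indicator U)"
        by (rule V_cong[OF qU])
      then show ?thesis
        using h[OF x] False V_link(3)[OF q(1-3) fin x z, of "n - Suc m" m] unfolding n by simp
    qed
  qed
qed

text \<open>The derivative of order \<open>m\<close> of the function in (ii') is the integral from
  \<open>z\<close> of a nonnegative function. It vanishes at \<open>z\<close>, so the modulus of its
  increment is the unsigned integral.\<close>

lemma dominates_p_az:
  assumes j: "j \<in> F_index I w (Suc m) n"
    and ge: "integral_ge \<nu>1 \<nu>2 (p_az_fun I w z 0 (Suc m) j)"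
  shows "dominates (\<lambda>x. \<integral>\<^sup>+u. between_kernel z x u * V (j - Suc m) (Suc m) (\<lambda>_. 1) u \<partial>lborel)"
proof -
  let ?g = "Vr (j - Suc m) (Suc m) (\<lambda>_. 1)"
  have fin: "\<And>x. x \<in> I \<Longrightarrow> V (j - Suc m) (Suc m) (\<lambda>_. 1) x < \<infinity>"
    using j by (auto simp: F_index_iff)
  have li: "locally_integrable ?g"
    by (rule Vr_locally_integrable[OF _ _ fin]) (auto simp: mono_def)
  show ?thesis
  proof (rule dominatesI[where F = "\<lambda>i. iter_re w z (Suc m - i) i ?g" and \<phi> = "\<lambda>x. LBINT u=ereal z..ereal x. ?g u"])
    have "chain (Suc m) (\<lambda>i. iter_re w z (Suc m - i) i ?g)"
      by (intro chain_iter_re li z Vr_borel) simp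
    then show "chain m (\<lambda>i. iter_re w z (Suc m - i) i ?g)"
      by (rule chain_mono) simp
    show "mono_on I (\<lambda>x. LBINT u=ereal z..ereal x. ?g u)"
    proof (rule mono_onI)
      fix x y assume xy: "x \<in> I" "y \<in> I" "x \<le> y"
      have "0 \<le> (LBINT u=ereal x..ereal y. ?g u)"
        by (rule nn_integral_interval(2)[OF li Vr_nonneg xy])
      then show "(LBINT u=ereal z..ereal x. ?g u) \<le> (LBINT u=ereal z..ereal y. ?g u)"
        using interval_integral_split[OF li z xy(1,2)] by simp
    qed
    show "integral_ge \<nu>1 \<nu>2 (\<lambda>x. ereal (iter_re w z (Suc m - 0) 0 ?g x))"
      using ge integral_ge_cong(1)[OF N_plusD(1)[OF \<nu>1] N_plusD(1)[OF \<nu>2] p_az_fun_real[OF j z]] by simp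
    fix x assume x: "x \<in> I"
    have "ennreal \<bar>LBINT u=ereal z..ereal x. ?g u\<bar> = (\<integral>\<^sup>+u. between_kernel z x u * ennreal \<bar>?g u\<bar> \<partial>lborel)"
      by (rule interval_integral_side(2)[where e = 0, OF li z x]) (simp add: Vr_nonneg)
    also have "\<dots> = (\<integral>\<^sup>+u. between_kernel z x u * V (j - Suc m) (Suc m) (\<lambda>_. 1) u \<partial>lborel)"
      by (rule nn_integral_between_cong[OF z x]) (simp add: Vr_nonneg ennreal_Vr[OF fin])
    finally show "(\<integral>\<^sup>+u. between_kernel z x u * V (j - Suc m) (Suc m) (\<lambda>_. 1) u \<partial>lborel)
        = ennreal \<bar>(LBINT u=ereal z..ereal x. ?g u) - (LBINT u=ereal z..ereal z. ?g u)\<bar>"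
      by simp
  qed simp
qed

text \<open>The case \<open>k = n + 1\<close>: the increment is cut at the levels between its two
  values, so that the layer at \<open>l\<close> is the increment of the indicator of a level
  set.\<close>

lemma dominates_F_plus_top:
  assumes f: "f \<in> S_space I w m" and mono: "mono_on I (gderiv I w m f)"
    and le: "\<And>t. t \<in> I \<Longrightarrow> (\<integral>\<^sup>+x. V m 0 (indicator {t..}) x \<partial>\<nu>2) \<le> (\<integral>\<^sup>+x. V m 0 (indicator {t..}) x \<partial>\<nu>1)"
  shows "dominates (\<lambda>x. ennreal \<bar>gderiv I w m f x - gderiv I w m f z\<bar>)"
proof -
  define \<psi> where "\<psi> = gderiv I w m f"
  define r where "r x = indicator I x * \<psi> x" for x
  have [measurable]: "r \<in> borel_measurable borel"
    using gderiv_borel[OF f] unfolding r_def[abs_def] \<psi>_def borel_funs_iff .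
  have r: "r x = \<psi> x" if "x \<in> I" for x using that by (simp add: r_def)
  \<comment> \<open>Half-open, so that the layer is 1 exactly when one of \<open>x\<close> and
    \<open>z\<close> lies in the level set at \<open>l\<close> and the other does not.\<close>
  define h where "h l x = (if min (r x) (\<psi> z) < l \<and> l \<le> max (r x) (\<psi> z) then 1 else 0 :: ennreal)" for l x
  have "dominates (\<lambda>x. ennreal \<bar>\<psi> x - \<psi> z\<bar>)"
  proof (rule dominates_mixture[where J = "{}" and c = "\<lambda>_. 0" and g = "\<lambda>_ _. 0" and h = h])
    show "(\<lambda>(l, x). h l x) \<in> borel_measurable (lborel \<Otimes>\<^sub>M borel)"
      unfolding h_def by measurable
    show "ennreal \<bar>\<psi> x - \<psi> z\<bar> = (\<Sum>j\<in>{}. 0 * 0) + (\<integral>\<^sup>+l. h l x \<partial>lborel)" if x: "x \<in> I" for x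
    proof -
      have "(\<integral>\<^sup>+l. h l x \<partial>lborel) = (\<integral>\<^sup>+l. indicator {min (\<psi> x) (\<psi> z)<..max (\<psi> x) (\<psi> z)} l \<partial>lborel)"
        by (intro nn_integral_cong) (auto simp: h_def r[OF x] split: split_indicator)
      also have "\<dots> = ennreal \<bar>\<psi> x - \<psi> z\<bar>"
        by (auto simp: min_def max_def)
      finally show ?thesis by simp
    qed
    show "dominates (h l)" for l
    proof -
      define U where "U = {x \<in> I. l \<le> \<psi> x}"
      have eq: "h l x = ennreal \<bar>indicator U x - indicator U z\<bar>" if "x \<in> I" for x
        using that z by (auto simp: h_def U_def r split: split_indicator)
      have "U = {} \<or> U = I \<or> (\<exists>t\<in>I. U = I \<inter> {t..} \<or> U = I \<inter> {t<..})"
      proof (rule upper_subset_of_I)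
        show "U \<subseteq> I" by (auto simp: U_def)
        fix x y assume "x \<in> U" "y \<in> I" "x \<le> y"
        then show "y \<in> U"
          using mono_onD[OF mono, of x y] by (auto simp: U_def \<psi>_def)
      qed
      then consider "U = {} \<or> U = I" | t where "t \<in> I" "U = I \<inter> {t..} \<or> U = I \<inter> {t<..}"
        by blast
      then show ?thesis
      proof cases
        case 1
        have "h l x = 0" if "x \<in> I" for x
          using 1 eq[OF that] that z by auto
        then show ?thesis
          using dominates_cong[of "h l" "\<lambda>x. 0"] dominates_zero by simp
      next
        case (2 t)
        show ?thesis
          by (rule dominates_upper[OF le order_refl 2]) (simp_all add: eq)
      qed
    qed
  qed simp_all
  then show ?thesis by (simp add: \<psi>_def)
qed

text \<open>Using (ii') requires membership in \<open>F_index\<close>. Each finiteness needed is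
  read off from the finite value of w_k f^(k), which bounds every nonnegative term of its
  expansion.\<close>

lemma dominates_F_plus_less:
  assumes f: "f \<in> S_space I w n" and mn: "m < n"
    and mono: "\<And>j. \<lbrakk>m \<le> j; j \<le> n\<rbrakk> \<Longrightarrow> mono_on I (gderiv I w j f)"
    and az: "\<And>j. j \<in> F_index I w (Suc m) n \<Longrightarrow> integral_ge \<nu>1 \<nu>2 (p_az_fun I w z 0 (Suc m) j)"
    and le: "\<And>t. t \<in> I \<Longrightarrow> (\<integral>\<^sup>+x. V n 0 (indicator {t..}) x \<partial>\<nu>2) \<le> (\<integral>\<^sup>+x. V n 0 (indicator {t..}) x \<partial>\<nu>1)"
  shows "dominates (\<lambda>x. ennreal \<bar>gderiv I w m f x - gderiv I w m f z\<bar>)"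
proof -
  let ?k = "Suc m" and ?one = "\<lambda>_::real. 1::ennreal"
  define \<psi> where "\<psi> j = gderiv I w j f" for j
  have nn: "0 \<le> \<psi> j x" if j: "?k \<le> j" "j \<le> n" "x \<in> I" for j x
  proof -
    obtain j' where j': "j = Suc j'" using j(1) by (cases j) auto
    have "f \<in> S_space I w (Suc j')" using S_spaceD[OF f] j j' by blast
    then show ?thesis
      using gderiv_Suc_nonneg[OF _ mono[of j'] j(3)] j j' by (simp add: \<psi>_def)
  qed
  define r where "r x = indicator I x * \<psi> n x" for x
  have [measurable]: "r \<in> borel_measurable borel"
    using gderiv_borel[OF f] unfolding r_def[abs_def] \<psi>_def borel_funs_iff .
  have r: "0 \<le> r x" for x
    using nn[of n x] mn by (auto simp: r_def split: split_indicator)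
  define q where "q l x = (if 0 < l \<and> l \<le> r x then 1 else 0 :: ennreal)" for l x
  have qm: "(\<lambda>(l, x). q l x) \<in> borel_measurable (lborel \<Otimes>\<^sub>M borel)"
    unfolding q_def by measurable
  have qint: "(\<integral>\<^sup>+l. q l x \<partial>lborel) = ennreal (r x)" for x
  proof -
    have "(\<integral>\<^sup>+l. q l x \<partial>lborel) = (\<integral>\<^sup>+l. indicator {0<..r x} l \<partial>lborel)"
      by (intro nn_integral_cong) (auto simp: q_def split: split_indicator)
    then show ?thesis using r[of x] by simp
  qed
  have ql: "(\<lambda>l. q l x) \<in> borel_measurable lborel" for x
    unfolding q_def by measurable
  have Wq: "(\<lambda>(l, x). W (?k + (n - ?k)) x * q l x) \<in> borel_measurable (lborel \<Otimes>\<^sub>M borel)"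
  proof -
    have "(\<lambda>p. W (?k + (n - ?k)) (snd p)) \<in> borel_measurable (lborel \<Otimes>\<^sub>M borel)" by measurable
    from borel_measurable_times_ennreal[OF this qm] show ?thesis by (simp add: case_prod_beta')
  qed
  have Vq: "(\<lambda>(l, x). V (n - ?k) ?k (q l) x) \<in> borel_measurable (lborel \<Otimes>\<^sub>M borel)"
    unfolding V_def by (rule below.measurable_iter_param[OF Wq])
  have Vr: "V (n - ?k) ?k (\<lambda>x. ennreal (r x)) = (\<lambda>x. \<integral>\<^sup>+l. V (n - ?k) ?k (q l) x \<partial>lborel)"
    unfolding V_def qint[symmetric]
    using below.iter_nn_nn_integral[OF lborel.sigma_finite_measure_axioms Wq, of "n - ?k" ?k]
    by (simp add: nn_integral_cmult[OF ql])
  define c where "c i = (INF y\<in>I. ennreal (\<psi> i y))" for i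
  define g where "g j x = (\<integral>\<^sup>+u. between_kernel z x u * V (j - ?k) ?k ?one u \<partial>lborel)" for j x
  define h where "h l x = (\<integral>\<^sup>+u. between_kernel z x u * V (n - ?k) ?k (q l) u \<partial>lborel)" for l x
  \<comment> \<open>Weight 1, because the increment at order \<open>m\<close> carries no factor
    \<open>w m\<close>; that factor is supplied by \<open>T\<close>.\<close>
  interpret K: nn_kernel "between_kernel z" "\<lambda>_ _. 1"
    by unfold_locales (rule measurable_between_kernel, simp)
  have g1: "g j = iter_nn (between_kernel z) (\<lambda>_ _. 1) (Suc 0) 0 (V (j - ?k) ?k ?one)" for j
    by (simp add: g_def fun_eq_iff)
  have h1: "h l = iter_nn (between_kernel z) (\<lambda>_ _. 1) (Suc 0) 0 (V (n - ?k) ?k (q l))" for l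
    by (simp add: h_def fun_eq_iff)
  have expansion: "W ?k u * ennreal (\<psi> ?k u)
      = (\<Sum>i\<in>{?k..<n}. c i * V (i - ?k) ?k ?one u) + V (n - ?k) ?k (\<lambda>x. ennreal (r x)) u" for u
  proof -
    have "n - (n - ?k) = ?k" using mn by simp
    then show ?thesis
      using left_end_expansion[OF f nn[unfolded \<psi>_def] mono, of ?k "n - ?k" u] mn
      by (simp add: \<psi>_def c_def r_def[abs_def] del: gderiv.simps)
  qed
  have fin: "W ?k u * ennreal (\<psi> ?k u) < \<infinity>" if "u \<in> I" for u
    using that by (simp add: W_I ennreal_mult_less_top)
  have one: "dominates (g j)" if j: "?k \<le> j" "j \<le> n" and V: "\<And>x. x \<in> I \<Longrightarrow> V (j - ?k) ?k ?one x < \<infinity>" for j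
    unfolding g_def by (rule dominates_p_az[OF _ az]) (use j V in \<open>auto simp: F_index_iff\<close>)
  have "dominates (\<lambda>x. ennreal \<bar>\<psi> m x - \<psi> m z\<bar>)"
  proof (rule dominates_mixture[where J = "{?k..<n}" and c = c and g = g and h = h])
    show "g j \<in> borel_measurable borel" for j
      unfolding g1 by (intro K.measurable_iter V_measurable) simp
    show "(\<lambda>(l, x). h l x) \<in> borel_measurable (lborel \<Otimes>\<^sub>M borel)"
      unfolding h1 by (rule K.measurable_iter_param[OF Vq])
    show "ennreal \<bar>\<psi> m x - \<psi> m z\<bar> = (\<Sum>j\<in>{?k..<n}. c j * g j x) + (\<integral>\<^sup>+l. h l x \<partial>lborel)" if x: "x \<in> I" for x
    proof -
      note C = S_space_chain[OF f, folded \<psi>_def]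
      have li: "locally_integrable (\<lambda>u. w ?k u * \<psi> ?k u)"
        using chain_D(2)[OF C mn] .
      have "\<psi> m x - \<psi> m z = (LBINT u=ereal z..ereal x. w ?k u * \<psi> ?k u)"
        using chain_D(3)[OF C mn x z] w_pos[OF x, of m] w_pos[OF z, of m] by simp
      then have "ennreal \<bar>\<psi> m x - \<psi> m z\<bar>
          = (\<integral>\<^sup>+u. between_kernel z x u * ennreal \<bar>w ?k u * \<psi> ?k u\<bar> \<partial>lborel)"
        using interval_integral_side(2)[where e = 0, OF li z x] nn mn w_pos by (simp add: less_imp_le)
      also have "\<dots> = (\<integral>\<^sup>+u. between_kernel z x u * (W ?k u * ennreal (\<psi> ?k u)) \<partial>lborel)"
        using nn[of ?k] mn w_pos
        by (intro nn_integral_between_cong[OF z x]) (simp add: W_I ennreal_mult less_imp_le)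
      also have "\<dots> = (\<Sum>j\<in>{?k..<n}. c j * g j x)
          + (\<integral>\<^sup>+u. between_kernel z x u * V (n - ?k) ?k (\<lambda>x. ennreal (r x)) u \<partial>lborel)"
      proof -
        have "(\<integral>\<^sup>+u. between_kernel z x u * (c i * V (i - ?k) ?k ?one u) \<partial>lborel) = c i * g i x" for i
          unfolding g_def by (subst nn_integral_cmult[symmetric]) (simp_all add: ac_simps)
        then show ?thesis
          unfolding expansion by (simp add: distrib_left sum_distrib_left nn_integral_add nn_integral_sum)
      qed
      also have "(\<integral>\<^sup>+u. between_kernel z x u * V (n - ?k) ?k (\<lambda>x. ennreal (r x)) u \<partial>lborel)
          = (\<integral>\<^sup>+l. h l x \<partial>lborel)"
        using fun_cong[OF K.iter_nn_nn_integral[OF lborel.sigma_finite_measure_axioms Vq, of "Suc 0" 0], of x]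
        unfolding Vr by (simp add: h_def)
      finally show ?thesis .
    qed
    show "dominates (g j)" if j: "j \<in> {?k..<n}" "c j \<noteq> 0" for j
    proof (rule one)
      fix x assume x: "x \<in> I"
      \<comment> \<open>A nonzero boundary value forces \<open>j\<close> into
        \<open>F_index\<close>, since its term is at most the finite left-hand side of the
        expansion.\<close>
      have "c j * V (j - ?k) ?k ?one x \<le> (\<Sum>i\<in>{?k..<n}. c i * V (i - ?k) ?k ?one x)"
        using j(1) by (intro member_le_sum) auto
      also have "\<dots> \<le> W ?k x * ennreal (\<psi> ?k x)"
        unfolding expansion by simp
      also have "\<dots> < \<infinity>" by (rule fin[OF x])
      finally show "V (j - ?k) ?k ?one x < \<infinity>"
        using j(2) by (auto simp: ennreal_mult_less_top)
    qed (use j in auto)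
    show "dominates (h l)" for l
    proof (cases "0 < l")
      case False
      then have "h l x = 0" for x
        by (simp add: h_def q_def[abs_def] V_zero)
      then show ?thesis
          using dominates_cong[of "h l" "\<lambda>x. 0"] dominates_zero by simp
    next
      case l: True
      define U where "U = {x \<in> I. l \<le> \<psi> n x}"
      have qU: "q l x = indicator U x" for x
        using l by (auto simp: q_def U_def r_def split: split_indicator)
      have "U = {} \<or> U = I \<or> (\<exists>t\<in>I. U = I \<inter> {t..} \<or> U = I \<inter> {t<..})"
      proof (rule upper_subset_of_I)
        show "U \<subseteq> I" by (auto simp: U_def)
        fix x y assume "x \<in> U" "y \<in> I" "x \<le> y"
        then show "y \<in> U"
          using mono_onD[OF mono[of n], of x y] mn by (auto simp: U_def \<psi>_def)
      qed
      then consider "U = {}" | "U = I" | t where "t \<in> I" "U = I \<inter> {t..} \<or> U = I \<inter> {t<..}"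
        by blast
      then show ?thesis
      proof cases
        case 1
        then have "q l = (\<lambda>x. 0)"
          by (simp add: fun_eq_iff qU)
        then have "h l x = 0" for x
          by (simp add: h_def V_zero)
        then show ?thesis
          using dominates_cong[of "h l" "\<lambda>x. 0"] dominates_zero by simp
      next
        \<comment> \<open>Here the derivative of order \<open>n\<close> stays at least
          \<open>l\<close> down to the left end, so \<open>l\<close> times p_{a;k,n} is at most w_k
          f^(k). Hence \<open>n\<close> belongs to \<open>F_index\<close> and (ii') applies with
          \<open>j = n\<close>.\<close>
        case 2
        have qlm: "q l \<in> borel_measurable borel"
          unfolding q_def[abs_def] by measurable
        have V1: "V (n - ?k) ?k (q l) = V (n - ?k) ?k ?one"
          by (rule V_cong) (simp add: qU 2)
        have "dominates (g n)"
        proof (rule one)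
          fix x assume x: "x \<in> I"
          have "ennreal l * V (n - ?k) ?k ?one x = V (n - ?k) ?k (\<lambda>x. ennreal l * q l x) x"
            using V_cmult[OF qlm, of "n - ?k" ?k "ennreal l" x] by (simp add: V1)
          also have "\<dots> \<le> V (n - ?k) ?k (\<lambda>x. ennreal (r x)) x"
            by (rule V_mono) (auto simp: q_def intro!: ennreal_leI)
          also have "\<dots> \<le> W ?k x * ennreal (\<psi> ?k x)"
            unfolding expansion by simp
          also have "\<dots> < \<infinity>" by (rule fin[OF x])
          finally show "V (n - ?k) ?k ?one x < \<infinity>"
            using l by (auto simp: ennreal_mult_less_top)
        qed (use mn in auto)
        then show ?thesis
          using dominates_cong[of "g n" "h l"] by (simp add: g_def h_def V1)
      next
        case (3 t)
        show ?thesis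
          by (rule dominates_upper[OF le _ 3]) (use mn in \<open>simp_all add: h_def fun_eq_iff[THEN iffD2, OF allI, OF qU]\<close>)
      qed
    qed
  qed simp
  then show ?thesis by (simp only: \<psi>_def)
qed

lemma integral_ge_F_plus:
  assumes f: "f \<in> F_plus I w (Suc m) n" and mn: "m \<le> n"
    and fin: "(\<integral>\<^sup>+x. ennreal (- f x) \<partial>\<nu>1) < \<infinity>" "(\<integral>\<^sup>+x. ennreal (- f x) \<partial>\<nu>2) < \<infinity>"
    and az: "\<And>j. j \<in> F_index I w (Suc m) n \<Longrightarrow> integral_ge \<nu>1 \<nu>2 (p_az_fun I w z 0 (Suc m) j)"
    and le: "\<And>t. t \<in> I \<Longrightarrow> (\<integral>\<^sup>+x. V n 0 (indicator {t..}) x \<partial>\<nu>2) \<le> (\<integral>\<^sup>+x. V n 0 (indicator {t..}) x \<partial>\<nu>1)"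
  shows "integral_ge \<nu>1 \<nu>2 (\<lambda>x. ereal (f x))"
proof -
  have S: "f \<in> S_space I w n" and mono: "\<And>j. m \<le> j \<Longrightarrow> j \<le> n \<Longrightarrow> mono_on I (gderiv I w j f)"
    using f by (auto simp: F_plus_def)
  let ?h = "\<lambda>x. ennreal \<bar>gderiv I w m f x - gderiv I w m f z\<bar>"
  have dom: "dominates ?h"
  proof (cases "m = n")
    case True
    show ?thesis
      by (rule dominates_F_plus_top) (use S mono le True in auto)
  next
    case False
    then have "m < n" using mn by simp
    from dominates_F_plus_less[OF S this mono az le] show ?thesis .
  qed
  have C: "chain m (\<lambda>j x. w j x * gderiv I w j f x)"
    by (rule chain_mono[OF S_space_chain[OF S] mn])
  note cmp = chain_comparison[OF C refl mono[OF order_refl mn]]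
  have eq: "w 0 x * gderiv I w 0 f x = f x" if "x \<in> I" for x
    using w_pos[OF that, of 0] by simp
  have sp: "space \<nu>1 = I" "space \<nu>2 = I"
    using N_plusD(1) \<nu>1 \<nu>2 by auto
  have int: "(\<integral>\<^sup>+x. ennreal (- (w 0 x * gderiv I w 0 f x)) \<partial>\<nu>) = (\<integral>\<^sup>+x. ennreal (- f x) \<partial>\<nu>)" if "space \<nu> = I" for \<nu>
    by (intro nn_integral_cong) (simp only: that eq)
  have "integral_ge \<nu>1 \<nu>2 (\<lambda>x. ereal (w 0 x * gderiv I w 0 f x))"
    using cmp(3) cmp(1,2) fin dom unfolding int[OF sp(1)] int[OF sp(2)] by blast
  then show ?thesis
    using integral_ge_cong(1)[OF sp, of "\<lambda>x. ereal (w 0 x * gderiv I w 0 f x)" "\<lambda>x. ereal (f x)"] eq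
    by simp
qed

end

section \<open>Translation of the three conditions, and the equivalence\<close>

context gauge_system
begin

lemma p_fun_real:
  assumes "s \<in> I" "x \<in> I"
  shows "p_fun w (ereal s) 0 i x = ereal (iter_re w s i 0 (w i) x)"
  unfolding p_fun_def using iter_integral_real[OF w_locally_integrable assms(1) refl assms(2), where j = 0 and d = i]
  by simp

lemma integral_ge_p_fun_plus_iff:
  assumes \<nu>: "\<nu>1 \<in> N_plus I" "\<nu>2 \<in> N_plus I" and t: "t \<in> I"
  shows "integral_ge \<nu>1 \<nu>2 (p_fun_plus w t 0 n) \<longleftrightarrow>
    (\<integral>\<^sup>+x. V n 0 (indicator {t..}) x \<partial>\<nu>2) \<le> (\<integral>\<^sup>+x. V n 0 (indicator {t..}) x \<partial>\<nu>1)"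
proof -
  have p: "p_fun_plus w t 0 n x = enn2ereal (V n 0 (indicator {t..}) x)" if "x \<in> I" for x
    using p_fun_plus_V[OF t that, of 0 n] by simp
  have "integral_ge \<nu>1 \<nu>2 (p_fun_plus w t 0 n)
      = integral_ge \<nu>1 \<nu>2 (\<lambda>x. enn2ereal (V n 0 (indicator {t..}) x))"
    by (rule integral_ge_cong(1)[OF N_plusD(1)[OF \<nu>(1)] N_plusD(1)[OF \<nu>(2)]]) (rule p)
  also have "\<dots> \<longleftrightarrow> (\<integral>\<^sup>+x. V n 0 (indicator {t..}) x \<partial>\<nu>2) \<le> (\<integral>\<^sup>+x. V n 0 (indicator {t..}) x \<partial>\<nu>1)"
    by (subst integral_ge_nonneg) simp_all
  finally show ?thesis .
qed

lemma integral_eq_real_iff: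
  assumes \<nu>: "\<nu>1 \<in> N_plus I" "\<nu>2 \<in> N_plus I" and f: "f \<in> borel_funs I"
  shows "integral_eq_real \<nu>1 \<nu>2 (\<lambda>x. ereal (f x)) \<longleftrightarrow>
    integrable \<nu>1 f \<and> integrable \<nu>2 f \<and> (\<integral>x. f x \<partial>\<nu>1) = (\<integral>x. f x \<partial>\<nu>2)"
  using ext_integral_real_iff[OF N_plusD(2)[OF \<nu>(1) f]] ext_integral_real_iff[OF N_plusD(2)[OF \<nu>(2) f]]
  unfolding integral_eq_real_def by force

end

theorem theorem5p5:
  fixes I :: "real set" and w :: "nat \<Rightarrow> real \<Rightarrow> real" and k n :: nat
    and G :: "(real \<Rightarrow> real) set" and \<nu>1 \<nu>2 :: "real measure" and s z :: real
  assumes "is_interval I" and "\<exists>x\<in>I. \<exists>y\<in>I. x < y"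
    and "gauge_seq I w"
    and "1 \<le> k" and "k \<le> n + 1"
    and "P_plus I w k n \<union> P_zero_plus I w n \<subseteq> G" and "G \<subseteq> F_plus I w k n"
    and "\<nu>1 \<in> N_plus_on I G" and "\<nu>2 \<in> N_plus_on I G"
    and "s \<in> I" and "z \<in> I"
  shows "(\<nu>1, \<nu>2) \<in> dual_cone I G \<longleftrightarrow>
     (\<forall>i\<in>{0..k - 1}. integral_eq_real \<nu>1 \<nu>2 (p_fun w (ereal s) 0 i)) \<and>
     (\<forall>j\<in>F_index I w k n. integral_ge \<nu>1 \<nu>2 (p_az_fun I w z 0 k j)) \<and>
     (\<forall>t\<in>I. integral_ge \<nu>1 \<nu>2 (p_fun_plus w t 0 n))"
proof -
  interpret gauge_system I w by unfold_locales fact+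
  have \<nu>: "\<nu>1 \<in> N_plus I" "\<nu>2 \<in> N_plus I"
    using assms(8,9) by (auto simp: N_plus_on_def)
  note sp = N_plusD(1)[OF \<nu>(1)] N_plusD(1)[OF \<nu>(2)]
  have neg: "(\<integral>\<^sup>+x. ennreal (- f x) \<partial>\<nu>1) < \<infinity>" "(\<integral>\<^sup>+x. ennreal (- f x) \<partial>\<nu>2) < \<infinity>" if "f \<in> G" for f
    using assms(8,9) that unfolding neg_part_finite_iff by (auto simp: N_plus_on_def)
  have dual: "(\<nu>1, \<nu>2) \<in> dual_cone I G \<longleftrightarrow> (\<forall>f\<in>G. integral_ge \<nu>1 \<nu>2 (\<lambda>x. ereal (f x)))"
    using assms(8,9) by (simp add: dual_cone_def)
  let ?P = "\<lambda>i. iter_re w s i 0 (w i)"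
  have Pb: "?P i \<in> borel_funs I" for i
    by (rule iter_re_borel[OF w_locally_integrable assms(10) w_borel])
  have eq_real: "integral_eq_real \<nu>1 \<nu>2 (p_fun w (ereal s) 0 i) \<longleftrightarrow>
      integrable \<nu>1 (?P i) \<and> integrable \<nu>2 (?P i) \<and> (\<integral>x. ?P i x \<partial>\<nu>1) = (\<integral>x. ?P i x \<partial>\<nu>2)" for i
  proof -
    have "integral_eq_real \<nu>1 \<nu>2 (p_fun w (ereal s) 0 i) = integral_eq_real \<nu>1 \<nu>2 (\<lambda>x. ereal (?P i x))"
      by (rule integral_ge_cong(2)[OF sp]) (rule p_fun_real[OF assms(10)])
    then show ?thesis
      using integral_eq_real_iff[OF \<nu> Pb] by blast
  qed
  show ?thesis
    unfolding dual
  proof (intro iffI conjI ballI)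
    assume ge: "\<forall>f\<in>G. integral_ge \<nu>1 \<nu>2 (\<lambda>x. ereal (f x))"
    {
      fix i assume "i \<in> {0..k - 1}"
      then have i: "i < k" using assms(4) by auto
      have PG: "?P i \<in> G" "(\<lambda>x. - ?P i x) \<in> G"
        using polynomial_in_P_plus[OF assms(10) i assms(5)] assms(6) by auto
      \<comment> \<open>Finite negative parts of \<open>?P i\<close> and of its negative together
        amount to integrability.\<close>
      have int: "integrable \<nu>1 (?P i)" "integrable \<nu>2 (?P i)"
        using neg[OF PG(1)] neg[OF PG(2)] N_plusD(2)[OF \<nu>(1) Pb] N_plusD(2)[OF \<nu>(2) Pb]
        by (auto simp: real_integrable_def)
      have "integral_ge \<nu>1 \<nu>2 (\<lambda>x. ereal (?P i x))" "integral_ge \<nu>1 \<nu>2 (\<lambda>x. ereal (- ?P i x))"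
        using bspec[OF ge PG(1)] bspec[OF ge PG(2)] by simp_all
      then have "(\<integral>x. ?P i x \<partial>\<nu>1) = (\<integral>x. ?P i x \<partial>\<nu>2)"
        using int ext_integral_real_iff(2)[of "?P i"] ext_integral_real_iff(2)[of "\<lambda>x. - ?P i x"]
        by (simp add: integral_ge_def borel_measurable_integrable)
      then show "integral_eq_real \<nu>1 \<nu>2 (p_fun w (ereal s) 0 i)"
        using int eq_real by blast
    next
      fix j assume j: "j \<in> F_index I w k n"
      let ?f = "iter_re w z k 0 (Vr (j - k) k (\<lambda>_. 1))"
      have "?f \<in> G"
        using p_az_in_P_plus[OF j assms(11,4)] assms(6) by blast
      moreover have "integral_ge \<nu>1 \<nu>2 (p_az_fun I w z 0 k j) = integral_ge \<nu>1 \<nu>2 (\<lambda>x. ereal (?f x))"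
        by (rule integral_ge_cong(1)[OF sp]) (rule p_az_fun_real[OF j assms(11)])
      ultimately show "integral_ge \<nu>1 \<nu>2 (p_az_fun I w z 0 k j)"
        using ge by blast
    next
      fix t assume t: "t \<in> I"
      \<comment> \<open>\<open>G\<close> consists of real functions, so a real-valued representative
        of the test function is needed; its values off \<open>I\<close> are immaterial.\<close>
      have p: "p_fun_plus w t 0 n x = ereal (Vr n 0 (indicator {t..}) x)" if "x \<in> I" for x
      proof -
        have "V n 0 (indicator {t..}) x < \<infinity>"
          by (rule V_finite_of_support[OF _ _ t that]) (auto split: split_indicator)
        then show ?thesis
          using p_fun_plus_V[OF t that, of 0 n]
          by (cases "V n 0 (indicator {t..}) x") (auto simp: Vr_def enn2ereal_ennreal)
      qed
      have "Vr n 0 (indicator {t..}) \<in> P_zero_plus I w n"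
        unfolding P_zero_plus_def by (intro CollectI bexI[OF _ t] ballI) (rule p[symmetric])
      then have "Vr n 0 (indicator {t..}) \<in> G"
        using assms(6) by blast
      moreover have "integral_ge \<nu>1 \<nu>2 (p_fun_plus w t 0 n)
          = integral_ge \<nu>1 \<nu>2 (\<lambda>x. ereal (Vr n 0 (indicator {t..}) x))"
        by (rule integral_ge_cong(1)[OF sp]) (rule p)
      ultimately show "integral_ge \<nu>1 \<nu>2 (p_fun_plus w t 0 n)"
        using ge by blast
    }
  next
    fix f assume conds: "(\<forall>i\<in>{0..k - 1}. integral_eq_real \<nu>1 \<nu>2 (p_fun w (ereal s) 0 i)) \<and>
      (\<forall>j\<in>F_index I w k n. integral_ge \<nu>1 \<nu>2 (p_az_fun I w z 0 k j)) \<and>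
      (\<forall>t\<in>I. integral_ge \<nu>1 \<nu>2 (p_fun_plus w t 0 n))" and f: "f \<in> G"
    define m where "m = k - 1"
    have k: "k = Suc m" using assms(4) by (simp add: m_def)
    interpret dual_problem I w \<nu>1 \<nu>2 s z m
    proof unfold_locales
      fix i assume "i \<le> m"
      then have "integral_eq_real \<nu>1 \<nu>2 (p_fun w (ereal s) 0 i)"
        using conds by (simp add: m_def)
      then show "integrable \<nu>1 (?P i)" "integrable \<nu>2 (?P i)" "(\<integral>x. ?P i x \<partial>\<nu>1) = (\<integral>x. ?P i x \<partial>\<nu>2)"
        by (simp_all add: eq_real)
    qed (fact \<nu> assms)+
    show "integral_ge \<nu>1 \<nu>2 (\<lambda>x. ereal (f x))"
    proof (rule integral_ge_F_plus)
      show "f \<in> F_plus I w (Suc m) n" using f assms(7) k by blast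
      show "m \<le> n" using assms(5) k by simp
    qed (use neg[OF f] conds k integral_ge_p_fun_plus_iff[OF \<nu>] in auto)
  qed
qed

end
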